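(* Let $d\ge1$, let $K\subset\mathbb{C}^d$ be a regular non-pluripolar compact set, let $\tau$ be a finite measure on $K$ satisfying the Bernstein-Markov property on $K$, and let $\{q_\alpha\}_{\alpha\in\mathbb{N}^d}$ be the associated orthonormal polynomials. Let $\{\xi_\alpha\}_{\alpha\in\mathbb{N}^d}$ be non-degenerate i.i.d. complex random variables satisfying $\mathbb{P}(|\xi_\alpha|>e^{t})=o(t^{-d})$ as $t\to+\infty$. For $n\ge1$ let $$H_n(z)=\sum_{|\alpha|\le n}\xi_\alpha q_\alpha(z).$$ Then $\frac1n\log|H_n|\to V_K$ in probability in $L^1_{loc}(\mathbb{C}^d)$, and $Z_{H_n}\to dd^cV_K$ in probability in the sense that for every subsequence $Y\subset\mathbb{N}$ there is a further subsequence $Y^*\subset Y$ such that $$\lim_{n\in Y^*}Z_{H_n}=dd^cV_K\qquad\text{almost surely,}$$ where the limit is in the sense of currents.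
   Context: Here $\mathbb{N}=\{0,1,2,\dots\}$ for multi-indices, $|\alpha|=\alpha_1+\dots+\alpha_d$ and $z^\alpha=z_1^{\alpha_1}\cdots z_d^{\alpha_d}$. For $K\subset\mathbb{C}^d$ compact, $V_K(z)=\sup\{\frac{1}{\deg p}\log|p(z)| : p \text{ a non-constant polynomial with } \sup_K|p|\le1\}$; $K$ is regular if $V_K$ is continuous on $\mathbb{C}^d$. $\tau$ satisfies the Bernstein-Markov property on $K$ if for every $\epsilon>0$ there is $M>0$ such that for all $n$ and all polynomials $p$ of total degree at most $n$, $\sup_K|p|\le Me^{\epsilon n}\|p\|_{L^2(\tau)}$. Multi-indices are ordered by: $\alpha>\beta$ if $|\alpha|>|\beta|$, or if $|\alpha|=|\beta|$ and there is $l\in\{1,\dots,d\}$ with $\alpha_l>\beta_l$ and $\alpha_k=\beta_k$ for $k<l$. The polynomials $q_\alpha$ are obtained by applying Gram-Schmidt in $L^2(\tau)$ to the monomials $z^\alpha$ in this order (so $q_\alpha$ is a linear combination of $z^\beta$, $\beta\le\alpha$, with nonzero coefficient of $z^\alpha$). A random variable is non-degenerate if its law is supported on at least two points. $Z_{H_n}=dd^c\left(\frac1n\log|H_n|\right)$ is a positive $(1,1)$ current, where $dd^c=\frac{i}{\pi}\partial\overline{\partial}$; convergence of currents means convergence when paired with each smooth compactly supported $(d-1,d-1)$ test form. $L^1_{loc}(\mathbb{C}^d)$ carries its usual metrizable topology of $L^1$ convergence on compact sets. On the event $H_n\equiv0$ (whose probability tends to $0$) one may assign arbitrary values to $\frac1n\log|H_n|$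 and $Z_{H_n}$. *)

theory Defs
  imports "HOL-Probability.Probability" "HOL-Library.Poly_Mapping" "HOL-Library.Landau_Symbols"
begin

text \<open>
  The space of \<open>d\<close> complex variables is \<open>complex ^ 'd\<close> with \<open>d = CARD('d)\<close>. The index type is
  linearly ordered because both the order on multi-indices and the signs in the calculus of
  differential forms refer to the order of the coordinates.
\<close>

type_synonym 'd cspace = "(complex, 'd) vec"
type_synonym 'd multiindex = "(nat, 'd) vec"


section \<open>Polynomials in several variables\<close>

definition mi_size :: "'d::finite multiindex \<Rightarrow> nat" where
  "mi_size \<alpha> = (\<Sum>i\<in>UNIV. \<alpha> $ i)"

definition mi_less :: "'d::{finite,linorder} multiindex \<Rightarrow> 'd multiindex \<Rightarrow> bool" where
  "mi_less \<beta> \<alpha> \<longleftrightarrow> mi_size \<beta> < mi_size \<alpha> \<or>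
     (mi_size \<beta> = mi_size \<alpha> \<and> (\<exists>l. \<beta> $ l < \<alpha> $ l \<and> (\<forall>k<l. \<beta> $ k = \<alpha> $ k)))"

definition monomial :: "'d::finite multiindex \<Rightarrow> 'd cspace \<Rightarrow> complex" where
  "monomial \<alpha> z = (\<Prod>i\<in>UNIV. (z $ i) ^ (\<alpha> $ i))"

text \<open>A polynomial is its finitely supported family of coefficients.\<close>

type_synonym 'd cpoly = "'d multiindex \<Rightarrow>\<^sub>0 complex"

definition poly_eval :: "'d::finite cpoly \<Rightarrow> 'd cspace \<Rightarrow> complex" where
  "poly_eval p z = (\<Sum>\<alpha>\<in>Poly_Mapping.keys p. Poly_Mapping.lookup p \<alpha> * monomial \<alpha> z)"

definition total_degree :: "'d::finite cpoly \<Rightarrow> nat" where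
  "total_degree p = Max (insert 0 (mi_size ` Poly_Mapping.keys p))"


section \<open>Pluripotential theory\<close>

definition log_abs :: "complex \<Rightarrow> ereal" where
  "log_abs w = (if w = 0 then -\<infinity> else ereal (ln (cmod w)))"

definition extremal_function :: "'d::finite cspace set \<Rightarrow> 'd cspace \<Rightarrow> ereal" where
  "extremal_function K z =
     (SUP p\<in>{p. total_degree p > 0 \<and> (\<forall>x\<in>K. cmod (poly_eval p x) \<le> 1)}.
        log_abs (poly_eval p z) / ereal (real (total_degree p)))"

definition regular_set :: "'d::finite cspace set \<Rightarrow> bool" where
  "regular_set K \<longleftrightarrow> continuous_on UNIV (extremal_function K)"

text \<open>The Lebesgue integral of an extended real function as the difference of the integrals of
  its positive and negative parts (\<^const>\<open>e2ennreal\<close> truncates negative values to \<open>0\<close>).\<close>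

definition ereal_integral :: "'a measure \<Rightarrow> ('a \<Rightarrow> ereal) \<Rightarrow> ereal" where
  "ereal_integral M f =
     enn2ereal (\<integral>\<^sup>+x. e2ennreal (f x) \<partial>M) - enn2ereal (\<integral>\<^sup>+x. e2ennreal (- f x) \<partial>M)"

text \<open>Plurisubharmonic on the whole space: upper semicontinuous, never \<open>\<infinity>\<close>, and satisfying the
  sub-mean value inequality on every complex line. The constant \<open>-\<infinity>\<close> is allowed here and
  excluded in the definition of pluripolar sets.\<close>

definition plurisubharmonic :: "('d::finite cspace \<Rightarrow> ereal) \<Rightarrow> bool" where
  "plurisubharmonic u \<longleftrightarrow>
     (\<forall>z. u z < \<infinity>) \<and> (\<forall>c. open {z. u z < c}) \<and>
     (\<forall>a b. u a \<le> ereal_integral (restrict_space lborel {0..2 * pi}) (\<lambda>\<theta>. u (a + cis \<theta> *s b))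
                    / ereal (2 * pi))"

definition pluripolar :: "'d::finite cspace set \<Rightarrow> bool" where
  "pluripolar E \<longleftrightarrow> (\<exists>u. plurisubharmonic u \<and> (\<exists>z. u z \<noteq> -\<infinity>) \<and> (\<forall>z\<in>E. u z = -\<infinity>))"


section \<open>Orthonormal polynomials\<close>

definition L2_inner :: "'a measure \<Rightarrow> ('a \<Rightarrow> complex) \<Rightarrow> ('a \<Rightarrow> complex) \<Rightarrow> complex" where
  "L2_inner \<tau> f g = (\<integral>z. f z * cnj (g z) \<partial>\<tau>)"

definition L2_nrm :: "'a measure \<Rightarrow> ('a \<Rightarrow> complex) \<Rightarrow> real" where
  "L2_nrm \<tau> f = sqrt (\<integral>z. (cmod (f z))\<^sup>2 \<partial>\<tau>)"

definition bernstein_markov ::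
    "'d::finite cspace set \<Rightarrow> 'd cspace measure \<Rightarrow> bool" where
  "bernstein_markov K \<tau> \<longleftrightarrow>
     (\<forall>\<epsilon>>0. \<exists>M>0. \<forall>n p. total_degree p \<le> n \<longrightarrow>
        (\<forall>z\<in>K. cmod (poly_eval p z) \<le> M * exp (\<epsilon> * real n) * L2_nrm \<tau> (poly_eval p)))"

lemma mi_less_trans:
  assumes "mi_less \<alpha> \<beta>" "mi_less \<beta> \<gamma>"
  shows "mi_less \<alpha> \<gamma>"
proof -
  have "\<exists>l. \<alpha> $ l < \<gamma> $ l \<and> (\<forall>k<l. \<alpha> $ k = \<gamma> $ k)"
    if l: "\<alpha> $ l < \<beta> $ l" "\<forall>k<l. \<alpha> $ k = \<beta> $ k"
      and m: "\<beta> $ m < \<gamma> $ m" "\<forall>k<m. \<beta> $ k = \<gamma> $ k" for l m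
    using l m by (intro exI[of _ "min l m"]) (cases l m rule: linorder_cases; force simp: min_def)
  then show ?thesis
    using assms unfolding mi_less_def by auto
qed

lemma mi_less_irrefl: "\<not> mi_less \<alpha> \<alpha>"
  unfolding mi_less_def by auto

lemma finite_mi_size_le: "finite {\<alpha> :: 'd::finite multiindex. mi_size \<alpha> \<le> n}"
proof -
  have le: "\<alpha> $ i \<le> mi_size \<alpha>" for \<alpha> :: "'d multiindex" and i
    unfolding mi_size_def by (rule member_le_sum) auto
  have "\<alpha> \<in> vec_lambda ` (\<Pi>\<^sub>E i\<in>UNIV. {..n})" if "mi_size \<alpha> \<le> n" for \<alpha> :: "'d multiindex"
    using le[of \<alpha>] that by (intro image_eqI[of _ _ "vec_nth \<alpha>"]) (auto intro: order_trans)
  then have "{\<alpha> :: 'd multiindex. mi_size \<alpha> \<le> n} \<subseteq> vec_lambda ` (\<Pi>\<^sub>E i\<in>UNIV. {..n})"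
    by blast
  then show ?thesis
    by (rule finite_subset) (intro finite_imageI finite_PiE, auto)
qed

lemma finite_mi_less: "finite {\<beta>. mi_less \<beta> \<alpha>}"
  by (rule finite_subset[OF _ finite_mi_size_le[of "mi_size \<alpha>"]]) (auto simp: mi_less_def)

lemma card_mi_less_mono:
  assumes "mi_less \<beta> \<alpha>"
  shows "card {\<gamma>. mi_less \<gamma> \<beta>} < card {\<gamma>. mi_less \<gamma> \<alpha>}"
proof (rule psubset_card_mono[OF finite_mi_less])
  show "{\<gamma>. mi_less \<gamma> \<beta>} \<subset> {\<gamma>. mi_less \<gamma> \<alpha>}"
    using assms mi_less_trans mi_less_irrefl by blast
qed

text \<open>The Gram--Schmidt process applied to the monomials.\<close>

function gram_schmidt ::
    "'d::{finite,linorder} cspace measure \<Rightarrow> 'd multiindex \<Rightarrow> 'd cspace \<Rightarrow> complex" where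
  "gram_schmidt \<tau> \<alpha> =
     (let v = (\<lambda>z. monomial \<alpha> z -
                (\<Sum>\<beta>\<in>{\<beta>. mi_less \<beta> \<alpha>}.
                   L2_inner \<tau> (monomial \<alpha>) (gram_schmidt \<tau> \<beta>) * gram_schmidt \<tau> \<beta> z))
      in (\<lambda>z. v z / complex_of_real (L2_nrm \<tau> v)))"
  by pat_completeness auto
termination
  by (relation "measures [\<lambda>(\<tau>, \<alpha>). card {\<beta>. mi_less \<beta> \<alpha>}]") (auto intro: card_mi_less_mono)

declare gram_schmidt.simps [simp del]


section \<open>Differential forms and currents\<close>

primrec C_k :: "nat \<Rightarrow> ('a::real_normed_vector \<Rightarrow> 'b::real_normed_vector) \<Rightarrow> bool" where
  "C_k 0 f \<longleftrightarrow> continuous_on UNIV f"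
| "C_k (Suc k) f \<longleftrightarrow>
     (\<forall>x. f differentiable (at x)) \<and> (\<forall>v. C_k k (\<lambda>x. frechet_derivative f (at x) v))"

definition smooth :: "('a::euclidean_space \<Rightarrow> 'b::real_normed_vector) \<Rightarrow> bool" where
  "smooth f \<longleftrightarrow> (\<forall>k. C_k k f)"

definition del_coord :: "'d::finite \<Rightarrow> ('d cspace \<Rightarrow> complex) \<Rightarrow> 'd cspace \<Rightarrow> complex" where
  "del_coord j f z =
     (frechet_derivative f (at z) (axis j 1) - \<i> * frechet_derivative f (at z) (axis j \<i>)) / 2"

definition delbar_coord :: "'d::finite \<Rightarrow> ('d cspace \<Rightarrow> complex) \<Rightarrow> 'd cspace \<Rightarrow> complex" where
  "delbar_coord j f z =
     (frechet_derivative f (at z) (axis j 1) + \<i> * frechet_derivative f (at z) (axis j \<i>)) / 2"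

text \<open>
  A differential form is given by its coefficients: \<open>\<phi>\<close> stands for the sum of
  \<open>\<phi> I J dz\<^sub>I \<and> d\<bar>z\<^sub>J\<close> over all sets \<open>I\<close> and \<open>J\<close> of coordinates, where the factors of
  \<open>dz\<^sub>I\<close> and of \<open>d\<bar>z\<^sub>J\<close> are in increasing order of the indices.
\<close>

type_synonym 'd cform = "'d set \<Rightarrow> 'd set \<Rightarrow> 'd cspace \<Rightarrow> complex"

text \<open>The signs come from sorting \<open>dz\<^sub>j \<and> dz\<^sub>I\<^sub>-\<^sub>j \<and> d\<bar>z\<^sub>J\<close> and \<open>d\<bar>z\<^sub>k \<and> dz\<^sub>I \<and> d\<bar>z\<^sub>J\<^sub>-\<^sub>k\<close>.\<close>

definition form_del :: "'d::{finite,linorder} cform \<Rightarrow> 'd cform" where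
  "form_del \<phi> I J z = (\<Sum>j\<in>I. (-1) ^ card {i\<in>I. i < j} * del_coord j (\<phi> (I - {j}) J) z)"

definition form_delbar :: "'d::{finite,linorder} cform \<Rightarrow> 'd cform" where
  "form_delbar \<phi> I J z =
     (\<Sum>k\<in>J. (-1) ^ (card I + card {j\<in>J. j < k}) * delbar_coord k (\<phi> I (J - {k})) z)"

definition form_ddc :: "'d::{finite,linorder} cform \<Rightarrow> 'd cform" where
  "form_ddc \<phi> I J z = \<i> / complex_of_real pi * form_del (form_delbar \<phi>) I J z"

text \<open>
  Integral of the top degree part, using
  \<open>dz\<^sub>1 \<and> \<dots> \<and> dz\<^sub>d \<and> d\<bar>z\<^sub>1 \<and> \<dots> \<and> d\<bar>z\<^sub>d = (-1)\<^bsup>d(d-1)/2\<^esup> (dz\<^sub>1 \<and> d\<bar>z\<^sub>1) \<and> \<dots> \<and> (dz\<^sub>d \<and> d\<bar>z\<^sub>d)\<close>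
  and \<open>dz \<and> d\<bar>z = -2i dx \<and> dy\<close>.
\<close>

definition form_integral :: "'d::{finite,linorder} cform \<Rightarrow> complex" where
  "form_integral \<psi> =
     (\<integral>z. (-1) ^ (CARD('d) * (CARD('d) - 1) div 2) * (-2 * \<i>) ^ CARD('d) * \<psi> UNIV UNIV z \<partial>lborel)"

text \<open>Test forms of bidegree \<open>(p, p)\<close>.\<close>

definition test_forms :: "nat \<Rightarrow> 'd::finite cform set" where
  "test_forms p =
     {\<phi>. (\<forall>I J. smooth (\<phi> I J) \<and> compact (closure {z. \<phi> I J z \<noteq> 0})) \<and>
         (\<forall>I J. \<not> (card I = p \<and> card J = p) \<longrightarrow> \<phi> I J = (\<lambda>z. 0))}"

text \<open>For locally integrable \<open>u\<close>, the current \<open>dd\<^sup>c u\<close> is the functional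
  \<open>\<phi> \<mapsto> \<integral> u dd\<^sup>c \<phi>\<close> on test forms of bidegree \<open>(d-1, d-1)\<close>.\<close>

definition ddc_current :: "('d::{finite,linorder} cspace \<Rightarrow> real) \<Rightarrow> 'd cform \<Rightarrow> complex" where
  "ddc_current u \<phi> = form_integral (\<lambda>I J z. complex_of_real (u z) * form_ddc \<phi> I J z)"

definition currents_tendsto ::
    "(nat \<Rightarrow> 'd::finite cform \<Rightarrow> complex) \<Rightarrow> ('d cform \<Rightarrow> complex) \<Rightarrow> bool" where
  "currents_tendsto T S \<longleftrightarrow> (\<forall>\<phi>\<in>test_forms (CARD('d) - 1). (\<lambda>k. T k \<phi>) \<longlonglongrightarrow> S \<phi>)"


section \<open>Probability\<close>

definition measure_support :: "'a::topological_space measure \<Rightarrow> 'a set" where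
  "measure_support \<mu> = {x. \<forall>U. open U \<and> x \<in> U \<longrightarrow> emeasure \<mu> U > 0}"

definition nondegenerate :: "'w measure \<Rightarrow> ('w \<Rightarrow> complex) \<Rightarrow> bool" where
  "nondegenerate M X \<longleftrightarrow>
     (\<exists>a b. a \<noteq> b \<and> {a, b} \<subseteq> measure_support (distr M borel X))"

text \<open>
  Convergence in probability, in the space of locally integrable functions, to a deterministic
  limit: every neighbourhood of \<open>f\<close> has probability tending to \<open>1\<close>. The sets
  \<open>{g. \<integral>\<^sub>C \<bar>g - f\<bar> \<le> \<epsilon>}\<close> form a basis of neighbourhoods of \<open>f\<close>. The integrals are taken in
  \<^typ>\<open>ennreal\<close>, so that a function that is not integrable over \<open>C\<close> is at distance \<open>\<infinity>\<close>.
\<close>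

definition tendsto_prob_L1loc ::
    "'w measure \<Rightarrow> (nat \<Rightarrow> 'w \<Rightarrow> 'a::euclidean_space \<Rightarrow> real) \<Rightarrow> ('a \<Rightarrow> real) \<Rightarrow> bool" where
  "tendsto_prob_L1loc M X f \<longleftrightarrow>
     (\<forall>C \<epsilon>. compact C \<and> \<epsilon> > 0 \<longrightarrow>
        (let E = (\<lambda>n. {w \<in> space M. (\<integral>\<^sup>+z\<in>C. ennreal \<bar>X n w z - f z\<bar> \<partial>lborel) > ennreal \<epsilon>})
         in (\<forall>n. E n \<in> sets M) \<and> (\<lambda>n. measure M (E n)) \<longlonglongrightarrow> 0))"

definition random_poly ::
    "'d::{finite,linorder} cspace measure \<Rightarrow> ('d multiindex \<Rightarrow> 'w \<Rightarrow> complex)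
       \<Rightarrow> nat \<Rightarrow> 'w \<Rightarrow> 'd cspace \<Rightarrow> complex" where
  "random_poly \<tau> \<xi> n w z = (\<Sum>\<alpha> | mi_size \<alpha> \<le> n. \<xi> \<alpha> w * gram_schmidt \<tau> \<alpha> z)"

text \<open>
  The potential \<open>1/n log \<bar>H\<^sub>n\<bar>\<close>. Because of \<open>ln 0 = 0\<close> it is real-valued; this changes it on a
  Lebesgue null set, except when \<open>H\<^sub>n\<close> vanishes identically, where it is assigned the value \<open>0\<close>.
\<close>

definition random_potential ::
    "'d::{finite,linorder} cspace measure \<Rightarrow> ('d multiindex \<Rightarrow> 'w \<Rightarrow> complex)
       \<Rightarrow> nat \<Rightarrow> 'w \<Rightarrow> 'd cspace \<Rightarrow> real" where
  "random_potential \<tau> \<xi> n w z = ln (cmod (random_poly \<tau> \<xi> n w z)) / real n"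

definition zero_current ::
    "'d::{finite,linorder} cspace measure \<Rightarrow> ('d multiindex \<Rightarrow> 'w \<Rightarrow> complex)
       \<Rightarrow> nat \<Rightarrow> 'w \<Rightarrow> 'd cform \<Rightarrow> complex" where
  "zero_current \<tau> \<xi> n w = ddc_current (random_potential \<tau> \<xi> n w)"

end

theory Submission
  imports Defs "HOL-Complex_Analysis.Conformal_Mappings"
    "HOL-Computational_Algebra.Fundamental_Theorem_Algebra" "HOL-Real_Asymp.Real_Asymp"
begin

text \<open>The potentials \<open>u\<^sub>n = 1/n log \<bar>H\<^sub>n\<bar>\<close> are bounded above by \<open>V\<^sub>K + \<epsilon>\<close> with probability tending to
  \<open>1\<close>, by the tail condition, the Bernstein-Markov property and the Bernstein-Walsh inequality.
  Conversely every nonempty open set contains, with probability close to \<open>1\<close>, a point where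
  \<open>u\<^sub>n \<ge> V\<^sub>K - \<epsilon>\<close>. Where \<open>V\<^sub>K > 0\<close>, many of the values \<open>\<bar>q\<^sub>\<alpha>(z)\<bar>\<close> are larger than
  \<open>exp (n (V\<^sub>K(z) - \<epsilon>))\<close> and lie far apart from each other; if \<open>\<bar>H\<^sub>n(z)\<bar>\<close> is small, the
  corresponding coefficients lie one after another in small balls determined by the previous ones,
  which by non-degeneracy has exponentially small probability in their number. Where \<open>V\<^sub>K = 0\<close> on an
  open set, smallness of \<open>H\<^sub>n\<close> at finitely many points confines the coefficients of the first few
  \<open>q\<^sub>\<alpha>\<close> to small balls, since these are linearly independent there.

  By the sub-mean value property of \<open>log \<bar>H\<^sub>n\<bar>\<close>, the upper bound together with one good point in each
  ball of a fine covering makes the \<open>L\<^sup>1\<close> distance of \<open>u\<^sub>n\<close> and \<open>V\<^sub>K\<close> on a compact set small. The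
  statement on currents follows along a subsequence by the Borel-Cantelli lemma.\<close>


section \<open>Polynomial functions\<close>

text \<open>Non-degeneracy gives no density: the law of the coefficients may have atoms, so a set of
  small diameter is only known to have probability at most some \<open>\<theta> < 1\<close>. The
  lower bound must combine \<open>J\<close> coefficients into a probability
  \<open>\<theta> ^ J\<close>, and for this each of them has to be recovered from values of
  \<open>H\<close> up to a fixed small error. At a point where V > 0, polynomials \<open>q\<close>
  of well separated size make this possible with one evaluation; on an open set where V = 0 there is
  no growth to separate them, hence the use of several points.

  The exponent d of the tail condition matches the union bound over the indices of size at most n,
  whose number is of order n^d.

  The passage to L1 convergence is quantitative and uses no compactness of families of
  plurisubharmonic functions, so finitely many sample balls have to be fixed before n.

  The convention \<open>ln 0 = 0\<close> breaks mean value inequalities at zeros; nonvanishing at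
  the centre and a bound \<open>A \<ge> 0\<close> in \<open>A - ln (cmod (p z))\<close> keep the
  statements true.\<close>

definition mono_span :: "'d::finite multiindex set \<Rightarrow> ('d cspace \<Rightarrow> complex) set" where
  "mono_span A = {f. \<exists>c. \<forall>z. f z = (\<Sum>\<alpha>\<in>A. c \<alpha> * monomial \<alpha> z)}"

text \<open>Degree bounds are the usual case; spans over other index sets are needed for the initial
  segments of the monomial order in Gram-Schmidt.\<close>

abbreviation poly_fun :: "nat \<Rightarrow> ('d::finite cspace \<Rightarrow> complex) set" where
  "poly_fun n \<equiv> mono_span {\<alpha>. mi_size \<alpha> \<le> n}"

lemma mi_size_add: "mi_size (\<alpha> + \<beta>) = mi_size \<alpha> + mi_size \<beta>"
  by (simp add: mi_size_def sum.distrib)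

lemma monomial_add: "monomial (\<alpha> + \<beta>) z = monomial \<alpha> z * monomial \<beta> z"
  by (simp add: monomial_def power_add prod.distrib)

lemma mono_span_lincomb:
  assumes "finite B" "A \<subseteq> B"
  shows "(\<lambda>z. \<Sum>\<alpha>\<in>A. c \<alpha> * monomial \<alpha> z) \<in> mono_span B"
proof -
  have "(\<Sum>\<alpha>\<in>A. c \<alpha> * monomial \<alpha> z) =
      (\<Sum>\<alpha>\<in>B. (if \<alpha> \<in> A then c \<alpha> else 0) * monomial \<alpha> z)" for z :: "'a cspace"
    by (rule sum.mono_neutral_cong_left) (use assms in auto)
  then show ?thesis unfolding mono_span_def by (intro CollectI exI allI)
qed

lemma mono_span_monomial: "finite A \<Longrightarrow> \<alpha> \<in> A \<Longrightarrow> monomial \<alpha> \<in> mono_span A"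
  using mono_span_lincomb[of A "{\<alpha>}" "\<lambda>_. 1"] by simp

lemma mono_span_cmult: "f \<in> mono_span A \<Longrightarrow> (\<lambda>z. a * f z) \<in> mono_span A"
  unfolding mono_span_def
proof clarify
  fix c assume "\<forall>z. f z = (\<Sum>\<alpha>\<in>A. c \<alpha> * monomial \<alpha> z)"
  then show "\<exists>c. \<forall>z. a * f z = (\<Sum>\<alpha>\<in>A. c \<alpha> * monomial \<alpha> z)"
    by (intro exI[of _ "\<lambda>\<alpha>. a * c \<alpha>"]) (simp add: sum_distrib_left mult_ac)
qed

lemma mono_span_add: "f \<in> mono_span A \<Longrightarrow> g \<in> mono_span A \<Longrightarrow> (\<lambda>z. f z + g z) \<in> mono_span A"
  unfolding mono_span_def
proof clarify
  fix c d assume "\<forall>z. f z = (\<Sum>\<alpha>\<in>A. c \<alpha> * monomial \<alpha> z)"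
    "\<forall>z. g z = (\<Sum>\<alpha>\<in>A. d \<alpha> * monomial \<alpha> z)"
  then show "\<exists>c. \<forall>z. f z + g z = (\<Sum>\<alpha>\<in>A. c \<alpha> * monomial \<alpha> z)"
    by (intro exI[of _ "\<lambda>\<alpha>. c \<alpha> + d \<alpha>"]) (simp add: sum.distrib algebra_simps)
qed

lemma mono_span_sum:
  assumes "\<And>i. i \<in> S \<Longrightarrow> f i \<in> mono_span A"
  shows "(\<lambda>z. \<Sum>i\<in>S. f i z) \<in> mono_span A"
proof -
  have "(\<lambda>z. 0) \<in> mono_span A"
    unfolding mono_span_def by (intro CollectI exI[of _ "\<lambda>_. 0"]) simp
  with assms show ?thesis
  proof (induction S rule: infinite_finite_induct)
    case (insert x F)
    then show ?case using mono_span_add[of "f x" A "\<lambda>z. \<Sum>i\<in>F. f i z"] by simp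
  qed simp_all
qed

lemma mono_span_diff: "f \<in> mono_span A \<Longrightarrow> g \<in> mono_span A \<Longrightarrow> (\<lambda>z. f z - g z) \<in> mono_span A"
  using mono_span_add[OF _ mono_span_cmult, of f A g "-1"] by simp

lemma mono_span_mono: "f \<in> mono_span A \<Longrightarrow> A \<subseteq> B \<Longrightarrow> finite B \<Longrightarrow> f \<in> mono_span B"
proof -
  assume "f \<in> mono_span A" and AB: "A \<subseteq> B" "finite B"
  then obtain c where "f = (\<lambda>z. \<Sum>\<alpha>\<in>A. c \<alpha> * monomial \<alpha> z)"
    unfolding mono_span_def by auto
  then show ?thesis using mono_span_lincomb[OF AB(2,1), of c] by simp
qed

lemma poly_fun_mono: "f \<in> poly_fun m \<Longrightarrow> m \<le> n \<Longrightarrow> f \<in> poly_fun n"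
  by (erule mono_span_mono) (auto simp: finite_mi_size_le)

lemma poly_fun_monomial: "mi_size \<alpha> \<le> n \<Longrightarrow> monomial \<alpha> \<in> poly_fun n"
  by (simp add: mono_span_monomial finite_mi_size_le)

lemma poly_fun_mult:
  assumes "f \<in> poly_fun m" "g \<in> poly_fun n"
  shows "(\<lambda>z. f z * g z) \<in> poly_fun (m + n)"
proof -
  obtain c where c: "\<And>z. f z = (\<Sum>\<alpha> | mi_size \<alpha> \<le> m. c \<alpha> * monomial \<alpha> z)"
    using assms(1) unfolding mono_span_def by auto
  obtain d where d: "\<And>z. g z = (\<Sum>\<alpha> | mi_size \<alpha> \<le> n. d \<alpha> * monomial \<alpha> z)"
    using assms(2) unfolding mono_span_def by auto
  have "f z * g z = (\<Sum>\<alpha> | mi_size \<alpha> \<le> m. \<Sum>\<beta> | mi_size \<beta> \<le> n. c \<alpha> * d \<beta> * monomial (\<alpha> + \<beta>) z)" for z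
    unfolding c d sum_product by (simp add: monomial_add mult_ac)
  moreover have "(\<lambda>z. \<Sum>\<alpha> | mi_size \<alpha> \<le> m. \<Sum>\<beta> | mi_size \<beta> \<le> n. c \<alpha> * d \<beta> * monomial (\<alpha> + \<beta>) z)
      \<in> poly_fun (m + n)"
    by (intro mono_span_sum mono_span_cmult poly_fun_monomial) (auto simp: mi_size_add)
  ultimately show ?thesis by simp
qed

lemma poly_fun_const: "(\<lambda>z. a) \<in> poly_fun n"
  using mono_span_cmult[OF poly_fun_monomial[of 0 n], of a]
  by (simp add: mi_size_def monomial_def)

lemma poly_fun_power: "f \<in> poly_fun m \<Longrightarrow> (\<lambda>z. f z ^ k) \<in> poly_fun (k * m)"
proof (induction k)
  case 0
  show ?case using poly_fun_const[of 1 0] by simp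
next
  case (Suc k)
  then show ?case using poly_fun_mult[of f m "\<lambda>z. f z ^ k" "k * m"] by simp
qed

lemma poly_eval_poly_fun: "poly_eval p \<in> poly_fun (total_degree p)"
proof -
  have "mi_size \<alpha> \<le> total_degree p" if "\<alpha> \<in> Poly_Mapping.keys p" for \<alpha>
    unfolding total_degree_def using that by (intro Max_ge) auto
  then show ?thesis
    unfolding poly_eval_def[abs_def] by (intro mono_span_lincomb finite_mi_size_le) auto
qed

text \<open>The way back to coefficient families, over which the extremal function and the
  Bernstein-Markov property quantify. The degree is only bounded by \<open>n\<close>, as leading
  coefficients may vanish.\<close>

lemma poly_fun_eq_poly_eval:
  assumes "f \<in> poly_fun n"
  obtains p where "total_degree p \<le> n" "f = poly_eval p"
proof -
  obtain c where c: "\<And>z. f z = (\<Sum>\<alpha> | mi_size \<alpha> \<le> n. c \<alpha> * monomial \<alpha> z)"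
    using assms unfolding mono_span_def by auto
  \<comment> \<open>The family \<open>c\<close> is arbitrary beyond degree \<open>n\<close>; cutting
    it off makes it finitely supported.\<close>
  define c' where "c' = (\<lambda>\<alpha>. if mi_size \<alpha> \<le> n then c \<alpha> else 0)"
  have fin: "finite {\<alpha>. c' \<alpha> \<noteq> 0}"
    by (rule finite_subset[OF _ finite_mi_size_le[of n]]) (auto simp: c'_def)
  define p where "p = Abs_poly_mapping c'"
  have lk: "Poly_Mapping.lookup p = c'"
    unfolding p_def using fin by (rule lookup_Abs_poly_mapping)
  have keys: "Poly_Mapping.keys p \<subseteq> {\<alpha>. mi_size \<alpha> \<le> n}"
    by (auto simp: keys_eq_empty in_keys_iff lk c'_def split: if_splits)
  have "total_degree p \<le> n"
    unfolding total_degree_def using keys by (subst Max_le_iff) auto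
  moreover have "f z = poly_eval p z" for z
    unfolding c poly_eval_def
    by (rule sum.mono_neutral_cong_right[OF finite_mi_size_le keys])
       (auto simp: in_keys_iff lk c'_def)
  ultimately show ?thesis using that by blast
qed

text \<open>Restriction to a complex line is how one-variable theory enters: the identity theorem,
  the sub-mean value inequality and the growth estimate all rest on it.\<close>

lemma poly_fun_line:
  assumes "f \<in> poly_fun n"
  obtains g where "degree g \<le> n" "\<And>\<zeta>. f (a + \<zeta> *s b) = poly g \<zeta>"
proof -
  obtain c where c: "\<And>z. f z = (\<Sum>\<alpha> | mi_size \<alpha> \<le> n. c \<alpha> * monomial \<alpha> z)"
    using assms unfolding mono_span_def by auto
  define g where "g = (\<Sum>\<alpha> | mi_size \<alpha> \<le> n. smult (c \<alpha>) (\<Prod>i\<in>UNIV. [:a $ i, b $ i:] ^ (\<alpha> $ i)))"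
  have "degree (\<Prod>i\<in>UNIV. [:a $ i, b $ i:] ^ (\<alpha> $ i)) \<le> mi_size \<alpha>" for \<alpha>
  proof -
    have "degree ([:a $ i, b $ i:] ^ (\<alpha> $ i)) \<le> \<alpha> $ i" for i
      by (rule order_trans[OF degree_power_le]) simp
    then show ?thesis
      unfolding mi_size_def by (intro order_trans[OF degree_prod_sum_le]) (auto intro: sum_mono)
  qed
  then have "degree g \<le> n"
    unfolding g_def by (intro degree_sum_le finite_mi_size_le)
      (auto intro!: order_trans[OF degree_smult_le] dest: order_trans)
  moreover have "f (a + \<zeta> *s b) = poly g \<zeta>" for \<zeta>
    unfolding c g_def poly_sum by (simp add: poly_prod monomial_def mult.commute)
  ultimately show ?thesis using that by blast
qed

lemma continuous_on_monomial: "continuous_on S (monomial \<alpha>)"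
  unfolding monomial_def by (intro continuous_intros)

lemma continuous_on_mono_span: "f \<in> mono_span A \<Longrightarrow> continuous_on S f"
proof -
  assume "f \<in> mono_span A"
  then obtain c where "f = (\<lambda>z. \<Sum>\<alpha>\<in>A. c \<alpha> * monomial \<alpha> z)"
    unfolding mono_span_def by auto
  then show ?thesis
    by (auto intro!: continuous_intros continuous_on_monomial)
qed

text \<open>A geometric sum whose ratio is an N-th root of unity; the ratio differs from 1 for
  distinct \<open>a\<close>, \<open>b\<close> because they differ by less than
  \<open>N\<close>.\<close>

lemma sum_roots_of_unity_power:
  fixes a b N :: nat
  assumes "a < N" "b < N"
  shows "(\<Sum>k<N. cis (2 * pi * real k * (real a - real b) / real N)) = (if a = b then of_nat N else 0)"
proof (cases "a = b")
  case False
  define w where "w = cis (2 * pi * (real a - real b) / real N)"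
  have "cis (2 * pi * real k * (real a - real b) / real N) = w ^ k" for k
    unfolding w_def Complex.DeMoivre by (rule arg_cong[of _ _ cis]) (simp add: field_simps)
  moreover have "w \<noteq> 1"
  proof
    assume "w = 1"
    then have "cos (2 * pi * (real a - real b) / real N) = 1"
      by (auto simp: w_def complex_eq_iff)
    then obtain j :: int where "2 * pi * (real a - real b) / real N = of_int j * 2 * pi"
      unfolding cos_one_2pi_int by (auto simp: mult_ac)
    then have "2 * pi * (real a - real b) = 2 * pi * (of_int j * real N)"
      using assms by (simp add: field_simps)
    then have "real a - real b = of_int j * real N"
      by (subst (asm) mult_left_cancel) auto
    then have "int a - int b = j * int N"
      by (metis of_int_diff of_int_eq_iff of_int_mult of_int_of_nat_eq)
    moreover have "\<bar>int a - int b\<bar> < int N" using assms by auto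
    ultimately have "\<bar>j\<bar> * int N < 1 * int N" by (auto simp: abs_mult)
    then have "j = 0" using assms by (simp only: mult_less_cancel_right) auto
    with \<open>int a - int b = j * int N\<close> False show False by simp
  qed
  moreover have "w ^ N = 1"
  proof -
    have "w ^ N = cis (2 * pi * (real a - real b))" using assms by (simp add: w_def Complex.DeMoivre)
    also have "\<dots> = cis (2 * pi * of_int (int a - int b))" by simp
    also have "\<dots> = 1" by (rule cis_multiple_2pi) auto
    finally show ?thesis .
  qed
  ultimately show ?thesis
    using False by (simp add: sum_gp_strict)
qed simp

text \<open>Discrete Fourier inversion: on the grid of points whose coordinates are N-th roots of
  unity, monomials are characters of a finite group, and they are distinct, hence orthogonal, once N
  exceeds all exponents.\<close>

lemma monomials_independent:
  assumes "finite A" "\<And>z. (\<Sum>\<alpha>\<in>A. c \<alpha> * monomial \<alpha> z) = 0" "\<beta> \<in> A"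
  shows "c \<beta> = 0"
proof -
  define N where "N = Suc (Max (mi_size ` A))"
  have small: "\<alpha> $ i < N" if "\<alpha> \<in> A" for \<alpha> i
  proof -
    have "\<alpha> $ i \<le> mi_size \<alpha>" unfolding mi_size_def by (rule member_le_sum) auto
    also have "\<dots> \<le> Max (mi_size ` A)" using that assms(1) by simp
    finally show ?thesis by (simp add: N_def)
  qed
  define G where "G = (UNIV :: 'a set) \<rightarrow>\<^sub>E {..<N}"
  define pt where "pt = (\<lambda>g :: 'a \<Rightarrow> nat. \<chi> i. cis (2 * pi * real (g i) / real N))"
  \<comment> \<open>The conjugate of the monomial with exponent \<beta> on the grid.\<close>
  define wt where "wt = (\<lambda>g :: 'a \<Rightarrow> nat. \<Prod>i\<in>UNIV. cis (- (2 * pi * real (g i) * real (\<beta> $ i) / real N)))"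
  have orth: "(\<Sum>g\<in>G. wt g * monomial \<alpha> (pt g)) = (if \<alpha> = \<beta> then of_nat N ^ CARD('a) else 0)"
    if "\<alpha> \<in> A" for \<alpha>
  proof -
    have "(\<Sum>g\<in>G. wt g * monomial \<alpha> (pt g)) =
        (\<Sum>g\<in>G. \<Prod>i\<in>UNIV. cis (2 * pi * real (g i) * (real (\<alpha> $ i) - real (\<beta> $ i)) / real N))"
      by (intro sum.cong)
         (auto simp: wt_def monomial_def pt_def prod.distrib[symmetric] Complex.DeMoivre cis_mult algebra_simps
            diff_divide_distrib intro!: prod.cong)
    also have "\<dots> = (\<Prod>i\<in>UNIV. \<Sum>k<N. cis (2 * pi * real k * (real (\<alpha> $ i) - real (\<beta> $ i)) / real N))"
      unfolding G_def by (subst prod_sum_PiE) auto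
    also have "\<dots> = (\<Prod>i\<in>UNIV. if \<alpha> $ i = \<beta> $ i then of_nat N else 0)"
      by (intro prod.cong refl sum_roots_of_unity_power small that assms(3))
    also have "\<dots> = (if \<alpha> = \<beta> then of_nat N ^ CARD('a) else 0)"
      by (auto simp: vec_eq_iff)
    finally show ?thesis .
  qed
  have "0 = (\<Sum>g\<in>G. wt g * (\<Sum>\<alpha>\<in>A. c \<alpha> * monomial \<alpha> (pt g)))"
    by (simp add: assms(2))
  also have "\<dots> = (\<Sum>\<alpha>\<in>A. c \<alpha> * (\<Sum>g\<in>G. wt g * monomial \<alpha> (pt g)))"
    unfolding sum_distrib_left by (subst sum.swap) (simp add: mult_ac)
  also have "\<dots> = (\<Sum>\<alpha>\<in>A. c \<alpha> * (if \<alpha> = \<beta> then of_nat N ^ CARD('a) else 0))"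
    by (intro sum.cong refl) (simp add: orth)
  also have "\<dots> = c \<beta> * of_nat N ^ CARD('a)"
    using assms by (simp add: if_distrib sum.delta cong: if_cong)
  finally have "c \<beta> * of_nat N ^ CARD('a) = 0" by simp
  moreover have "N \<noteq> 0" by (simp add: N_def)
  ultimately show ?thesis by simp
qed

text \<open>On the complex line through \<open>a\<close> and \<open>z\<close> the restriction
  vanishes on a disc, so it is the zero polynomial; the parameter 1 gives \<open>z\<close>.\<close>

lemma poly_fun_zero_on_open:
  assumes "f \<in> poly_fun n" "open U" "a \<in> U" "\<And>z. z \<in> U \<Longrightarrow> f z = 0"
  shows "f z = 0"
proof -
  obtain g where g: "\<And>\<zeta>. f (a + \<zeta> *s (z - a)) = poly g \<zeta>"
    using poly_fun_line[OF assms(1)] by metis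
  have "continuous_on UNIV (\<lambda>\<zeta>::complex. a + \<zeta> *s (z - a))"
    unfolding vector_scalar_mult_def by (intro continuous_intros)
  then have op: "open ((\<lambda>\<zeta>::complex. a + \<zeta> *s (z - a)) -` U)"
    using assms(2) by (simp add: continuous_on_open_vimage)
  then obtain e where e: "e > 0" "ball 0 e \<subseteq> (\<lambda>\<zeta>::complex. a + \<zeta> *s (z - a)) -` U"
    using assms(3) openE[OF op, of 0] by auto
  then have "ball 0 e \<subseteq> {\<zeta>. poly g \<zeta> = 0}" using assms(4) g by (metis (mono_tags, lifting) mem_Collect_eq subsetI subsetD vimageD)
  then have "infinite {\<zeta>. poly g \<zeta> = 0}"
    using e(1) infinite_super[OF _ uncountable_infinite[OF uncountable_ball]] by blast
  then have "g = 0" using poly_roots_finite by blast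
  then show ?thesis using g[of 1] by simp
qed


section \<open>Jensen's inequality on circles\<close>

lemma mean_value_circle:
  assumes "f holomorphic_on cball 0 1"
  shows "((\<lambda>t. f (cis (2 * pi * t))) has_integral f 0) {0..1}"
proof -
  have "((\<lambda>u. f u / (u - 0)) has_contour_integral (2 * of_real pi * \<i> * f 0)) (circlepath 0 1)"
    by (rule Cauchy_integral_circlepath_simple[OF assms]) simp
  then have "((\<lambda>t. f (circlepath 0 1 t) / circlepath 0 1 t *
      vector_derivative (circlepath 0 1) (at t within {0..1})) has_integral (2 * of_real pi * \<i> * f 0)) {0..1}"
    by (simp add: has_contour_integral_def)
  then have "((\<lambda>t. (2 * of_real pi * \<i>) * f (cis (2 * pi * t))) has_integral (2 * of_real pi * \<i> * f 0)) {0..1}"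
    by (rule has_integral_cong[THEN iffD1, rotated])
       (simp add: vector_derivative_circlepath01, simp add: circlepath cis_conv_exp mult_ac)
  from has_integral_mult_right[OF this, of "inverse (2 * of_real pi * \<i>)"]
  have "((\<lambda>t. inverse (2 * of_real pi * \<i>) * (2 * of_real pi * \<i> * f (cis (2 * pi * t))))
      has_integral inverse (2 * of_real pi * \<i>) * (2 * of_real pi * \<i> * f 0)) {0..1}" .
  moreover have "inverse (2 * of_real pi * \<i>) * (2 * of_real pi * \<i> * x) = x" for x
    by (simp add: field_simps)
  ultimately show ?thesis by (simp only:)
qed

text \<open>With the zero outside, \<open>1 - \<zeta> / w\<close> has positive real part on the
  closed disc, so its logarithm is holomorphic there and has the mean value 0 of the centre.\<close>

lemma ln_circle_outside:
  assumes "cmod w > 1"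
  shows "((\<lambda>t. ln (cmod (cis (2 * pi * t) - w))) has_integral ln (cmod w)) {0..1}"
proof -
  have w: "w \<noteq> 0" using assms by auto
  have re: "Re (1 - \<zeta> / w) > 0" if "cmod \<zeta> \<le> 1" for \<zeta>
  proof -
    have "cmod (\<zeta> / w) < 1" using that assms by (simp add: norm_divide divide_simps)
    then show ?thesis using complex_Re_le_cmod[of "\<zeta> / w"] by simp
  qed
  have nz: "1 - \<zeta> / w \<noteq> 0" "1 - \<zeta> / w \<notin> \<real>\<^sub>\<le>\<^sub>0" if "cmod \<zeta> \<le> 1" for \<zeta>
    using re[OF that] by (auto simp: complex_nonpos_Reals_iff)
  have "(\<lambda>\<zeta>. Ln (1 - \<zeta> / w)) holomorphic_on cball 0 1"
    by (intro holomorphic_intros) (use w nz in auto)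
  from has_integral_linear[OF mean_value_circle[OF this] bounded_linear_Re]
  have "((\<lambda>t. Re (Ln (1 - cis (2 * pi * t) / w))) has_integral 0) {0..1}"
    by (simp add: o_def)
  from has_integral_add[OF this has_integral_const_real[of "ln (cmod w)" 0 1]]
  have "((\<lambda>t. Re (Ln (1 - cis (2 * pi * t) / w)) + ln (cmod w)) has_integral ln (cmod w)) {0..1}"
    by simp
  moreover have "Re (Ln (1 - cis (2 * pi * t) / w)) + ln (cmod w) = ln (cmod (cis (2 * pi * t) - w))" for t
  proof -
    have "cis (2 * pi * t) - w = - (w * (1 - cis (2 * pi * t) / w))"
      using w by (simp add: field_simps)
    then have "cmod (cis (2 * pi * t) - w) = cmod w * cmod (1 - cis (2 * pi * t) / w)"
      by (simp add: norm_mult norm_minus_cancel del: minus_diff_eq mult_minus_right)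
    then show ?thesis using w nz(1)[of "cis (2 * pi * t)"] by (simp add: ln_mult)
  qed
  ultimately show ?thesis by simp
qed

text \<open>Reflection of the zero: on the unit circle \<open>\<zeta> - w\<close> and
  \<open>1 - cnj w * \<zeta>\<close> have equal modulus, and the latter has no zero in the
  disc.\<close>

lemma ln_circle_inside:
  assumes "cmod w < 1"
  shows "((\<lambda>t. ln (cmod (cis (2 * pi * t) - w))) has_integral 0) {0..1}"
proof -
  have re: "Re (1 - cnj w * \<zeta>) > 0" if "cmod \<zeta> \<le> 1" for \<zeta>
  proof -
    have "cmod (cnj w * \<zeta>) \<le> cmod w" using that by (simp add: norm_mult mult_left_le)
    then show ?thesis using complex_Re_le_cmod[of "cnj w * \<zeta>"] assms by simp
  qed
  have nz: "1 - cnj w * \<zeta> \<noteq> 0" "1 - cnj w * \<zeta> \<notin> \<real>\<^sub>\<le>\<^sub>0" if "cmod \<zeta> \<le> 1" for \<zeta>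
    using re[OF that] by (metis less_irrefl zero_complex.sel(1), auto simp: complex_nonpos_Reals_iff)
  have "(\<lambda>\<zeta>. Ln (1 - cnj w * \<zeta>)) holomorphic_on cball 0 1"
    by (intro holomorphic_intros) (use nz in auto)
  from has_integral_linear[OF mean_value_circle[OF this] bounded_linear_Re]
  have "((\<lambda>t. Re (Ln (1 - cnj w * cis (2 * pi * t)))) has_integral 0) {0..1}"
    by (simp add: o_def)
  moreover have "Re (Ln (1 - cnj w * cis (2 * pi * t))) = ln (cmod (cis (2 * pi * t) - w))" for t
  proof -
    let ?e = "cis (2 * pi * t)"
    have "cnj (?e - w) * ?e = 1 - cnj w * ?e"
      by (simp add: algebra_simps cis_cnj cis_mult)
    then have "cmod (1 - cnj w * ?e) = cmod (cnj (?e - w) * ?e)" by simp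
    also have "\<dots> = cmod (?e - w)" by (simp only: norm_mult complex_mod_cnj norm_cis mult_1_right)
    finally show ?thesis using nz(1)[of ?e] by simp
  qed
  ultimately show ?thesis by simp
qed

section \<open>Sub-mean value inequality for polynomials in one variable\<close>

definition unit_interval :: "real measure" where
  "unit_interval = restrict_space lborel {0..1}"

lemma prob_space_unit_interval: "prob_space unit_interval"
  by (rule prob_spaceI) (simp add: unit_interval_def emeasure_restrict_space space_restrict_space)

interpretation unit_interval: prob_space unit_interval
  by (rule prob_space_unit_interval)

lemma borel_measurable_unit_interval: "f \<in> borel_measurable borel \<Longrightarrow> f \<in> borel_measurable unit_interval"
  unfolding unit_interval_def by (simp add: measurable_restrict_space1)

lemma unit_interval_has_integral:
  fixes f :: "real \<Rightarrow> real"
  assumes "continuous_on {0..1} f" "(f has_integral I) {0..1}"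
  shows "integrable unit_interval f" "integral\<^sup>L unit_interval f = I"
proof -
  have "set_integrable lborel {0..1} f"
    using borel_integrable_atLeastAtMost'[OF assms(1)] .
  then show "integrable unit_interval f"
    unfolding unit_interval_def set_integrable_def by (subst integrable_restrict_space) auto
  have "integral\<^sup>L unit_interval f = (LINT x:{0..1}|lborel. f x)"
    unfolding unit_interval_def set_lebesgue_integral_def by (subst integral_restrict_space) auto
  also have "\<dots> = integral {0..1} f"
    using set_borel_integral_eq_integral(2)[OF \<open>set_integrable lborel {0..1} f\<close>] .
  finally show "integral\<^sup>L unit_interval f = I" using assms(2) by (simp add: integral_unique)
qed

lemma AE_circle_neq: "AE t in unit_interval. cis (2 * pi * t) \<noteq> w"
proof -
  have "countable {t. cis (2 * pi * t) = w}"
  proof (cases "\<exists>s. cis (2 * pi * s) = w")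
    case True
    then obtain s where s: "cis (2 * pi * s) = w" by blast
    have "{t. cis (2 * pi * t) = w} \<subseteq> range (\<lambda>n::int. s + of_int n)"
    proof clarify
      fix t assume "w = cis (2 * pi * t)"
      then have "cis (2 * pi * t - 2 * pi * s) = 1" using s by (simp add: cis_divide[symmetric])
      then have "cos (2 * pi * t - 2 * pi * s) = 1" by (auto simp: complex_eq_iff)
      then obtain n :: int where "2 * pi * t - 2 * pi * s = of_int n * 2 * pi"
        unfolding cos_one_2pi_int by (auto simp: mult_ac)
      then have "2 * pi * t = 2 * pi * (s + of_int n)" by (simp add: algebra_simps)
      then have "t = s + of_int n" by simp
      then show "t \<in> range (\<lambda>n::int. s + of_int n)" by blast
    qed
    then show ?thesis by (rule countable_subset) simp
  next
    case False
    then have "{t. cis (2 * pi * t) = w} = {}" by blast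
    then show ?thesis by (simp only: countable_empty)
  qed
  then have "AE t in lborel. t \<notin> {t. cis (2 * pi * t) = w}"
    by (intro AE_not_in countable_imp_null_set_lborel)
  then show ?thesis
    unfolding unit_interval_def by (subst AE_restrict_space_iff) auto
qed

lemma measurable_ln_circle: "(\<lambda>t. ln (cmod (cis (2 * pi * t) - w))) \<in> borel_measurable unit_interval"
proof (rule borel_measurable_unit_interval)
  have "(\<lambda>t. cis (2 * pi * t)) \<in> borel_measurable borel"
    by (intro borel_measurable_continuous_onI continuous_intros)
  then show "(\<lambda>t. ln (cmod (cis (2 * pi * t) - w))) \<in> borel_measurable borel" by simp
qed

text \<open>Sub-mean value inequality at the centre of the unit disc. Nonvanishing almost everywhere
  and integrability are included because they allow the logarithm of a product to be split under the
  integral.\<close>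

definition jensen :: "(complex \<Rightarrow> complex) \<Rightarrow> bool" where
  "jensen g \<longleftrightarrow> (AE t in unit_interval. g (cis (2 * pi * t)) \<noteq> 0) \<and>
     integrable unit_interval (\<lambda>t. ln (cmod (g (cis (2 * pi * t))))) \<and>
     ln (cmod (g 0)) \<le> (\<integral>t. ln (cmod (g (cis (2 * pi * t)))) \<partial>unit_interval)"

text \<open>The integrand is unbounded, so the zero is moved radially out of the disc, where the
  mean value is exact; letting it return to the circle is an application of Fatou's lemma, and an
  inequality is all that is wanted.\<close>

lemma jensen_linear_boundary:
  assumes "cmod w = 1"
  shows "jensen (\<lambda>\<zeta>. \<zeta> - w)"
proof -
  let ?e = "\<lambda>t. cis (2 * pi * t)"
  let ?w = "\<lambda>k. complex_of_real (1 + 1 / real (Suc k)) * w"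
  have wk: "cmod (?w k) = 1 + 1 / real (Suc k)" for k
    unfolding norm_mult norm_of_real assms by (simp add: abs_of_nonneg)
  \<comment> \<open>The moved zeros have modulus at most 2, so \<open>ln 3\<close> is a common upper
    bound that turns the integrands of Fatou's lemma nonnegative.\<close>
  have le3: "ln (cmod (?e t - ?w k)) \<le> ln 3" for t k
  proof (cases "?e t = ?w k")
    case False
    have "cmod (?e t - ?w k) \<le> cmod (?e t) + cmod (?w k)" by (rule norm_triangle_ineq4)
    also have "\<dots> = 2 + 1 / real (Suc k)" unfolding wk by simp
    also have "\<dots> \<le> 3" by (simp add: divide_simps)
    finally show ?thesis using False by (subst ln_le_cancel_iff) auto
  qed simp
  have conv: "(\<lambda>k. ?w k) \<longlonglongrightarrow> w"
  proof -
    have "(\<lambda>k. ?w k) \<longlonglongrightarrow> complex_of_real (1 + 0) * w"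
      by (intro tendsto_mult tendsto_of_real tendsto_add tendsto_const LIMSEQ_Suc[OF lim_1_over_n])
    then show ?thesis by simp
  qed
  have nnk: "(\<integral>\<^sup>+t. ennreal (ln 3 - ln (cmod (?e t - ?w k))) \<partial>unit_interval) \<le> ennreal (ln 3)" for k
  proof -
    have gt: "cmod (?w k) > 1" unfolding wk by simp
    have cont: "continuous_on {0..1} (\<lambda>t. ln (cmod (?e t - ?w k)))"
    proof (intro continuous_intros ballI)
      fix t show "cmod (?e t - ?w k) \<noteq> 0"
        using gt by (metis norm_cis eq_iff_diff_eq_0 less_irrefl norm_eq_zero)
    qed
    note I = unit_interval_has_integral[OF cont ln_circle_outside[OF gt]]
    have "(\<integral>\<^sup>+t. ennreal (ln 3 - ln (cmod (?e t - ?w k))) \<partial>unit_interval)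
        = ennreal (\<integral>t. ln 3 - ln (cmod (?e t - ?w k)) \<partial>unit_interval)"
      using I(1) le3 by (intro nn_integral_eq_integral) (auto intro: Bochner_Integration.integrable_diff)
    also have "(\<integral>t. ln 3 - ln (cmod (?e t - ?w k)) \<partial>unit_interval) = ln 3 - ln (cmod (?w k))"
      using I by (subst Bochner_Integration.integral_diff) (simp_all add: unit_interval.prob_space)
    also have "\<dots> \<le> ln 3" using gt by simp
    finally show ?thesis by (simp add: ennreal_leI)
  qed
  have AEw: "AE t in unit_interval. ?e t \<noteq> w" by (rule AE_circle_neq)
  have "(\<integral>\<^sup>+t. ennreal (ln 3 - ln (cmod (?e t - w))) \<partial>unit_interval)
      \<le> (\<integral>\<^sup>+t. liminf (\<lambda>k. ennreal (ln 3 - ln (cmod (?e t - ?w k)))) \<partial>unit_interval)"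
  proof (rule nn_integral_mono_AE, use AEw in eventually_elim)
    fix t assume "?e t \<noteq> w"
    then have "(\<lambda>k. ennreal (ln 3 - ln (cmod (?e t - ?w k)))) \<longlonglongrightarrow> ennreal (ln 3 - ln (cmod (?e t - w)))"
      by (intro tendsto_intros tendsto_ennrealI conv) auto
    then show "ennreal (ln 3 - ln (cmod (?e t - w))) \<le> liminf (\<lambda>k. ennreal (ln 3 - ln (cmod (?e t - ?w k))))"
      by (simp add: lim_imp_Liminf)
  qed
  also have "\<dots> \<le> liminf (\<lambda>k. \<integral>\<^sup>+t. ennreal (ln 3 - ln (cmod (?e t - ?w k))) \<partial>unit_interval)"
    by (intro nn_integral_liminf measurable_compose[OF _ measurable_ennreal] borel_measurable_diff
        measurable_ln_circle) auto
  also have "\<dots> \<le> ennreal (ln 3)"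
    using nnk by (intro Liminf_le) (auto intro!: always_eventually)
  finally have fin: "(\<integral>\<^sup>+t. ennreal (ln 3 - ln (cmod (?e t - w))) \<partial>unit_interval) \<le> ennreal (ln 3)" .
  have nonneg: "0 \<le> ln 3 - ln (cmod (?e t - w))" for t
  proof (cases "?e t = w")
    case False
    have "cmod (?e t - w) \<le> 3" using norm_triangle_ineq4[of "?e t" w] assms by simp
    then show ?thesis using False by simp
  qed simp
  have "integrable unit_interval (\<lambda>t. ln 3 - ln (cmod (?e t - w)))"
  proof (rule integrableI_bounded)
    have "(\<integral>\<^sup>+t. ennreal (norm (ln 3 - ln (cmod (?e t - w)))) \<partial>unit_interval) \<le> ennreal (ln 3)"
      using fin nonneg by simp
    then show "(\<integral>\<^sup>+t. ennreal (norm (ln 3 - ln (cmod (?e t - w)))) \<partial>unit_interval) < \<infinity>"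
      using le_less_trans by fastforce
  qed (intro borel_measurable_diff measurable_ln_circle, simp)
  then have int: "integrable unit_interval (\<lambda>t. ln (cmod (?e t - w)))"
    using Bochner_Integration.integrable_diff[of unit_interval "\<lambda>_. ln 3" "\<lambda>t. ln 3 - ln (cmod (?e t - w))"]
    by simp
  have "ennreal (\<integral>t. ln 3 - ln (cmod (?e t - w)) \<partial>unit_interval) \<le> ennreal (ln 3)"
    using fin nonneg int by (subst nn_integral_eq_integral[symmetric]) auto
  then have "(\<integral>t. ln 3 - ln (cmod (?e t - w)) \<partial>unit_interval) \<le> ln 3"
    by (subst (asm) ennreal_le_iff) auto
  then have "0 \<le> (\<integral>t. ln (cmod (?e t - w)) \<partial>unit_interval)"
    using int by (simp add: Bochner_Integration.integral_diff unit_interval.prob_space)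
  then show ?thesis
    unfolding jensen_def using int AEw assms by simp
qed

lemma jensen_linear:
  assumes "w \<noteq> 0"
  shows "jensen (\<lambda>\<zeta>. \<zeta> - w)"
proof (cases "cmod w = 1")
  case True
  then show ?thesis by (rule jensen_linear_boundary)
next
  case False
  have cont: "continuous_on {0..1} (\<lambda>t. ln (cmod (cis (2 * pi * t) - w)))"
  proof (intro continuous_intros ballI)
    fix t show "cmod (cis (2 * pi * t) - w) \<noteq> 0"
      using False by (metis norm_cis eq_iff_diff_eq_0 norm_eq_zero)
  qed
  show ?thesis
  proof (cases "cmod w > 1")
    case True
    show ?thesis
      using unit_interval_has_integral[OF cont ln_circle_outside[OF True]] AE_circle_neq[of w]
      by (simp add: jensen_def)
  next
    case nle: False
    then have lt: "cmod w < 1" using False by simp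
    show ?thesis
      using unit_interval_has_integral[OF cont ln_circle_inside[OF lt]] AE_circle_neq[of w] lt assms
      by (simp add: jensen_def)
  qed
qed

lemma jensen_mult:
  assumes "jensen f" "jensen g" "f 0 \<noteq> 0" "g 0 \<noteq> 0"
    and [measurable]: "f \<in> borel_measurable borel" "g \<in> borel_measurable borel"
  shows "jensen (\<lambda>\<zeta>. f \<zeta> * g \<zeta>)"
proof -
  let ?e = "\<lambda>t. cis (2 * pi * t)"
  have [measurable]: "?e \<in> borel_measurable unit_interval"
    by (intro borel_measurable_unit_interval borel_measurable_continuous_onI continuous_intros)
  have nz: "AE t in unit_interval. f (?e t) \<noteq> 0" "AE t in unit_interval. g (?e t) \<noteq> 0"
    and int: "integrable unit_interval (\<lambda>t. ln (cmod (f (?e t))))"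
      "integrable unit_interval (\<lambda>t. ln (cmod (g (?e t))))"
    and le: "ln (cmod (f 0)) \<le> (\<integral>t. ln (cmod (f (?e t))) \<partial>unit_interval)"
      "ln (cmod (g 0)) \<le> (\<integral>t. ln (cmod (g (?e t))) \<partial>unit_interval)"
    using assms(1,2) unfolding jensen_def by auto
  have eq: "AE t in unit_interval. ln (cmod (f (?e t))) + ln (cmod (g (?e t))) = ln (cmod (f (?e t) * g (?e t)))"
    using nz by eventually_elim (simp add: norm_mult ln_mult)
  have i1: "integrable unit_interval (\<lambda>t. ln (cmod (f (?e t) * g (?e t))))"
    by (rule integrable_cong_AE_imp[OF Bochner_Integration.integrable_add[OF int] _ ]) (use eq in simp_all)
  have "(\<integral>t. ln (cmod (f (?e t) * g (?e t))) \<partial>unit_interval) =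
      (\<integral>t. ln (cmod (f (?e t))) + ln (cmod (g (?e t))) \<partial>unit_interval)"
    by (rule integral_cong_AE) (use eq in \<open>auto elim: eventually_mono\<close>)
  also have "\<dots> = (\<integral>t. ln (cmod (f (?e t))) \<partial>unit_interval) + (\<integral>t. ln (cmod (g (?e t))) \<partial>unit_interval)"
    using int by (rule Bochner_Integration.integral_add)
  finally show ?thesis
    unfolding jensen_def using nz i1 le assms(3,4) by (auto simp: norm_mult ln_mult elim: eventually_elim2)
qed

text \<open>Factorisation into linear factors. A zero at the centre must be excluded: with
  \<open>ln 0 = 0\<close> the inequality fails for instance for the polynomial \<zeta> / 2.\<close>

lemma jensen_poly:
  assumes "poly g 0 \<noteq> 0"
  shows "jensen (poly g)"
proof -
  obtain A where A: "g = smult (lead_coeff g) (\<Prod>x\<in>#A. [:- x, 1:])"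
    using alg_closed_imp_factorization[of g] assms by fastforce
  have meas: "poly p \<in> borel_measurable borel" for p :: "complex poly"
    by (intro borel_measurable_continuous_onI continuous_intros)
  have "poly (\<Prod>x\<in>#A. [:- x, 1:]) 0 \<noteq> 0 \<Longrightarrow> jensen (poly (\<Prod>x\<in>#A. [:- x, 1:]))"
  proof (induction A)
    case (add x A)
    have "poly [:- x, 1:] = (\<lambda>\<zeta>. \<zeta> - x)" by (simp add: fun_eq_iff)
    then have lin: "jensen (poly [:- x, 1:])"
      using jensen_linear[of x] add.prems by simp
    have nz: "poly [:- x, 1:] 0 \<noteq> 0" "poly (\<Prod>x\<in>#A. [:- x, 1:]) 0 \<noteq> 0"
      using add.prems by auto
    have "jensen (\<lambda>\<zeta>. poly [:- x, 1:] \<zeta> * poly (\<Prod>x\<in>#A. [:- x, 1:]) \<zeta>)"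
      by (rule jensen_mult[OF lin add.IH[OF nz(2)] nz meas meas])
    moreover have "(\<lambda>\<zeta>. poly [:- x, 1:] \<zeta> * poly (\<Prod>x\<in>#A. [:- x, 1:]) \<zeta>) = poly (\<Prod>x\<in>#add_mset x A. [:- x, 1:])"
      by (simp add: fun_eq_iff algebra_simps)
    ultimately show ?case by (rule back_subst[of jensen])
  qed (simp add: jensen_def unit_interval.prob_space)
  note prod = this
  define c P where "c = lead_coeff g" and "P = (\<Prod>x\<in>#A. [:- x, 1:])"
  have g: "poly g = (\<lambda>\<zeta>. c * poly P \<zeta>)"
    by (subst A) (simp add: c_def P_def fun_eq_iff)
  have nz: "c \<noteq> 0" "poly P 0 \<noteq> 0" using assms by (auto simp: g)
  have "jensen (poly P)" unfolding P_def by (rule prod[OF nz(2)[unfolded P_def]])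
  moreover have "jensen (\<lambda>_. c)"
    using nz by (simp add: jensen_def unit_interval.prob_space)
  ultimately show ?thesis
    unfolding g using nz by (intro jensen_mult meas) auto
qed

text \<open>Passing to the nonnegative function \<open>A - ln\<close> gives a form to which Tonelli
  applies. The condition \<open>A \<ge> 0\<close> covers the zeros of \<open>g\<close>, where the
  logarithm takes the value 0.\<close>

lemma nn_integral_circle_le:
  assumes "poly g 0 \<noteq> 0" "A \<ge> 0" "\<And>\<zeta>. cmod \<zeta> = 1 \<Longrightarrow> cmod (poly g \<zeta>) \<le> exp A"
  shows "(\<integral>\<^sup>+t. ennreal (A - ln (cmod (poly g (cis (2 * pi * t))))) \<partial>unit_interval)
    \<le> ennreal (A - ln (cmod (poly g 0)))"
proof -
  let ?f = "\<lambda>t. ln (cmod (poly g (cis (2 * pi * t))))"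
  have J: "integrable unit_interval ?f" "ln (cmod (poly g 0)) \<le> integral\<^sup>L unit_interval ?f"
    using jensen_poly[OF assms(1)] unfolding jensen_def by auto
  have "0 \<le> A - ?f t" for t
  proof (cases "poly g (cis (2 * pi * t)) = 0")
    case False
    then have "?f t \<le> ln (exp A)" using assms(3)[of "cis (2 * pi * t)"] by (subst ln_le_cancel_iff) auto
    then show ?thesis by simp
  qed (use assms in simp)
  then have "(\<integral>\<^sup>+t. ennreal (A - ?f t) \<partial>unit_interval) = ennreal (\<integral>t. A - ?f t \<partial>unit_interval)"
    using J by (intro nn_integral_eq_integral) auto
  also have "(\<integral>t. A - ?f t \<partial>unit_interval) = A - integral\<^sup>L unit_interval ?f"
    using J by (simp add: Bochner_Integration.integral_diff unit_interval.prob_space)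
  finally show ?thesis using J(2) by (simp add: ennreal_leI)
qed


section \<open>Mean values over balls\<close>

lemma nn_integral_lborel_translate:
  fixes g :: "'a::euclidean_space \<Rightarrow> ennreal"
  assumes "g \<in> borel_measurable borel"
  shows "(\<integral>\<^sup>+x. g (c + x) \<partial>lborel) = (\<integral>\<^sup>+x. g x \<partial>lborel)"
  using nn_integral_distr[of "(+) c" lborel borel g] assms lborel_distr_plus[of c] by simp

lemma emeasure_lborel_ball_translate:
  "emeasure lborel (ball (c::'a::euclidean_space) r) = emeasure lborel (ball (0::'a) r)"
proof -
  have "emeasure lborel (ball c r) = (\<integral>\<^sup>+x. indicator (ball c r) (c + x) \<partial>lborel)"
    by (subst nn_integral_lborel_translate) (auto intro!: borel_measurable_indicator)
  also have "\<dots> = (\<integral>\<^sup>+x. indicator (ball (0::'a) r) x \<partial>lborel)"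
    by (rule nn_integral_cong) (simp add: indicator_def dist_norm)
  finally show ?thesis by simp
qed

text \<open>Averaging over translations identifies the image measure with a multiple of Lebesgue
  measure, and the unit ball fixes the factor.\<close>

lemma distr_lborel_isometry:
  fixes f :: "'a::euclidean_space \<Rightarrow> 'a"
  assumes "linear f" "\<And>x. norm (f x) = norm x"
  shows "distr lborel borel f = lborel"
proof (rule measure_eqI)
  have "inj f"
    using assms by (subst linear_injective_0) (metis norm_eq_zero)+
  then have surj: "surj f" using assms(1) linear_injective_imp_surjective by blast
  have meas_f [measurable]: "f \<in> borel_measurable borel"
    using assms(1) by (intro borel_measurable_continuous_onI linear_continuous_on linear_conv_bounded_linear[THEN iffD1])
  interpret lborel_pair: pair_sigma_finite "lborel :: 'a measure" "lborel :: 'a measure" ..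
  fix A assume "A \<in> sets (distr lborel borel f)"
  then have A [measurable]: "A \<in> sets borel" by simp
  define B where "B = ball (0::'a) 1"
  have B [measurable]: "B \<in> sets borel" by (simp add: B_def)
  let ?I = "\<lambda>S x. indicator S x :: ennreal"
  \<comment> \<open>The double integral of the indicators of \<open>B\<close> at y and of
    \<open>A\<close> at y + f x is computed twice. Integrating in x first yields the image measure
    of \<open>A\<close>; after a shift in y, the points x with y - f x in \<open>B\<close> form a
    unit ball, which yields the Lebesgue measure of \<open>A\<close>.\<close>
  have "emeasure lborel B * emeasure (distr lborel borel f) A =
      (\<integral>\<^sup>+y. ?I B y * emeasure (distr lborel borel f) A \<partial>lborel)"
    by (subst nn_integral_multc) auto
  also have "\<dots> = (\<integral>\<^sup>+y. \<integral>\<^sup>+x. ?I B y * ?I A (y + f x) \<partial>lborel \<partial>lborel)"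
  proof (rule nn_integral_cong)
    fix y
    obtain y' where y': "y = f y'" using surj by (metis surjD)
    have "emeasure (distr lborel borel f) A = (\<integral>\<^sup>+x. ?I A x \<partial>distr lborel borel f)" by simp
    also have "\<dots> = (\<integral>\<^sup>+x. ?I A (f x) \<partial>lborel)" by (rule nn_integral_distr) auto
    also have "\<dots> = (\<integral>\<^sup>+x. ?I A (f (y' + x)) \<partial>lborel)" by (subst nn_integral_lborel_translate) auto
    also have "\<dots> = (\<integral>\<^sup>+x. ?I A (y + f x) \<partial>lborel)" by (simp add: y' linear_add[OF assms(1)])
    finally show "?I B y * emeasure (distr lborel borel f) A = (\<integral>\<^sup>+x. ?I B y * ?I A (y + f x) \<partial>lborel)"
      by (simp add: nn_integral_cmult)
  qed
  also have "\<dots> = (\<integral>\<^sup>+x. \<integral>\<^sup>+y. ?I B y * ?I A (y + f x) \<partial>lborel \<partial>lborel)"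
    by (rule lborel_pair.Fubini') (auto simp: split_beta')
  also have "\<dots> = (\<integral>\<^sup>+x. \<integral>\<^sup>+y. ?I B (- f x + y) * ?I A y \<partial>lborel \<partial>lborel)"
  proof (rule nn_integral_cong)
    fix x
    have "(\<lambda>y. ?I B y * ?I A (y + f x)) \<in> borel_measurable borel" by measurable
    from nn_integral_lborel_translate[OF this, of "- f x"]
    show "(\<integral>\<^sup>+y. ?I B y * ?I A (y + f x) \<partial>lborel) = (\<integral>\<^sup>+y. ?I B (- f x + y) * ?I A y \<partial>lborel)"
      by (simp add: algebra_simps)
  qed
  also have "\<dots> = (\<integral>\<^sup>+y. \<integral>\<^sup>+x. ?I B (- f x + y) * ?I A y \<partial>lborel \<partial>lborel)"
    by (rule lborel_pair.Fubini') (auto simp: split_beta')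
  also have "\<dots> = (\<integral>\<^sup>+y. emeasure lborel B * ?I A y \<partial>lborel)"
  proof (rule nn_integral_cong)
    fix y
    obtain y' where y': "y = f y'" using surj by (metis surjD)
    have "- f x + y = f (y' - x)" for x by (simp add: y' linear_diff[OF assms(1)])
    then have "(\<integral>\<^sup>+x. ?I B (- f x + y) \<partial>lborel) = (\<integral>\<^sup>+x. ?I (ball y' 1) x \<partial>lborel)"
      by (intro nn_integral_cong) (simp add: B_def indicator_def assms(2) dist_norm)
    also have "\<dots> = emeasure lborel B"
      by (simp add: B_def emeasure_lborel_ball_translate[of y'])
    finally show "(\<integral>\<^sup>+x. ?I B (- f x + y) * ?I A y \<partial>lborel) = emeasure lborel B * ?I A y"
      by (simp add: nn_integral_multc)
  qed
  also have "\<dots> = emeasure lborel B * emeasure lborel A" by (simp add: nn_integral_cmult)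
  finally have "emeasure lborel B * emeasure (distr lborel borel f) A = emeasure lborel B * emeasure lborel A" .
  moreover have "emeasure lborel B \<noteq> \<infinity>" "emeasure lborel B \<noteq> 0"
    using emeasure_lborel_ball_finite[of 0 1] content_ball_pos[of 1 "0::'a"] by (auto simp: B_def measure_def)
  ultimately show "emeasure (distr lborel borel f) A = emeasure lborel A"
    by (simp add: ennreal_mult_cancel_left)
qed simp

lemma norm_scalar_vec: "norm (c *s (z :: 'd::finite cspace)) = cmod c * norm z"
proof -
  have "norm (c *s z) = L2_set (\<lambda>i. cmod c * norm (z $ i)) UNIV"
    by (simp add: norm_vec_def norm_mult)
  also have "\<dots> = cmod c * L2_set (\<lambda>i. norm (z $ i)) UNIV"
    by (simp add: L2_set_right_distrib)
  finally show ?thesis by (simp add: norm_vec_def)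
qed

lemma distr_lborel_cis: "distr lborel borel (\<lambda>z :: 'd::finite cspace. cis \<theta> *s z) = lborel"
  by (rule distr_lborel_isometry)
     (auto intro!: linearI simp: norm_scalar_vec vec_eq_iff algebra_simps scaleR_conv_of_real)

lemma borel_measurable_ln_poly_fun:
  "p \<in> poly_fun n \<Longrightarrow> (\<lambda>z. ln (cmod (p z))) \<in> borel_measurable borel"
proof -
  assume "p \<in> poly_fun n"
  then have "p \<in> borel_measurable borel"
    by (intro borel_measurable_continuous_onI continuous_on_mono_span)
  then show ?thesis by measurable
qed

text \<open>Multiplication of w by a unimodular number preserves Lebesgue measure, so the integral
  over the ball may be averaged over these rotations about \<open>a\<close>. After Tonelli the inner
  integrals run over circles centred at \<open>a\<close> in complex lines, where the one-variable
  inequality applies.\<close>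

lemma nn_integral_ball_le:
  fixes p :: "'d::finite cspace \<Rightarrow> complex"
  assumes p: "p \<in> poly_fun n" and "A \<ge> 0" and nz: "p a \<noteq> 0"
    and bound: "\<And>z. z \<in> ball a r \<Longrightarrow> cmod (p z) \<le> exp A"
  shows "(\<integral>\<^sup>+z. ennreal (A - ln (cmod (p z))) * indicator (ball a r) z \<partial>lborel)
    \<le> ennreal (A - ln (cmod (p a))) * emeasure lborel (ball a r)"
proof -
  define F where "F = (\<lambda>z. ennreal (A - ln (cmod (p z))))"
  have F [measurable]: "F \<in> borel_measurable borel"
    unfolding F_def using borel_measurable_ln_poly_fun[OF p] by measurable
  define T where "T = (\<lambda>t w :: 'd cspace. cis (2 * pi * t) *s w)"
  have T_meas: "(\<lambda>(t, w). a + T t w) \<in> measurable (unit_interval \<Otimes>\<^sub>M lborel) borel"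
  proof -
    have "(\<lambda>x. a + T (fst x) (snd x)) \<in> borel_measurable borel"
      unfolding T_def vector_scalar_mult_def
      by (intro borel_measurable_continuous_onI continuous_intros)
    then have "(\<lambda>x. a + T (fst x) (snd x)) \<in> measurable (borel \<Otimes>\<^sub>M borel) borel"
      by (simp add: borel_prod)
    moreover have "(\<lambda>x. (fst x, snd x)) \<in> measurable (unit_interval \<Otimes>\<^sub>M (lborel :: 'd cspace measure)) (borel \<Otimes>\<^sub>M borel)"
      by (intro measurable_Pair measurable_compose[OF measurable_fst borel_measurable_unit_interval]
            measurable_compose[OF measurable_snd]) auto
    ultimately show ?thesis
      by (simp add: split_beta')
  qed
  have norm_T: "norm (T t w) = norm w" for t w
    by (simp add: T_def norm_scalar_vec)
  have rot: "(\<integral>\<^sup>+z. F z * indicator (ball a r) z \<partial>lborel) =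
      (\<integral>\<^sup>+w. F (a + T t w) * indicator (ball 0 r) w \<partial>lborel)" for t
  proof -
    have [measurable]: "T t \<in> borel_measurable borel"
      unfolding T_def vector_scalar_mult_def
      by (intro borel_measurable_continuous_onI continuous_intros)
    have "(\<integral>\<^sup>+z. F z * indicator (ball a r) z \<partial>lborel)
        = (\<integral>\<^sup>+w. F (a + w) * indicator (ball a r) (a + w) \<partial>lborel)"
      by (subst nn_integral_lborel_translate)
         (auto intro!: borel_measurable_times_ennreal borel_measurable_indicator)
    also have "\<dots> = (\<integral>\<^sup>+w. F (a + w) * indicator (ball 0 r) w \<partial>lborel)"
      by (intro nn_integral_cong) (simp add: indicator_def dist_norm)
    also have "\<dots> = (\<integral>\<^sup>+w. F (a + w) * indicator (ball 0 r) w \<partial>distr lborel borel (T t))"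
      by (simp add: T_def distr_lborel_cis)
    also have "\<dots> = (\<integral>\<^sup>+w. F (a + T t w) * indicator (ball 0 r) (T t w) \<partial>lborel)"
      by (rule nn_integral_distr) (auto intro!: borel_measurable_times_ennreal borel_measurable_indicator)
    finally show ?thesis by (simp add: indicator_def norm_T)
  qed
  interpret pair_sigma_finite unit_interval "lborel :: 'd cspace measure" ..
  have "(\<integral>\<^sup>+z. F z * indicator (ball a r) z \<partial>lborel) =
      (\<integral>\<^sup>+t. \<integral>\<^sup>+z. F z * indicator (ball a r) z \<partial>lborel \<partial>unit_interval)"
    by (simp add: unit_interval.emeasure_space_1)
  also have "\<dots> = (\<integral>\<^sup>+t. \<integral>\<^sup>+w. F (a + T t w) * indicator (ball 0 r) w \<partial>lborel \<partial>unit_interval)"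
    by (rule nn_integral_cong) (rule rot)
  also have "\<dots> = (\<integral>\<^sup>+w. \<integral>\<^sup>+t. F (a + T t w) * indicator (ball 0 r) w \<partial>unit_interval \<partial>lborel)"
  proof (rule Fubini'[symmetric])
    have "(\<lambda>x. F (case x of (t, w) \<Rightarrow> a + T t w) * indicator (ball 0 r) (snd x))
        \<in> borel_measurable (unit_interval \<Otimes>\<^sub>M lborel)"
      by (intro borel_measurable_times_ennreal measurable_compose[OF T_meas F]
          measurable_compose[OF measurable_snd] borel_measurable_indicator) auto
    then show "(\<lambda>(t, w). F (a + T t w) * indicator (ball 0 r) w) \<in> borel_measurable (unit_interval \<Otimes>\<^sub>M lborel)"
      by (simp add: split_beta')
  qed
  also have "\<dots> \<le> (\<integral>\<^sup>+w. F a * indicator (ball (0 :: 'd cspace) r) w \<partial>lborel)"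
  proof (rule nn_integral_mono)
    fix w :: "'d cspace"
    show "(\<integral>\<^sup>+t. F (a + T t w) * indicator (ball 0 r) w \<partial>unit_interval) \<le> F a * indicator (ball 0 r) w"
    proof (cases "w \<in> ball 0 r")
      case True
      obtain g where g: "\<And>\<zeta>. p (a + \<zeta> *s w) = poly g \<zeta>" using poly_fun_line[OF p] by metis
      have g0: "poly g 0 = p a" using g[of 0] by simp
      have "(\<integral>\<^sup>+t. F (a + T t w) \<partial>unit_interval) \<le> F a"
        unfolding F_def T_def g g0[symmetric]
      proof (rule nn_integral_circle_le[OF _ \<open>A \<ge> 0\<close>])
        fix \<zeta> :: complex assume "cmod \<zeta> = 1"
        then show "cmod (poly g \<zeta>) \<le> exp A"
          using True by (subst g[symmetric]) (auto intro!: bound simp: dist_norm norm_scalar_vec)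
      qed (use nz g0 in auto)
      then show ?thesis using True by simp
    qed simp
  qed
  also have "\<dots> = F a * emeasure lborel (ball (0 :: 'd cspace) r)"
    by (rule nn_integral_cmult_indicator) simp
  finally show ?thesis by (simp add: F_def emeasure_lborel_ball_translate[of a])
qed

text \<open>The distance is split at the constant A / n = V a + 2 \<epsilon>. The mean of A / n - ln
  |p| / n is at most its value at \<open>a\<close>, hence at most 3 \<epsilon>, and A / n differs
  from V by at most 3 \<epsilon> on the ball; together these give 6 \<epsilon>.\<close>

lemma nn_integral_ball_potential_le:
  fixes p :: "'d::finite cspace \<Rightarrow> complex" and V :: "'d cspace \<Rightarrow> real"
  assumes p: "p \<in> poly_fun m" and n: "n > 0" and V: "continuous_on UNIV V" "\<And>z. V z \<ge> 0" and "\<epsilon> > 0"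
    and bound: "\<And>z. cmod (p z) \<le> exp (real n * (V z + \<epsilon>))"
    and a: "cmod (p a) \<ge> exp (real n * (V a - \<epsilon>))"
    and osc: "\<And>z. z \<in> ball a r \<Longrightarrow> \<bar>V z - V a\<bar> \<le> \<epsilon>"
  shows "(\<integral>\<^sup>+z. ennreal \<bar>ln (cmod (p z)) / real n - V z\<bar> * indicator (ball a r) z \<partial>lborel)
    \<le> ennreal (6 * \<epsilon>) * emeasure lborel (ball a r)"
proof -
  \<comment> \<open>One \<epsilon> is the slack of the upper bound, the other the oscillation of
    \<open>V\<close> on the ball.\<close>
  define A where "A = real n * (V a + 2 * \<epsilon>)"
  have A: "A \<ge> 0" unfolding A_def using V(2)[of a] \<open>\<epsilon> > 0\<close> by simp
  have nz: "p a \<noteq> 0" using a by (metis exp_gt_zero norm_zero not_le)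
  have le: "cmod (p z) \<le> exp A" if "z \<in> ball a r" for z
  proof -
    have "V z + \<epsilon> \<le> V a + 2 * \<epsilon>" using osc[OF that] by linarith
    then have "real n * (V z + \<epsilon>) \<le> A" unfolding A_def by (rule mult_left_mono) simp
    then show ?thesis using bound[of z] by (meson exp_le_cancel_iff order_trans)
  qed
  have ln_le: "ln (cmod (p z)) \<le> A" if "z \<in> ball a r" for z
    using le[OF that] A by (cases "p z = 0") (auto simp: ln_le_cancel_iff[symmetric, of _ "exp A"] simp del: ln_le_cancel_iff)
  let ?G = "\<lambda>z. ennreal (A - ln (cmod (p z))) * indicator (ball a r) z"
  have G_meas: "?G \<in> borel_measurable lborel"
    using borel_measurable_ln_poly_fun[OF p]
    by (intro borel_measurable_times_ennreal borel_measurable_indicator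
        measurable_compose[OF _ measurable_ennreal] borel_measurable_diff) auto
  have "(\<integral>\<^sup>+z. ennreal \<bar>ln (cmod (p z)) / real n - V z\<bar> * indicator (ball a r) z \<partial>lborel)
      \<le> (\<integral>\<^sup>+z. ennreal (1 / real n) * ?G z + ennreal (3 * \<epsilon>) * indicator (ball a r) z \<partial>lborel)"
  proof (rule nn_integral_mono)
    fix z
    show "ennreal \<bar>ln (cmod (p z)) / real n - V z\<bar> * indicator (ball a r) z
        \<le> ennreal (1 / real n) * ?G z + ennreal (3 * \<epsilon>) * indicator (ball a r) z"
    proof (cases "z \<in> ball a r")
      case True
      have "\<bar>ln (cmod (p z)) / real n - V z\<bar> \<le> \<bar>ln (cmod (p z)) / real n - A / real n\<bar> + \<bar>A / real n - V z\<bar>"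
        by linarith
      also have "\<bar>ln (cmod (p z)) / real n - A / real n\<bar> = 1 / real n * (A - ln (cmod (p z)))"
        using ln_le[OF True] n by (simp add: diff_divide_distrib[symmetric])
      also have "A / real n = V a + 2 * \<epsilon>" using n by (simp add: A_def)
      also have "\<bar>V a + 2 * \<epsilon> - V z\<bar> \<le> 3 * \<epsilon>" using osc[OF True] \<open>\<epsilon> > 0\<close> by linarith
      finally have "\<bar>ln (cmod (p z)) / real n - V z\<bar> \<le> 1 / real n * (A - ln (cmod (p z))) + 3 * \<epsilon>"
        by simp
      then have "ennreal \<bar>ln (cmod (p z)) / real n - V z\<bar> \<le> ennreal (1 / real n * (A - ln (cmod (p z))) + 3 * \<epsilon>)"
        by (rule ennreal_leI)
      also have "\<dots> = ennreal (1 / real n) * ennreal (A - ln (cmod (p z))) + ennreal (3 * \<epsilon>)"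
        using ln_le[OF True] \<open>\<epsilon> > 0\<close> by (subst ennreal_plus) (simp_all add: ennreal_mult[symmetric])
      finally show ?thesis using True by simp
    qed simp
  qed
  also have "\<dots> = ennreal (1 / real n) * integral\<^sup>N lborel ?G + ennreal (3 * \<epsilon>) * emeasure lborel (ball a r)"
  proof (subst nn_integral_add)
    show "(\<integral>\<^sup>+z. ennreal (1 / real n) * ?G z \<partial>lborel) + (\<integral>\<^sup>+z. ennreal (3 * \<epsilon>) * indicator (ball a r) z \<partial>lborel) =
        ennreal (1 / real n) * integral\<^sup>N lborel ?G + ennreal (3 * \<epsilon>) * emeasure lborel (ball a r)"
      by (simp only: nn_integral_cmult[OF G_meas]) (subst nn_integral_cmult_indicator, auto)
    show "(\<lambda>z. ennreal (1 / real n) * ?G z) \<in> borel_measurable lborel"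
      by (rule borel_measurable_times_ennreal[OF _ G_meas]) simp
  qed (auto intro!: borel_measurable_times_ennreal borel_measurable_indicator)
  also have "integral\<^sup>N lborel ?G \<le> ennreal (A - ln (cmod (p a))) * emeasure lborel (ball a r)"
    by (rule nn_integral_ball_le[OF p A nz le])
  also have "ennreal (A - ln (cmod (p a))) \<le> ennreal (3 * real n * \<epsilon>)"
  proof (rule ennreal_leI)
    have "real n * (V a - \<epsilon>) \<le> ln (cmod (p a))"
      using a nz by (subst ln_ge_iff) auto
    then show "A - ln (cmod (p a)) \<le> 3 * real n * \<epsilon>" by (simp add: A_def algebra_simps)
  qed
  also have "ennreal (1 / real n) * (ennreal (3 * real n * \<epsilon>) * emeasure lborel (ball a r))
      + ennreal (3 * \<epsilon>) * emeasure lborel (ball a r) = ennreal (6 * \<epsilon>) * emeasure lborel (ball a r)"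
  proof -
    have "ennreal (1 / real n) * ennreal (3 * real n * \<epsilon>) = ennreal (3 * \<epsilon>)"
      using n \<open>\<epsilon> > 0\<close> by (subst ennreal_mult[symmetric]) auto
    moreover have "ennreal (6 * \<epsilon>) = ennreal (3 * \<epsilon>) + ennreal (3 * \<epsilon>)"
      using \<open>\<epsilon> > 0\<close> by (subst ennreal_plus[symmetric]) auto
    ultimately show ?thesis by (simp add: mult.assoc[symmetric] distrib_right)
  qed
  finally show ?thesis by (simp add: mult_left_mono mult_right_mono add_right_mono)
qed

text \<open>The good point in each ball may depend on \<open>p\<close>; only the centres
  \<open>X\<close> and the radius are fixed in advance.\<close>

definition close_at_points ::
    "('d::finite cspace \<Rightarrow> real) \<Rightarrow> real \<Rightarrow> 'd cspace set \<Rightarrow> real \<Rightarrow> nat \<Rightarrow> ('d cspace \<Rightarrow> complex) \<Rightarrow> bool" where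
  "close_at_points V \<epsilon> X \<rho> n p \<longleftrightarrow> (\<forall>z. cmod (p z) \<le> exp (real n * (V z + \<epsilon>))) \<and>
     (\<forall>x\<in>X. \<exists>z\<in>ball x \<rho>. cmod (p z) \<ge> exp (real n * (V z - \<epsilon>)))"

text \<open>The factor \<open>\<kappa>\<close> does not depend on \<open>\<epsilon>\<close>: the smaller balls of the Vitali covering are
  disjoint, so the total volume of the enlarged balls stays bounded.\<close>

lemma L1_estimate_from_points:
  fixes V :: "'d::finite cspace \<Rightarrow> real"
  assumes V: "continuous_on UNIV V" "\<And>z. V z \<ge> 0" and C: "compact C"
  obtains \<kappa> where "\<kappa> > 0"
    "\<forall>\<epsilon>>0. \<exists>X \<rho>. finite X \<and> \<rho> > 0 \<and>
       (\<forall>n m p. n > 0 \<and> p \<in> poly_fun m \<and> close_at_points V \<epsilon> X \<rho> n p \<longrightarrow>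
          (\<integral>\<^sup>+z\<in>C. ennreal \<bar>ln (cmod (p z)) / real n - V z\<bar> \<partial>lborel) \<le> ennreal (\<kappa> * \<epsilon>))"
proof -
  obtain R where R: "C \<subseteq> cball 0 R" "R > 0"
    using compact_imp_bounded[OF C] unfolding bounded_pos by (metis mem_cball_0 subsetI)
  define W where "W = measure lborel (ball (0::'d cspace) (R + 2))"
  define D where "D = DIM('d cspace)"
  define \<kappa> where "\<kappa> = 6 * 7 ^ D * W"
  have W: "W > 0" unfolding W_def using content_ball_pos[of "R + 2" "0::'d cspace"] R by simp
  have \<kappa>: "\<kappa> > 0" using W by (simp add: \<kappa>_def)
  have est: "\<exists>X \<rho>. finite X \<and> \<rho> > 0 \<and>
       (\<forall>n m p. n > 0 \<and> p \<in> poly_fun m \<and> close_at_points V \<epsilon> X \<rho> n p \<longrightarrow>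
          (\<integral>\<^sup>+z\<in>C. ennreal \<bar>ln (cmod (p z)) / real n - V z\<bar> \<partial>lborel) \<le> ennreal (\<kappa> * \<epsilon>))"
    if \<epsilon>: "\<epsilon> > 0" for \<epsilon>
  proof -
    have "uniformly_continuous_on (cball 0 (R + 20)) V"
      by (intro compact_uniformly_continuous continuous_on_subset[OF V(1)]) auto
    then obtain \<delta> where \<delta>: "\<delta> > 0"
      "\<And>x y. x \<in> cball 0 (R + 20) \<Longrightarrow> y \<in> cball 0 (R + 20) \<Longrightarrow> dist y x < \<delta> \<Longrightarrow> dist (V y) (V x) < \<epsilon>"
      unfolding uniformly_continuous_on_def using \<epsilon> by meson
    \<comment> \<open>The factor 20 is generous: balls of radius \<open>7 * \<rho>\<close> around
      the good points must have oscillation at most \<epsilon> and stay in the larger ball on which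
      \<delta> was chosen.\<close>
    define \<rho> where "\<rho> = min 1 \<delta> / 20"
    have \<rho>: "\<rho> > 0" "20 * \<rho> \<le> 1" "20 * \<rho> \<le> \<delta>" using \<delta> by (auto simp: \<rho>_def)
    have "C \<subseteq> (\<Union>i\<in>C. cball (id i) ((\<lambda>_. \<rho>) i))" using \<rho> by auto
    then obtain Y where Y: "countable Y" "Y \<subseteq> C" "pairwise (\<lambda>i j. disjnt (cball (id i) \<rho>) (cball (id j) \<rho>)) Y"
      "C \<subseteq> (\<Union>i\<in>Y. cball (id i) (5 * \<rho>))"
      by (rule Vitali_covering_lemma_cballs[where B = \<rho>]) (use \<rho> in auto)
    \<comment> \<open>The radius grows from 5 \<rho> to 6 \<rho> to get open balls and a finite
      subcover; recentring at a good point at distance less than \<rho> then leads to 7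
      \<rho>.\<close>
    have cover: "C \<subseteq> (\<Union>i\<in>Y. ball i (6 * \<rho>))"
    proof
      fix z assume "z \<in> C"
      then obtain i where "i \<in> Y" "dist i z \<le> 5 * \<rho>" using Y(4) by auto
      then show "z \<in> (\<Union>i\<in>Y. ball i (6 * \<rho>))" using \<rho>(1) by (intro UN_I[of i]) auto
    qed
    obtain X where X: "X \<subseteq> Y" "finite X" "C \<subseteq> (\<Union>i\<in>X. ball i (6 * \<rho>))"
      using compactE_image[OF C _ cover] by (metis open_ball)
    have disj: "disjoint_family_on (\<lambda>i. ball i \<rho>) X"
      unfolding disjoint_family_on_def
    proof (intro ballI impI)
      fix i j assume "i \<in> X" "j \<in> X" "i \<noteq> j"
      then have "cball i \<rho> \<inter> cball j \<rho> = {}"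
        using Y(3) X(1) by (auto simp: pairwise_def disjnt_def)
      then show "ball i \<rho> \<inter> ball j \<rho> = {}" using ball_subset_cball by blast
    qed
    have XR: "norm x \<le> R" if "x \<in> X" for x
    proof -
      have "x \<in> cball 0 R" using that X(1) Y(2) R(1) by blast
      then show ?thesis by simp
    qed
    have vol7: "measure lborel (ball y (7 * \<rho>)) = 7 ^ D * measure lborel (ball x \<rho>)" for x y :: "'d cspace"
      using content_ball_conv_unit_ball[of "7 * \<rho>" y] content_ball_conv_unit_ball[of \<rho> x] \<rho>(1)
      by (simp add: D_def power_mult_distrib)
    have "(\<Sum>x\<in>X. measure lborel (ball x \<rho>)) = measure lborel (\<Union>x\<in>X. ball x \<rho>)"
    proof (rule measure_finite_Union[OF X(2) _ disj, symmetric])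
      show "emeasure lborel (ball x \<rho>) \<noteq> \<infinity>" for x :: "'d cspace"
        using emeasure_lborel_ball_finite[of x \<rho>] by auto
    qed auto
    also have "\<dots> \<le> W" unfolding W_def
    proof (rule measure_mono_fmeasurable)
      show "(\<Union>x\<in>X. ball x \<rho>) \<subseteq> ball 0 (R + 2)"
      proof clarify
        fix x y assume "x \<in> X" "y \<in> ball x \<rho>"
        then show "y \<in> ball 0 (R + 2)"
          using XR[of x] \<rho> norm_triangle_sub[of y x] by (simp add: dist_norm norm_minus_commute)
      qed
      show "ball (0::'d cspace) (R + 2) \<in> fmeasurable lborel"
        using emeasure_lborel_ball_finite by (auto simp: fmeasurable_def)
    qed (auto intro!: borel_open)
    finally have sumW: "(\<Sum>x\<in>X. measure lborel (ball x \<rho>)) \<le> W" .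
    have "(\<integral>\<^sup>+z\<in>C. ennreal \<bar>ln (cmod (p z)) / real n - V z\<bar> \<partial>lborel) \<le> ennreal (\<kappa> * \<epsilon>)"
      if n: "n > 0" and p: "p \<in> poly_fun m" and close: "close_at_points V \<epsilon> X \<rho> n p" for n m p
    proof -
      note up = close[unfolded close_at_points_def, THEN conjunct1]
        and low = close[unfolded close_at_points_def, THEN conjunct2]
      obtain a where a: "\<And>x. x \<in> X \<Longrightarrow> a x \<in> ball x \<rho>" "\<And>x. x \<in> X \<Longrightarrow> cmod (p (a x)) \<ge> exp (real n * (V (a x) - \<epsilon>))"
        using low by metis
      let ?F = "\<lambda>z. ennreal \<bar>ln (cmod (p z)) / real n - V z\<bar>"
      have "V \<in> borel_measurable borel" by (rule borel_measurable_continuous_onI[OF V(1)])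
      with borel_measurable_ln_poly_fun[OF p] have F [measurable]: "?F \<in> borel_measurable borel" by measurable
      have "(\<integral>\<^sup>+z. ?F z * indicator C z \<partial>lborel) \<le>
          (\<integral>\<^sup>+z. (\<Sum>x\<in>X. ?F z * indicator (ball (a x) (7 * \<rho>)) z) \<partial>lborel)"
      proof (rule nn_integral_mono)
        fix z
        show "?F z * indicator C z \<le> (\<Sum>x\<in>X. ?F z * indicator (ball (a x) (7 * \<rho>)) z)"
        proof (cases "z \<in> C")
          case True
          then obtain x where x: "x \<in> X" "z \<in> ball x (6 * \<rho>)" using X(3) by auto
          have "z \<in> ball (a x) (7 * \<rho>)"
            using x(2) a(1)[OF x(1)] dist_triangle[of "a x" z x] by (simp add: dist_commute)
          then have "?F z * indicator C z \<le> ?F z * indicator (ball (a x) (7 * \<rho>)) z" using True by simp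
          also have "\<dots> \<le> (\<Sum>x\<in>X. ?F z * indicator (ball (a x) (7 * \<rho>)) z)"
            using x(1) X(2) by (intro member_le_sum) auto
          finally show ?thesis .
        qed simp
      qed
      also have "\<dots> = (\<Sum>x\<in>X. \<integral>\<^sup>+z. ?F z * indicator (ball (a x) (7 * \<rho>)) z \<partial>lborel)"
        by (intro nn_integral_sum) (auto intro!: borel_measurable_times_ennreal borel_measurable_indicator F)
      also have "\<dots> \<le> (\<Sum>x\<in>X. ennreal (6 * \<epsilon>) * emeasure lborel (ball (a x) (7 * \<rho>)))"
      proof (rule sum_mono)
        fix x assume x: "x \<in> X"
        have na: "norm (a x) \<le> R + 1"
          using a(1)[OF x] XR[OF x] \<rho> norm_triangle_sub[of "a x" x] by (simp add: dist_norm norm_minus_commute)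
        show "(\<integral>\<^sup>+z. ?F z * indicator (ball (a x) (7 * \<rho>)) z \<partial>lborel) \<le> ennreal (6 * \<epsilon>) * emeasure lborel (ball (a x) (7 * \<rho>))"
        proof (rule nn_integral_ball_potential_le[OF p n V \<epsilon> _ a(2)[OF x]])
          show "cmod (p z) \<le> exp (real n * (V z + \<epsilon>))" for z using up by simp
          fix z assume z: "z \<in> ball (a x) (7 * \<rho>)"
          then have "norm z \<le> R + 20"
            using na \<rho> norm_triangle_sub[of z "a x"] by (simp add: dist_norm norm_minus_commute)
          moreover have "dist z (a x) < \<delta>" using z \<rho> by (simp add: dist_commute)
          ultimately have "dist (V z) (V (a x)) < \<epsilon>" using na by (intro \<delta>(2)) auto
          then show "\<bar>V z - V (a x)\<bar> \<le> \<epsilon>" by (simp add: dist_real_def)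
        qed
      qed
      also have "\<dots> = (\<Sum>x\<in>X. ennreal (6 * \<epsilon> * 7 ^ D * measure lborel (ball x \<rho>)))"
      proof (rule sum.cong[OF refl])
        fix x
        have "emeasure lborel (ball (a x) (7 * \<rho>)) = ennreal (measure lborel (ball (a x) (7 * \<rho>)))"
          using emeasure_lborel_ball_finite[of "a x" "7 * \<rho>"] by (intro emeasure_eq_ennreal_measure) auto
        then have "emeasure lborel (ball (a x) (7 * \<rho>)) = ennreal (7 ^ D * measure lborel (ball x \<rho>))"
          by (simp only: vol7[of "a x" x])
        then show "ennreal (6 * \<epsilon>) * emeasure lborel (ball (a x) (7 * \<rho>)) = ennreal (6 * \<epsilon> * 7 ^ D * measure lborel (ball x \<rho>))"
          using \<epsilon> by (simp add: ennreal_mult[symmetric] mult_ac)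
      qed
      also have "\<dots> = ennreal (6 * \<epsilon> * 7 ^ D * (\<Sum>x\<in>X. measure lborel (ball x \<rho>)))"
        using \<epsilon> by (subst sum_ennreal) (auto simp: sum_distrib_left)
      also have "\<dots> \<le> ennreal (6 * \<epsilon> * 7 ^ D * W)"
        using \<epsilon> by (intro ennreal_leI mult_left_mono sumW) auto
      finally show ?thesis by (simp add: \<kappa>_def mult_ac)
    qed
    then show ?thesis using X(2) \<rho>(1) by blast
  qed
  show ?thesis by (rule that[OF \<kappa>]) (intro allI impI est)
qed


section \<open>The extremal function\<close>

text \<open>Maximum principle for the reflected polynomial on the disc of radius 1 / s, whose
  boundary values are those of \<open>g\<close> on the circle of radius s, up to the factor 1 / s to
  the degree.\<close>

lemma poly_growth_disc:
  fixes g :: "complex poly"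
  assumes "degree g \<le> D" "\<And>\<zeta>. cmod \<zeta> \<le> s \<Longrightarrow> cmod (poly g \<zeta>) \<le> B" "0 < s" "s \<le> 1"
  shows "cmod (poly g 1) \<le> B / s ^ D"
proof -
  let ?h = "poly (reflect_poly g)"
  have B: "B \<ge> 0" using assms(2)[of 0] assms(3) using order_trans[OF norm_ge_zero] by force
  have "cmod (?h 1) \<le> B / s ^ degree g"
  proof (rule maximum_modulus_frontier[of ?h "cball 0 (1 / s)"])
    fix z assume "z \<in> frontier (cball 0 (1 / s) :: complex set)"
    then have z: "cmod z = 1 / s" using assms(3) by (simp add: frontier_cball)
    then have "z \<noteq> 0" using assms(3) by auto
    then have "cmod (?h z) = cmod z ^ degree g * cmod (poly g (inverse z))"
      by (simp add: poly_reflect_poly_nz norm_mult norm_power)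
    also have "cmod (poly g (inverse z)) \<le> B"
      by (rule assms(2)) (simp add: norm_inverse z)
    finally show "cmod (?h z) \<le> B / s ^ degree g"
      using assms(3) by (simp add: z power_divide mult_left_mono divide_right_mono)
  qed (use assms in \<open>auto intro!: holomorphic_intros continuous_intros\<close>)
  also have "\<dots> \<le> B / s ^ D"
    using assms B by (intro divide_left_mono power_decreasing) auto
  finally show ?thesis by (simp add: poly_reflect_poly_nz)
qed

lemma poly_fun_0_const: "f \<in> poly_fun 0 \<Longrightarrow> f x = f y"
proof -
  assume "f \<in> poly_fun 0"
  moreover have "{\<alpha> :: 'a multiindex. mi_size \<alpha> \<le> 0} = {0}"
    by (auto simp: mi_size_def vec_eq_iff)
  ultimately show ?thesis
    by (auto simp: mono_span_def monomial_def)
qed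

lemma log_abs_div_le_iff:
  assumes "D > 0"
  shows "log_abs w / ereal D \<le> ereal v \<longleftrightarrow> cmod w \<le> exp (D * v)"
proof (cases "w = 0")
  case False
  then have "log_abs w / ereal D \<le> ereal v \<longleftrightarrow> ln (cmod w) \<le> D * v"
    using assms by (simp add: log_abs_def field_simps)
  also have "\<dots> \<longleftrightarrow> cmod w \<le> exp (D * v)"
    using False by (metis exp_le_cancel_iff exp_ln zero_less_norm_iff)
  finally show ?thesis .
qed (use assms in \<open>simp add: log_abs_def\<close>)

section \<open>Finiteness of the extremal function and growth of polynomials\<close>

locale regular_compact =
  fixes K :: "'d::{finite,linorder} cspace set"
  assumes compact_K: "compact K" and regular: "regular_set K" and nonempty: "K \<noteq> {}"
begin

definition V :: "'d cspace \<Rightarrow> real" where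
  "V z = real_of_ereal (extremal_function K z)"

lemma extremal_function_ge:
  assumes f: "f \<in> poly_fun n" "\<And>x. x \<in> K \<Longrightarrow> cmod (f x) \<le> 1" "f x \<noteq> f y"
  obtains D where "0 < D" "D \<le> n" "log_abs (f z) / ereal (real D) \<le> extremal_function K z"
proof -
  obtain p where p: "total_degree p \<le> n" "f = poly_eval p"
    using poly_fun_eq_poly_eval[OF f(1)] by blast
  have "total_degree p \<noteq> 0"
    using poly_eval_poly_fun[of p] poly_fun_0_const[of f x y] f(3) p(2) by metis
  then show ?thesis
    using p f(2) by (intro that[of "total_degree p"]) (auto simp: extremal_function_def intro!: SUP_upper)
qed

text \<open>Constants are not competitors, so 1 is approached by the linear polynomials (1 - t) + t
  x_i / R with t tending to 0. They are bounded by 1 on \<open>K\<close> as convex combinations, and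
  their logarithms at \<open>z\<close> tend to 0.\<close>

lemma extremal_function_nonneg: "extremal_function K z \<ge> 0"
proof -
  obtain R where R: "R > 0" "\<And>x. x \<in> K \<Longrightarrow> norm x \<le> R"
    using compact_imp_bounded[OF compact_K] unfolding bounded_pos by blast
  define i :: 'd where "i = undefined"
  define w where "w = z $ i / of_real R"
  define f where "f = (\<lambda>k x. 1 + complex_of_real (1 / real (Suc k)) * ((x :: 'd cspace) $ i / of_real R - 1))"
  have mon: "(\<lambda>x. x $ i) = monomial (axis i 1)"
    by (rule ext) (simp add: monomial_def axis_def if_distrib[of "power _"] prod.delta cong: if_cong)
  have size: "mi_size (axis i 1 :: 'd multiindex) \<le> 1"
    by (simp add: mi_size_def axis_def)
  have le: "ereal (ln (cmod (f k z))) \<le> extremal_function K z" if fz: "f k z \<noteq> 0" for k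
  proof -
    let ?t = "1 / real (Suc k)"
    have f_alt: "f k = (\<lambda>x. complex_of_real (1 - ?t) + (complex_of_real ?t / of_real R) * x $ i)"
      by (simp add: f_def algebra_simps fun_eq_iff)
    have poly: "f k \<in> poly_fun 1"
      unfolding f_alt using poly_fun_monomial[OF size]
      by (intro mono_span_add poly_fun_const mono_span_cmult) (simp add: mon)
    have bnd: "cmod (f k x) \<le> 1" if "x \<in> K" for x
    proof -
      have "cmod (x $ i) \<le> R" using R(2)[OF that] Finite_Cartesian_Product.norm_nth_le[of x i] by linarith
      then have "cmod (complex_of_real ?t / of_real R * x $ i) \<le> ?t"
        using R(1) by (simp add: norm_mult norm_divide field_simps del: of_real_divide of_nat_Suc)
      moreover have "cmod (complex_of_real (1 - ?t)) = 1 - ?t" by (simp only: norm_of_real) simp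
      ultimately show ?thesis
        unfolding f_alt using norm_triangle_ineq[of "complex_of_real (1 - ?t)" "complex_of_real ?t / of_real R * x $ i"]
        by linarith
    qed
    have "f k 0 \<noteq> f k (axis i 1)" using R(1) by (simp add: f_alt del: of_nat_Suc)
    from extremal_function_ge[OF poly bnd this] obtain D where
      D: "0 < D" "D \<le> 1" "log_abs (f k z) / ereal (real D) \<le> extremal_function K z" by metis
    then have "D = 1" by simp
    with D(3) fz show ?thesis by (simp add: log_abs_def divide_ereal_def one_ereal_def[symmetric])
  qed
  have lim: "(\<lambda>k. f k z) \<longlonglongrightarrow> 1"
  proof -
    have "(\<lambda>k. f k z) \<longlonglongrightarrow> 1 + complex_of_real 0 * (z $ i / of_real R - 1)"
      unfolding f_def by (intro tendsto_intros LIMSEQ_Suc[OF lim_1_over_n])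
    then show ?thesis by simp
  qed
  have "(\<lambda>k. ereal (ln (cmod (f k z)))) \<longlonglongrightarrow> ereal (ln (cmod 1))"
    by (intro tendsto_intros lim) auto
  moreover have "\<forall>\<^sub>F k in sequentially. ereal (ln (cmod (f k z))) \<le> extremal_function K z"
    by (rule eventually_mono[OF tendsto_imp_eventually_ne[OF lim one_neq_zero]]) (rule le)
  ultimately have "ereal (ln (cmod 1)) \<le> extremal_function K z"
    by (rule tendsto_upperbound) simp
  then show ?thesis by (simp add: zero_ereal_def)
qed

text \<open>Near a point of \<open>K\<close> the extremal function is at most \<open>1\<close> by continuity, and the growth of a
  polynomial along the complex lines through that point bounds it everywhere.\<close>

lemma extremal_function_finite: "extremal_function K z < \<infinity>"
proof -
  obtain a where a: "a \<in> K" using nonempty by blast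
  have "extremal_function K a \<le> 0"
    unfolding extremal_function_def
  proof (rule SUP_least)
    fix p assume "p \<in> {p. 0 < total_degree p \<and> (\<forall>x\<in>K. cmod (poly_eval p x) \<le> 1)}"
    then have "0 < real (total_degree p)" "cmod (poly_eval p a) \<le> 1" using a by auto
    then show "log_abs (poly_eval p a) / ereal (real (total_degree p)) \<le> 0"
      using log_abs_div_le_iff[of "real (total_degree p)" "poly_eval p a" 0] by (simp add: zero_ereal_def)
  qed
  have "open {x. extremal_function K x < 1}"
    using regular unfolding regular_set_def
    by (intro open_Collect_less continuous_on_const) auto
  moreover have "a \<in> {x. extremal_function K x < 1}"
    using \<open>extremal_function K a \<le> 0\<close> by (simp add: le_less_trans)
  ultimately obtain r where r: "r > 0" "ball a r \<subseteq> {x. extremal_function K x < 1}"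
    by (rule openE)
  \<comment> \<open>Parameters of modulus at most \<open>s\<close> on the line from \<open>a\<close>
    to \<open>z\<close> stay in \<open>ball a r\<close>: the 2 makes the inclusion strict, and the 1
    avoids a zero denominator when \<open>z\<close> equals \<open>a\<close>.\<close>
  define s where "s = min 1 (r / (2 * (norm (z - a) + 1)))"
  have s: "0 < s" "s \<le> 1" using r(1) by (auto simp: s_def add_nonneg_pos)
  have s_ball: "a + \<zeta> *s (z - a) \<in> ball a r" if "cmod \<zeta> \<le> s" for \<zeta>
  proof -
    have "cmod \<zeta> * norm (z - a) \<le> r / (2 * (norm (z - a) + 1)) * (norm (z - a) + 1)"
      using that r(1) by (intro mult_mono) (auto simp: s_def)
    also have "\<dots> = r / 2"
    proof -
      have "norm (z - a) + 1 \<noteq> 0" using norm_ge_zero[of "z - a"] by linarith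
      then show ?thesis by (simp add: field_simps del: mult_2)
    qed
    also have "\<dots> < r" using r(1) by simp
    finally have "norm (\<zeta> *s (z - a)) < r" by (simp only: norm_scalar_vec)
    moreover have "dist a (a + w) = norm w" for w by (simp add: dist_norm)
    ultimately show ?thesis by (simp only: mem_ball)
  qed
  have "extremal_function K z \<le> ereal (1 - ln s)"
    unfolding extremal_function_def
  proof (rule SUP_least)
    fix p assume "p \<in> {p. 0 < total_degree p \<and> (\<forall>x\<in>K. cmod (poly_eval p x) \<le> 1)}"
    then have p: "0 < total_degree p" "\<forall>x\<in>K. cmod (poly_eval p x) \<le> 1" by auto
    define D where "D = total_degree p"
    have D: "real D > 0" using p by (simp add: D_def)
    have small: "cmod (poly_eval p x) \<le> exp (real D)" if "x \<in> ball a r" for x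
    proof -
      have "log_abs (poly_eval p x) / ereal (real D) \<le> extremal_function K x"
        unfolding extremal_function_def D_def by (rule SUP_upper) (use p in auto)
      also have "\<dots> \<le> ereal 1" using r(2) that by (auto simp: one_ereal_def[symmetric])
      finally show ?thesis by (subst (asm) log_abs_div_le_iff[OF D]) simp
    qed
    obtain g where g: "degree g \<le> D" "\<And>\<zeta>. poly_eval p (a + \<zeta> *s (z - a)) = poly g \<zeta>"
      using poly_fun_line[OF poly_eval_poly_fun[of p], of a "z - a"] unfolding D_def by blast
    have "cmod (poly g 1) \<le> exp (real D) / s ^ D"
    proof (rule poly_growth_disc[OF g(1) _ s])
      fix \<zeta> assume "cmod \<zeta> \<le> s"
      then show "cmod (poly g \<zeta>) \<le> exp (real D)"
        unfolding g(2)[symmetric] by (intro small s_ball)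
    qed
    also have "poly g 1 = poly_eval p z" using g(2)[of 1] by simp
    also have "exp (real D) / s ^ D = exp (real D * (1 - ln s))"
      using s by (simp add: algebra_simps exp_diff exp_of_nat_mult)
    finally show "log_abs (poly_eval p z) / ereal (real (total_degree p)) \<le> ereal (1 - ln s)"
      using log_abs_div_le_iff[OF D] by (simp add: D_def)
  qed
  then show ?thesis by (rule le_less_trans) simp
qed

lemma ereal_V: "ereal (V z) = extremal_function K z"
  unfolding V_def using extremal_function_nonneg[of z] extremal_function_finite[of z]
  by (cases "extremal_function K z") auto

lemma V_nonneg: "V z \<ge> 0"
  using extremal_function_nonneg[of z] by (simp add: ereal_V[symmetric])

lemma continuous_on_V: "continuous_on S V"
proof -
  have "continuous_on UNIV (\<lambda>z. ereal (V z))"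
    using regular by (simp add: ereal_V regular_set_def)
  then show ?thesis by (intro continuous_on_subset[of UNIV V S]) (simp_all add: continuous_on_iff_ereal comp_def)
qed

text \<open>For nonconstant \<open>f\<close> this is the definition of the extremal function after
  division by \<open>B\<close>; \<open>V \<ge> 0\<close> allows the true degree to be replaced by
  \<open>n\<close>. Constants need the separate case.\<close>

lemma bernstein_walsh:
  assumes f: "f \<in> poly_fun n" and B: "B > 0" "\<And>x. x \<in> K \<Longrightarrow> cmod (f x) \<le> B"
  shows "cmod (f z) \<le> B * exp (real n * V z)"
proof (cases "\<exists>x y. f x \<noteq> f y")
  case False
  obtain a where "a \<in> K" using nonempty by blast
  then have "cmod (f z) \<le> B" using False B(2) by metis
  also have "\<dots> \<le> B * exp (real n * V z)" using B(1) V_nonneg[of z] by simp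
  finally show ?thesis .
next
  case True
  then obtain x y where xy: "f x \<noteq> f y" by blast
  define g where "g = (\<lambda>z. (1 / of_real B) * f z)"
  have "g \<in> poly_fun n" unfolding g_def by (rule mono_span_cmult[OF f])
  moreover have "cmod (g x) \<le> 1" if "x \<in> K" for x
    using B(1) B(2)[OF that] by (simp add: g_def norm_mult norm_divide)
  moreover have "g x \<noteq> g y" using xy B(1) by (simp add: g_def)
  ultimately obtain D where D: "0 < D" "D \<le> n" "log_abs (g z) / ereal (real D) \<le> extremal_function K z"
    by (rule extremal_function_ge[where z = z])
  then have "cmod (g z) \<le> exp (real D * V z)"
    by (simp add: log_abs_div_le_iff ereal_V[symmetric])
  also have "\<dots> \<le> exp (real n * V z)" using D(2) V_nonneg[of z] by (simp add: mult_right_mono)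
  finally show ?thesis using B(1) by (simp add: g_def norm_mult norm_divide field_simps)
qed

text \<open>Any positive number bounds \<open>f\<close> on \<open>K\<close>, and \<open>B\<close> is
  chosen so that the Bernstein-Walsh bound at \<open>z\<close> is half of |f z|.\<close>

lemma poly_fun_zero_on_K:
  assumes f: "f \<in> poly_fun n" "\<And>x. x \<in> K \<Longrightarrow> f x = 0"
  shows "f z = 0"
proof (rule ccontr)
  assume nz: "f z \<noteq> 0"
  define B where "B = cmod (f z) / (2 * exp (real n * V z))"
  have "B > 0" using nz by (simp add: B_def)
  then have "cmod (f z) \<le> B * exp (real n * V z)" using f by (intro bernstein_walsh) auto
  then show False using nz by (simp add: B_def)
qed

lemma V_approx:
  assumes "\<delta> > 0"
  obtains D f where "D > 0" "f \<in> poly_fun D" "\<And>x. x \<in> K \<Longrightarrow> cmod (f x) \<le> 1"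
    "cmod (f z) > exp (real D * (V z - \<delta>))"
proof -
  have "ereal (V z - \<delta>) < extremal_function K z"
    using assms by (simp add: ereal_V[symmetric])
  then obtain p where p: "total_degree p > 0" "\<forall>x\<in>K. cmod (poly_eval p x) \<le> 1"
      "ereal (V z - \<delta>) < log_abs (poly_eval p z) / ereal (real (total_degree p))"
    unfolding extremal_function_def less_SUP_iff by auto
  have "cmod (poly_eval p z) > exp (real (total_degree p) * (V z - \<delta>))"
    using p(3) log_abs_div_le_iff[of "real (total_degree p)" "poly_eval p z" "V z - \<delta>"] p(1) by auto
  then show ?thesis using p poly_eval_poly_fun[of p] by (intro that[of "total_degree p" "poly_eval p"]) auto
qed

end


section \<open>Orthonormal polynomials\<close>

lemma mi_less_total: "\<alpha> \<noteq> \<beta> \<Longrightarrow> mi_less \<alpha> \<beta> \<or> mi_less \<beta> \<alpha>"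
proof -
  assume "\<alpha> \<noteq> \<beta>"
  then have "{l. \<alpha> $ l \<noteq> \<beta> $ l} \<noteq> {}" by (auto simp: vec_eq_iff)
  moreover define l where "l = Min {l. \<alpha> $ l \<noteq> \<beta> $ l}"
  ultimately have l: "\<alpha> $ l \<noteq> \<beta> $ l" "\<And>k. \<alpha> $ k \<noteq> \<beta> $ k \<Longrightarrow> l \<le> k"
    using Min_in[of "{l. \<alpha> $ l \<noteq> \<beta> $ l}"] by auto
  then have "\<forall>k<l. \<alpha> $ k = \<beta> $ k" by (meson not_le)
  with l(1) show ?thesis unfolding mi_less_def by (metis linorder_neqE_nat)
qed

locale bernstein_markov_pair = regular_compact K
  for K :: "'d::{finite,linorder} cspace set" +
  fixes \<tau> :: "'d cspace measure"
  assumes finite_tau: "finite_measure \<tau>" and sets_tau [measurable_cong]: "sets \<tau> = sets borel"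
    and tau_outside: "emeasure \<tau> (- K) = 0" and BM: "bernstein_markov K \<tau>"
begin

sublocale finite_measure \<tau> by (rule finite_tau)

abbreviation q :: "'d multiindex \<Rightarrow> 'd cspace \<Rightarrow> complex" where
  "q \<equiv> gram_schmidt \<tau>"

lemma AE_in_K: "AE x in \<tau>. x \<in> K"
  using tau_outside compact_imp_closed[OF compact_K]
  by (intro AE_I[of _ _ "- K"]) (auto simp: sets_tau)

lemma integrable_continuous:
  fixes f :: "'d cspace \<Rightarrow> 'b::{banach, second_countable_topology}"
  assumes "continuous_on UNIV f"
  shows "integrable \<tau> f"
proof -
  have "bounded (f ` K)"
    by (intro compact_imp_bounded compact_continuous_image continuous_on_subset[OF assms] compact_K) auto
  then obtain B where B: "\<And>x. x \<in> K \<Longrightarrow> norm (f x) \<le> B" unfolding bounded_iff by blast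
  have "AE x in \<tau>. norm (f x) \<le> B" using AE_in_K by eventually_elim (rule B)
  moreover have "f \<in> borel_measurable \<tau>"
    using borel_measurable_continuous_onI[OF assms] by simp
  ultimately show ?thesis by (rule integrable_const_bound)
qed

lemma L2_inner_diff:
  assumes "continuous_on UNIV f" "continuous_on UNIV g" "continuous_on UNIV h"
  shows "L2_inner \<tau> (\<lambda>z. f z - g z) h = L2_inner \<tau> f h - L2_inner \<tau> g h"
  unfolding L2_inner_def left_diff_distrib
  by (intro Bochner_Integration.integral_diff integrable_continuous continuous_intros assms)

lemma L2_inner_cmult: "L2_inner \<tau> (\<lambda>z. c * f z) h = c * L2_inner \<tau> f h"
  unfolding L2_inner_def mult.assoc by (rule integral_mult_right_zero)

lemma L2_inner_sum:
  assumes "\<And>i. i \<in> S \<Longrightarrow> continuous_on UNIV (f i)" "continuous_on UNIV h"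
  shows "L2_inner \<tau> (\<lambda>z. \<Sum>i\<in>S. f i z) h = (\<Sum>i\<in>S. L2_inner \<tau> (f i) h)"
  unfolding L2_inner_def sum_distrib_right
  by (intro Bochner_Integration.integral_sum integrable_continuous continuous_intros assms)

lemma L2_inner_cnj: "cnj (L2_inner \<tau> f g) = L2_inner \<tau> g f"
  unfolding L2_inner_def by (subst Bochner_Integration.integral_cnj[symmetric]) (simp add: mult.commute)

lemma L2_inner_self:
  assumes "continuous_on UNIV f"
  shows "L2_inner \<tau> f f = complex_of_real ((L2_nrm \<tau> f)\<^sup>2)"
proof -
  have "L2_inner \<tau> f f = (\<integral>z. complex_of_real ((cmod (f z))\<^sup>2) \<partial>\<tau>)"
    unfolding L2_inner_def by (simp add: complex_norm_square[symmetric])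
  also have "\<dots> = complex_of_real (\<integral>z. (cmod (f z))\<^sup>2 \<partial>\<tau>)"
    by (rule integral_complex_of_real)
  also have "(\<integral>z. (cmod (f z))\<^sup>2 \<partial>\<tau>) = (L2_nrm \<tau> f)\<^sup>2"
    unfolding L2_nrm_def by (subst real_sqrt_pow2) (auto intro!: integral_nonneg_AE)
  finally show ?thesis .
qed

lemma bernstein_markov_bound:
  assumes "\<epsilon> > 0"
  obtains M where "M > 0"
    "\<And>n f z. f \<in> poly_fun n \<Longrightarrow> z \<in> K \<Longrightarrow> cmod (f z) \<le> M * exp (\<epsilon> * real n) * L2_nrm \<tau> f"
proof -
  obtain M where M: "M > 0" "\<And>n p. total_degree p \<le> n \<Longrightarrow>
      (\<forall>z\<in>K. cmod (poly_eval p z) \<le> M * exp (\<epsilon> * real n) * L2_nrm \<tau> (poly_eval p))"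
    using BM assms unfolding bernstein_markov_def by metis
  show ?thesis
  proof (rule that[OF M(1)])
    fix n z and f :: "'d cspace \<Rightarrow> complex" assume "f \<in> poly_fun n" "z \<in> K"
    then show "cmod (f z) \<le> M * exp (\<epsilon> * real n) * L2_nrm \<tau> f"
      using M(2) by (metis poly_fun_eq_poly_eval)
  qed
qed

lemma L2_nrm_nonneg: "L2_nrm \<tau> f \<ge> 0"
  unfolding L2_nrm_def by (auto intro!: integral_nonneg_AE)

text \<open>The Bernstein-Markov inequality turns the L2 seminorm into a norm on polynomials: norm 0
  forces vanishing on \<open>K\<close>, and thereby everywhere.\<close>

lemma L2_nrm_eq_0:
  assumes "f \<in> poly_fun n" "L2_nrm \<tau> f = 0"
  shows "f z = 0"
proof -
  obtain M where "\<And>n f z. f \<in> poly_fun n \<Longrightarrow> z \<in> K \<Longrightarrow> cmod (f z) \<le> M * exp (1 * real n) * L2_nrm \<tau> f"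
    by (rule bernstein_markov_bound[OF zero_less_one]) blast
  then have "f x = 0" if "x \<in> K" for x using assms that by fastforce
  then show ?thesis by (rule poly_fun_zero_on_K[OF assms(1)])
qed

text \<open>The Gram-Schmidt vector before normalisation. Its norm has to be shown positive, since
  division by 0 would silently produce the zero function.\<close>

definition gs_residual :: "'d multiindex \<Rightarrow> 'd cspace \<Rightarrow> complex" where
  "gs_residual \<alpha> z = monomial \<alpha> z -
     (\<Sum>\<beta> | mi_less \<beta> \<alpha>. L2_inner \<tau> (monomial \<alpha>) (q \<beta>) * q \<beta> z)"

lemma gram_schmidt_residual: "q \<alpha> = (\<lambda>z. gs_residual \<alpha> z / complex_of_real (L2_nrm \<tau> (gs_residual \<alpha>)))"
  by (subst gram_schmidt.simps) (simp only: gs_residual_def[abs_def] Let_def)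

text \<open>One induction over the number of predecessors: the span of the earlier \<open>q\<close>
  shows that the residual is nonzero, and their orthonormality is needed for the new orthogonality
  relations.\<close>

lemma gram_schmidt_props:
  "q \<alpha> \<in> mono_span (insert \<alpha> {\<beta>. mi_less \<beta> \<alpha>}) \<and> L2_nrm \<tau> (gs_residual \<alpha>) > 0 \<and>
   L2_inner \<tau> (q \<alpha>) (q \<alpha>) = 1 \<and> (\<forall>\<beta>. mi_less \<beta> \<alpha> \<longrightarrow> L2_inner \<tau> (q \<alpha>) (q \<beta>) = 0)"
proof (induction "card {\<beta>. mi_less \<beta> \<alpha>}" arbitrary: \<alpha> rule: less_induct)
  case less
  let ?L = "{\<beta>. mi_less \<beta> \<alpha>}" and ?v = "gs_residual \<alpha>"
  have fin: "finite ?L" by (rule finite_mi_less)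
  note IH = less(1)[OF card_mi_less_mono]
  have q_low: "q \<beta> \<in> mono_span ?L" if "mi_less \<beta> \<alpha>" for \<beta>
    using IH[OF that] that by (auto intro!: mono_span_mono[OF _ _ fin] dest: mi_less_trans)
  have cont: "continuous_on UNIV (q \<beta>)" if "mi_less \<beta> \<alpha>" for \<beta>
    using q_low[OF that] by (rule continuous_on_mono_span)
  have low: "(\<lambda>z. \<Sum>\<beta>\<in>?L. L2_inner \<tau> (monomial \<alpha>) (q \<beta>) * q \<beta> z) \<in> mono_span ?L"
    by (intro mono_span_sum mono_span_cmult q_low) simp
  then obtain c where c: "\<And>z. (\<Sum>\<beta>\<in>?L. L2_inner \<tau> (monomial \<alpha>) (q \<beta>) * q \<beta> z) = (\<Sum>\<gamma>\<in>?L. c \<gamma> * monomial \<gamma> z)"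
    unfolding mono_span_def by blast
  have v_span: "?v \<in> mono_span (insert \<alpha> ?L)"
    unfolding gs_residual_def using fin
    by (intro mono_span_diff mono_span_monomial mono_span_mono[OF low]) auto
  have v_poly: "?v \<in> poly_fun (mi_size \<alpha>)"
    by (rule mono_span_mono[OF v_span]) (auto simp: mi_less_def finite_mi_size_le)
  have v_cont: "continuous_on UNIV ?v" by (rule continuous_on_mono_span[OF v_span])
  \<comment> \<open>A zero residual would express the monomial \<alpha> through strictly smaller
    ones.\<close>
  have nz: "L2_nrm \<tau> ?v \<noteq> 0"
  proof
    assume "L2_nrm \<tau> ?v = 0"
    from L2_nrm_eq_0[OF v_poly this] have v0: "monomial \<alpha> z = (\<Sum>\<gamma>\<in>?L. c \<gamma> * monomial \<gamma> z)" for z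
      by (simp add: gs_residual_def c)
    have notin: "\<alpha> \<notin> ?L" using mi_less_irrefl by simp
    have "(\<Sum>\<gamma>\<in>insert \<alpha> ?L. (if \<gamma> = \<alpha> then 1 else - c \<gamma>) * monomial \<gamma> z) = 0" for z
    proof -
      have "(\<Sum>\<gamma>\<in>?L. (if \<gamma> = \<alpha> then 1 else - c \<gamma>) * monomial \<gamma> z) = (\<Sum>\<gamma>\<in>?L. - (c \<gamma> * monomial \<gamma> z))"
        using notin by (intro sum.cong) auto
      then show ?thesis using fin notin by (simp add: v0 sum_negf)
    qed
    from monomials_independent[OF _ this, of \<alpha>] fin show False by simp
  qed
  then have pos: "L2_nrm \<tau> ?v > 0" using L2_nrm_nonneg[of ?v] by simp
  define r where "r = 1 / complex_of_real (L2_nrm \<tau> ?v)"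
  have q_eq: "q \<alpha> = (\<lambda>z. r * ?v z)"
    by (subst gram_schmidt_residual) (simp add: r_def)
  have scal: "L2_inner \<tau> (q \<alpha>) h = r * L2_inner \<tau> ?v h" for h
    unfolding q_eq by (rule L2_inner_cmult)
  have "L2_inner \<tau> (q \<alpha>) (q \<alpha>) = r * cnj (L2_inner \<tau> (q \<alpha>) ?v)"
    by (simp only: scal[of "q \<alpha>"] L2_inner_cnj)
  also have "\<dots> = r * cnj (r * L2_inner \<tau> ?v ?v)" by (simp only: scal)
  also have "\<dots> = 1"
    using pos by (simp add: L2_inner_self[OF v_cont] r_def power2_eq_square)
  finally have one: "L2_inner \<tau> (q \<alpha>) (q \<alpha>) = 1" .
  have orth: "L2_inner \<tau> (q \<alpha>) (q \<beta>) = 0" if b: "mi_less \<beta> \<alpha>" for \<beta>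
  proof -
    have delta: "L2_inner \<tau> (q \<gamma>) (q \<beta>) = (if \<gamma> = \<beta> then 1 else 0)" if g: "mi_less \<gamma> \<alpha>" for \<gamma>
    proof (cases "\<gamma> = \<beta>")
      case False
      then consider "mi_less \<gamma> \<beta>" | "mi_less \<beta> \<gamma>" using mi_less_total by blast
      then show ?thesis
      proof cases
        case 1
        then have "L2_inner \<tau> (q \<beta>) (q \<gamma>) = 0" using IH[OF b] by blast
        then show ?thesis using False L2_inner_cnj[of "q \<beta>" "q \<gamma>"] by simp
      qed (use False IH[OF g] in simp)
    qed (use IH[OF b] in simp)
    have "L2_inner \<tau> ?v (q \<beta>) = L2_inner \<tau> (monomial \<alpha>) (q \<beta>) -
        (\<Sum>\<gamma>\<in>?L. L2_inner \<tau> (monomial \<alpha>) (q \<gamma>) * L2_inner \<tau> (q \<gamma>) (q \<beta>))"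
    proof -
      have "L2_inner \<tau> (\<lambda>z. \<Sum>\<gamma>\<in>?L. L2_inner \<tau> (monomial \<alpha>) (q \<gamma>) * q \<gamma> z) (q \<beta>) =
          (\<Sum>\<gamma>\<in>?L. L2_inner \<tau> (monomial \<alpha>) (q \<gamma>) * L2_inner \<tau> (q \<gamma>) (q \<beta>))"
        by (subst L2_inner_sum) (auto simp: L2_inner_cmult intro!: continuous_intros cont b)
      moreover have "?v = (\<lambda>z. monomial \<alpha> z - (\<Sum>\<gamma>\<in>?L. L2_inner \<tau> (monomial \<alpha>) (q \<gamma>) * q \<gamma> z))"
        by (simp add: gs_residual_def fun_eq_iff)
      ultimately show ?thesis
        using L2_inner_diff[OF continuous_on_monomial continuous_on_mono_span[OF low] cont[OF b]] by simp
    qed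
    also have "(\<Sum>\<gamma>\<in>?L. L2_inner \<tau> (monomial \<alpha>) (q \<gamma>) * L2_inner \<tau> (q \<gamma>) (q \<beta>)) = L2_inner \<tau> (monomial \<alpha>) (q \<beta>)"
      using b fin by (simp add: delta if_distrib sum.delta cong: if_cong)
    finally show ?thesis by (simp add: q_eq L2_inner_cmult)
  qed
  have "q \<alpha> \<in> mono_span (insert \<alpha> ?L)"
    unfolding q_eq by (rule mono_span_cmult[OF v_span])
  then show ?case using pos one orth by blast
qed

lemma orthonormal: "L2_inner \<tau> (q \<alpha>) (q \<beta>) = (if \<alpha> = \<beta> then 1 else 0)"
proof (cases "\<alpha> = \<beta>")
  case False
  then consider "mi_less \<alpha> \<beta>" | "mi_less \<beta> \<alpha>" using mi_less_total by blast
  then show ?thesis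
  proof cases
    case 1
    then have "L2_inner \<tau> (q \<beta>) (q \<alpha>) = 0" using gram_schmidt_props[of \<beta>] by blast
    then show ?thesis using False L2_inner_cnj[of "q \<beta>" "q \<alpha>"] by simp
  qed (use False gram_schmidt_props[of \<alpha>] in simp)
qed (use gram_schmidt_props in simp)

lemma q_poly_fun: "q \<alpha> \<in> poly_fun (mi_size \<alpha>)"
  using gram_schmidt_props[of \<alpha>]
  by (auto intro!: mono_span_mono[OF _ _ finite_mi_size_le] simp: mi_less_def)

lemma continuous_on_q: "continuous_on S (q \<alpha>)"
  by (rule continuous_on_mono_span[OF q_poly_fun])

lemma L2_nrm_q: "L2_nrm \<tau> (q \<alpha>) = 1"
proof -
  have "complex_of_real ((L2_nrm \<tau> (q \<alpha>))\<^sup>2) = 1"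
    using L2_inner_self[OF continuous_on_q] orthonormal[of \<alpha> \<alpha>] by metis
  then have "(L2_nrm \<tau> (q \<alpha>))\<^sup>2 = 1" by (metis of_real_eq_1_iff)
  then show ?thesis using L2_nrm_nonneg[of "q \<alpha>"] by (simp add: power2_eq_1_iff)
qed

lemma poly_fun_q_expansion:
  assumes "f \<in> poly_fun n"
  shows "f z = (\<Sum>\<alpha> | mi_size \<alpha> \<le> n. L2_inner \<tau> f (q \<alpha>) * q \<alpha> z)"
proof -
  let ?N = "{\<alpha> :: 'd multiindex. mi_size \<alpha> \<le> n}"
  have fin: "finite ?N" by (rule finite_mi_size_le)
  \<comment> \<open>The triangular matrix expressing monomials by the \<open>q\<close>, read off
    from the Gram-Schmidt recursion; the norm of the residual stands on the diagonal.\<close>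
  define b where "b = (\<lambda>\<alpha> \<beta>. if \<beta> = \<alpha> then complex_of_real (L2_nrm \<tau> (gs_residual \<alpha>))
      else if mi_less \<beta> \<alpha> then L2_inner \<tau> (monomial \<alpha>) (q \<beta>) else 0)"
  have mono: "monomial \<alpha> z = (\<Sum>\<beta>\<in>?N. b \<alpha> \<beta> * q \<beta> z)" if "\<alpha> \<in> ?N" for \<alpha> z
  proof -
    have "(\<Sum>\<beta>\<in>?N. b \<alpha> \<beta> * q \<beta> z) = (\<Sum>\<beta>\<in>insert \<alpha> {\<beta>. mi_less \<beta> \<alpha>}. b \<alpha> \<beta> * q \<beta> z)"
      using that by (intro sum.mono_neutral_right fin) (auto simp: b_def mi_less_def)
    also have "\<dots> = b \<alpha> \<alpha> * q \<alpha> z + (\<Sum>\<beta> | mi_less \<beta> \<alpha>. b \<alpha> \<beta> * q \<beta> z)"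
      by (subst sum.insert) (auto simp: finite_mi_less mi_less_irrefl)
    also have "b \<alpha> \<alpha> * q \<alpha> z = gs_residual \<alpha> z"
      using gram_schmidt_props[of \<alpha>] by (subst gram_schmidt_residual) (simp add: b_def)
    also have "(\<Sum>\<beta> | mi_less \<beta> \<alpha>. b \<alpha> \<beta> * q \<beta> z) = (\<Sum>\<beta> | mi_less \<beta> \<alpha>. L2_inner \<tau> (monomial \<alpha>) (q \<beta>) * q \<beta> z)"
      by (intro sum.cong) (auto simp: b_def mi_less_irrefl)
    finally show ?thesis by (simp add: gs_residual_def)
  qed
  obtain a where a: "\<And>z. f z = (\<Sum>\<alpha>\<in>?N. a \<alpha> * monomial \<alpha> z)"
    using assms unfolding mono_span_def by blast
  define c where "c = (\<lambda>\<beta>. \<Sum>\<alpha>\<in>?N. a \<alpha> * b \<alpha> \<beta>)"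
  have f: "f z = (\<Sum>\<beta>\<in>?N. c \<beta> * q \<beta> z)" for z
  proof -
    have "f z = (\<Sum>\<alpha>\<in>?N. \<Sum>\<beta>\<in>?N. a \<alpha> * (b \<alpha> \<beta> * q \<beta> z))"
      unfolding a by (intro sum.cong refl) (simp add: mono sum_distrib_left)
    also have "\<dots> = (\<Sum>\<beta>\<in>?N. \<Sum>\<alpha>\<in>?N. a \<alpha> * (b \<alpha> \<beta> * q \<beta> z))" by (rule sum.swap)
    finally show ?thesis by (simp add: c_def sum_distrib_right mult.assoc)
  qed
  have "L2_inner \<tau> f (q \<alpha>) = c \<alpha>" if "\<alpha> \<in> ?N" for \<alpha>
  proof -
    have "L2_inner \<tau> f (q \<alpha>) = L2_inner \<tau> (\<lambda>z. \<Sum>\<beta>\<in>?N. c \<beta> * q \<beta> z) (q \<alpha>)"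
      using f by presburger
    also have "\<dots> = (\<Sum>\<beta>\<in>?N. c \<beta> * L2_inner \<tau> (q \<beta>) (q \<alpha>))"
      by (subst L2_inner_sum) (auto intro!: continuous_intros continuous_on_q simp: L2_inner_cmult)
    also have "\<dots> = c \<alpha>"
      using that fin by (simp add: orthonormal if_distrib sum.delta cong: if_cong)
    finally show ?thesis .
  qed
  then show ?thesis unfolding f by (intro sum.cong) auto
qed

text \<open>Norm 1 and Bernstein-Markov bound \<open>q \<alpha>\<close> on \<open>K\<close>;
  Bernstein-Walsh carries the bound to the whole space.\<close>

lemma q_upper_bound:
  assumes "\<epsilon> > 0"
  obtains M where "M > 0" "\<And>\<alpha> z. cmod (q \<alpha> z) \<le> M * exp (real (mi_size \<alpha>) * (V z + \<epsilon>))"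
proof -
  obtain M where M: "M > 0"
    "\<And>n f z. f \<in> poly_fun n \<Longrightarrow> z \<in> K \<Longrightarrow> cmod (f z) \<le> M * exp (\<epsilon> * real n) * L2_nrm \<tau> f"
    using bernstein_markov_bound[OF assms] by blast
  have "cmod (q \<alpha> z) \<le> M * exp (real (mi_size \<alpha>) * (V z + \<epsilon>))" for \<alpha> z
  proof -
    have "cmod (q \<alpha> z) \<le> M * exp (\<epsilon> * real (mi_size \<alpha>)) * exp (real (mi_size \<alpha>) * V z)"
      using M(1) M(2)[OF q_poly_fun, of _ \<alpha>] by (intro bernstein_walsh[OF q_poly_fun]) (auto simp: L2_nrm_q)
    also have "\<dots> = M * exp (real (mi_size \<alpha>) * (V z + \<epsilon>))"
      by (simp add: exp_add[symmetric] algebra_simps)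
    finally show ?thesis .
  qed
  then show ?thesis using that M(1) by blast
qed

text \<open>The elementary |q| \<le> 1 + |q|^2 replaces the Cauchy-Schwarz inequality; what matters
  is a bound independent of \<alpha>.\<close>

lemma L2_inner_q_bound:
  assumes "continuous_on UNIV f" "\<And>x. x \<in> K \<Longrightarrow> cmod (f x) \<le> 1"
  shows "cmod (L2_inner \<tau> f (q \<alpha>)) \<le> measure \<tau> UNIV + 1"
proof -
  have int2: "integrable \<tau> (\<lambda>z. 1 + (cmod (q \<alpha> z))\<^sup>2)"
    by (intro integrable_continuous continuous_intros continuous_on_q)
  have "cmod (L2_inner \<tau> f (q \<alpha>)) \<le> (\<integral>z. cmod (f z * cnj (q \<alpha> z)) \<partial>\<tau>)"
    unfolding L2_inner_def by (rule integral_norm_bound)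
  also have "\<dots> \<le> (\<integral>z. 1 + (cmod (q \<alpha> z))\<^sup>2 \<partial>\<tau>)"
  proof (rule integral_mono_AE[OF _ int2])
    show "integrable \<tau> (\<lambda>z. cmod (f z * cnj (q \<alpha> z)))"
      by (intro integrable_continuous continuous_intros continuous_on_q assms)
    show "AE z in \<tau>. cmod (f z * cnj (q \<alpha> z)) \<le> 1 + (cmod (q \<alpha> z))\<^sup>2"
      using AE_in_K
    proof eventually_elim
      case (elim z)
      have "cmod (f z * cnj (q \<alpha> z)) \<le> 1 * cmod (q \<alpha> z)"
        using mult_right_mono[OF assms(2)[OF elim], of "cmod (q \<alpha> z)"] by (simp add: norm_mult)
      also have "\<dots> \<le> 1 + (cmod (q \<alpha> z))\<^sup>2"
      proof -
        have "2 * cmod (q \<alpha> z) \<le> (cmod (q \<alpha> z))\<^sup>2 + 1"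
          using zero_le_power2[of "cmod (q \<alpha> z) - 1"] by (simp add: power2_diff)
        then show ?thesis using norm_ge_zero[of "q \<alpha> z"] by linarith
      qed
      finally show ?case .
    qed
  qed
  also have "\<dots> = measure \<tau> UNIV + (\<integral>z. (cmod (q \<alpha> z))\<^sup>2 \<partial>\<tau>)"
  proof (subst Bochner_Integration.integral_add)
    show "integrable \<tau> (\<lambda>z. (cmod (q \<alpha> z))\<^sup>2)"
      by (intro integrable_continuous continuous_intros continuous_on_q)
    have "space \<tau> = UNIV" using sets_eq_imp_space_eq[OF sets_tau] by simp
    then show "(\<integral>z. 1 \<partial>\<tau>) + (\<integral>z. (cmod (q \<alpha> z))\<^sup>2 \<partial>\<tau>) = measure \<tau> UNIV + (\<integral>z. (cmod (q \<alpha> z))\<^sup>2 \<partial>\<tau>)"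
      by simp
  qed simp
  also have "(\<integral>z. (cmod (q \<alpha> z))\<^sup>2 \<partial>\<tau>) = (L2_nrm \<tau> (q \<alpha>))\<^sup>2"
    unfolding L2_nrm_def by (subst real_sqrt_pow2) (auto intro!: integral_nonneg_AE)
  finally show ?thesis by (simp add: L2_nrm_q)
qed

end


section \<open>Growth of the orthonormal polynomials\<close>

lemma card_mi_size_le: "real (card {\<alpha> :: 'd::finite multiindex. mi_size \<alpha> \<le> n}) \<le> (real n + 1) ^ CARD('d)"
proof -
  have le: "\<alpha> $ i \<le> mi_size \<alpha>" for \<alpha> :: "'d multiindex" and i
    unfolding mi_size_def by (rule member_le_sum) auto
  have "vec_nth ` {\<alpha> :: 'd multiindex. mi_size \<alpha> \<le> n} \<subseteq> (\<Pi>\<^sub>E i\<in>UNIV. {..n})"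
    using le by (auto intro: order_trans)
  then have "card (vec_nth ` {\<alpha> :: 'd multiindex. mi_size \<alpha> \<le> n}) \<le> card ((\<Pi>\<^sub>E i\<in>UNIV. {..n}) :: ('d \<Rightarrow> nat) set)"
    by (intro card_mono finite_PiE) auto
  then have "card {\<alpha> :: 'd multiindex. mi_size \<alpha> \<le> n} \<le> Suc n ^ CARD('d)"
    by (subst (asm) card_image) (auto simp: card_PiE inj_on_def vec_nth_inject)
  then have "real (card {\<alpha> :: 'd multiindex. mi_size \<alpha> \<le> n}) \<le> real (Suc n ^ CARD('d))" by (rule of_nat_mono)
  then show ?thesis by (simp add: add.commute)
qed

lemma eventually_power_less_exp:
  fixes c :: real
  assumes "c > 0" "B \<ge> 0"
  shows "\<forall>\<^sub>F n in sequentially. (real n + 1) ^ d * B < exp (real n * c - e)"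
proof -
  have "(\<lambda>x. (x + 1) powr real d * B) \<in> o(\<lambda>x. exp (x * c - e))"
    using assms(1) by real_asymp
  then have "\<forall>\<^sub>F x in at_top. norm ((x + 1) powr real d * B) \<le> 1/2 * norm (exp (x * c - e))"
    by (rule landau_o.smallD) simp
  then have "\<forall>\<^sub>F n in sequentially. norm ((real n + 1) powr real d * B) \<le> 1/2 * norm (exp (real n * c - e))"
    by (rule eventually_compose_filterlim[OF _ filterlim_real_sequentially])
  then show ?thesis
  proof eventually_elim
    case (elim n)
    have "(real n + 1) ^ d * B = norm ((real n + 1) powr real d * B)"
      using assms(2) by (simp add: powr_realpow abs_mult)
    also note elim
    finally have "(real n + 1) ^ d * B \<le> 1 / 2 * exp (real n * c - e)" by simp
    moreover have "exp (real n * c - e) > 0" by (rule exp_gt_zero)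
    ultimately show ?case by linarith
  qed
qed

text \<open>Inductive step: subtract from the new function its interpolation by the old ones and
  evaluate at a point where the difference does not vanish.\<close>

lemma dual_point_functionals:
  fixes g :: "'i \<Rightarrow> 'z \<Rightarrow> complex"
  assumes "finite S"
    and "\<forall>a. (\<forall>z\<in>U. (\<Sum>\<beta>\<in>S. a \<beta> * g \<beta> z) = 0) \<longrightarrow> (\<forall>\<beta>\<in>S. a \<beta> = 0)"
  shows "\<exists>F c. finite F \<and> F \<subseteq> U \<and>
    (\<forall>\<alpha>\<in>S. \<forall>\<beta>\<in>S. (\<Sum>z\<in>F. c \<alpha> z * g \<beta> z) = (if \<alpha> = \<beta> then 1 else 0))"
  using assms
proof (induction S rule: finite_induct)
  case empty
  then show ?case by (intro exI[of _ "{}"]) auto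
next
  case (insert x S)
  have "\<forall>a. (\<forall>z\<in>U. (\<Sum>\<beta>\<in>S. a \<beta> * g \<beta> z) = 0) \<longrightarrow> (\<forall>\<beta>\<in>S. a \<beta> = 0)"
  proof (intro allI impI)
    fix a assume a: "\<forall>z\<in>U. (\<Sum>\<beta>\<in>S. a \<beta> * g \<beta> z) = 0"
    have "(\<Sum>\<beta>\<in>insert x S. (if \<beta> = x then 0 else a \<beta>) * g \<beta> z) = 0" if "z \<in> U" for z
    proof -
      have "(\<Sum>\<beta>\<in>S. (if \<beta> = x then 0 else a \<beta>) * g \<beta> z) = (\<Sum>\<beta>\<in>S. a \<beta> * g \<beta> z)"
        using insert.hyps(2) by (intro sum.cong) auto
      then show ?thesis using a that insert.hyps by simp
    qed
    then have *: "\<forall>\<beta>\<in>insert x S. (if \<beta> = x then 0 else a \<beta>) = 0"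
      by (intro insert.prems[rule_format, of "\<lambda>\<beta>. if \<beta> = x then 0 else a \<beta>"] ballI)
    show "\<forall>\<beta>\<in>S. a \<beta> = 0"
    proof
      fix \<beta> assume "\<beta> \<in> S"
      then show "a \<beta> = 0" using bspec[OF *, of \<beta>] insert.hyps(2) by (auto split: if_splits)
    qed
  qed
  from insert.IH[OF this] obtain F c where F: "finite F" "F \<subseteq> U"
    and c: "\<forall>\<alpha>\<in>S. \<forall>\<beta>\<in>S. (\<Sum>z\<in>F. c \<alpha> z * g \<beta> z) = (if \<alpha> = \<beta> then 1 else 0)"
    by (elim exE conjE)
  define L where "L = (\<lambda>\<alpha> f. \<Sum>z\<in>F. c \<alpha> z * f z)"
  have L: "L \<alpha> (g \<beta>) = (if \<alpha> = \<beta> then 1 else 0)" if "\<alpha> \<in> S" "\<beta> \<in> S" for \<alpha> \<beta>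
    unfolding L_def by (rule c[rule_format, OF that])
  \<comment> \<open>The difference between \<open>g x\<close> and its interpolation, which all old
    functionals annihilate.\<close>
  define h where "h = (\<lambda>z. g x z - (\<Sum>\<alpha>\<in>S. L \<alpha> (g x) * g \<alpha> z))"
  have "\<exists>z\<in>U. h z \<noteq> 0"
  proof (rule ccontr)
    assume "\<not> (\<exists>z\<in>U. h z \<noteq> 0)"
    then have h0: "h z = 0" if "z \<in> U" for z using that by blast
    have "(\<Sum>\<beta>\<in>insert x S. (if \<beta> = x then 1 else - L \<beta> (g x)) * g \<beta> z) = 0" if "z \<in> U" for z
    proof -
      have "(\<Sum>\<beta>\<in>S. (if \<beta> = x then 1 else - L \<beta> (g x)) * g \<beta> z) = (\<Sum>\<beta>\<in>S. - (L \<beta> (g x) * g \<beta> z))"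
        using insert.hyps(2) by (intro sum.cong) auto
      then show ?thesis using h0[OF that] insert.hyps by (simp add: h_def sum_negf)
    qed
    then have "\<forall>\<beta>\<in>insert x S. (if \<beta> = x then 1 else - L \<beta> (g x)) = 0"
      by (intro insert.prems[rule_format, of "\<lambda>\<beta>. if \<beta> = x then 1 else - L \<beta> (g x)"] ballI)
    then show False by simp
  qed
  then obtain z0 where z0: "z0 \<in> U" "h z0 \<noteq> 0" by blast
  define F' where "F' = insert z0 F"
  have F': "finite F'" "F' \<subseteq> U" "F \<subseteq> F'" "z0 \<in> F'" using F z0 by (auto simp: F'_def)
  define c0 where "c0 = (\<lambda>\<alpha> z. if z \<in> F then c \<alpha> z else 0)"
  have c0: "(\<Sum>z\<in>F'. c0 \<alpha> z * f z) = L \<alpha> f" for \<alpha> f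
    unfolding L_def by (rule sum.mono_neutral_cong_right) (use F' in \<open>auto simp: c0_def\<close>)
  \<comment> \<open>The functional f \<mapsto> (f minus its interpolation) evaluated at
    \<open>z0\<close>, normalised: it kills the old functions and is 1 on
    \<open>g x\<close>.\<close>
  define cx where "cx = (\<lambda>z. ((if z = z0 then 1 else 0) - (\<Sum>\<alpha>\<in>S. g \<alpha> z0 * c0 \<alpha> z)) / h z0)"
  have cx: "(\<Sum>z\<in>F'. cx z * f z) = (f z0 - (\<Sum>\<alpha>\<in>S. g \<alpha> z0 * L \<alpha> f)) / h z0" for f
  proof -
    have "(\<Sum>z\<in>F'. cx z * f z) =
        (\<Sum>z\<in>F'. (if z = z0 then f z else 0) - (\<Sum>\<alpha>\<in>S. g \<alpha> z0 * (c0 \<alpha> z * f z))) / h z0"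
      unfolding sum_divide_distrib cx_def
      by (intro sum.cong) (auto simp: left_diff_distrib sum_distrib_right mult.assoc)
    also have "(\<Sum>z\<in>F'. (if z = z0 then f z else 0) - (\<Sum>\<alpha>\<in>S. g \<alpha> z0 * (c0 \<alpha> z * f z))) =
        f z0 - (\<Sum>\<alpha>\<in>S. g \<alpha> z0 * L \<alpha> f)"
      unfolding sum_subtractf c0[symmetric] sum_distrib_left
      using F' by (subst sum.swap) (simp add: sum.delta)
    finally show ?thesis .
  qed
  have cx_S: "(\<Sum>z\<in>F'. cx z * g \<beta> z) = 0" if "\<beta> \<in> S" for \<beta>
  proof -
    have "(\<Sum>\<alpha>\<in>S. g \<alpha> z0 * L \<alpha> (g \<beta>)) = (\<Sum>\<alpha>\<in>S. if \<alpha> = \<beta> then g \<alpha> z0 else 0)"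
      using that by (intro sum.cong) (auto simp: L)
    then show ?thesis unfolding cx using that insert.hyps by simp
  qed
  have cx_x: "(\<Sum>z\<in>F'. cx z * g x z) = 1"
    unfolding cx using z0(2) by (simp add: h_def mult.commute)
  \<comment> \<open>The old functionals are corrected by multiples of the new one so as to vanish on
    \<open>g x\<close>.\<close>
  define c' where "c' = (\<lambda>\<alpha> z. if \<alpha> = x then cx z else c0 \<alpha> z - L \<alpha> (g x) * cx z)"
  have "(\<Sum>z\<in>F'. c' \<alpha> z * g \<beta> z) = (if \<alpha> = \<beta> then 1 else 0)" if "\<alpha> \<in> insert x S" "\<beta> \<in> insert x S" for \<alpha> \<beta>
  proof (cases "\<alpha> = x")
    case True
    then show ?thesis using that cx_x cx_S insert.hyps(2) by (auto simp: c'_def)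
  next
    case False
    then have "(\<Sum>z\<in>F'. c' \<alpha> z * g \<beta> z) = L \<alpha> (g \<beta>) - L \<alpha> (g x) * (\<Sum>z\<in>F'. cx z * g \<beta> z)"
      by (simp add: c'_def left_diff_distrib sum_subtractf c0 sum_distrib_left mult.assoc)
    then show ?thesis using that False cx_x cx_S L insert.hyps(2) by auto
  qed
  then show ?case using F'(1,2) by (intro exI[of _ F'] exI[of _ c'] conjI ballI)
qed

section \<open>Lower growth of the orthonormal polynomials\<close>

context bernstein_markov_pair
begin

text \<open>Independence on an open set: a relation valid there holds everywhere by the identity
  theorem, and pairing it with \<open>q \<beta>\<close> isolates each coefficient.\<close>

lemma dual_points_q:
  assumes "open U" "U \<noteq> {}" "finite S"
  obtains F c where "finite F" "F \<subseteq> U"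
    "\<And>\<alpha> \<beta>. \<alpha> \<in> S \<Longrightarrow> \<beta> \<in> S \<Longrightarrow> (\<Sum>z\<in>F. c \<alpha> z * q \<beta> z) = (if \<alpha> = \<beta> then 1 else 0)"
proof -
  have "\<forall>a. (\<forall>z\<in>U. (\<Sum>\<beta>\<in>S. a \<beta> * q \<beta> z) = 0) \<longrightarrow> (\<forall>\<beta>\<in>S. a \<beta> = 0)"
  proof (intro allI impI ballI)
    fix a \<beta> assume a: "\<forall>z\<in>U. (\<Sum>\<beta>\<in>S. a \<beta> * q \<beta> z) = 0" and \<beta>: "\<beta> \<in> S"
    obtain u where u: "u \<in> U" using assms(2) by blast
    have "mi_size \<gamma> \<le> Max (mi_size ` S)" if "\<gamma> \<in> S" for \<gamma> using assms(3) that by simp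
    then have "(\<lambda>z. \<Sum>\<beta>\<in>S. a \<beta> * q \<beta> z) \<in> poly_fun (Max (mi_size ` S))"
      by (intro mono_span_sum mono_span_cmult poly_fun_mono[OF q_poly_fun])
    from poly_fun_zero_on_open[OF this assms(1) u bspec[OF a]] have "(\<Sum>\<beta>\<in>S. a \<beta> * q \<beta> z) = 0" for z .
    then have "0 = L2_inner \<tau> (\<lambda>z. \<Sum>\<gamma>\<in>S. a \<gamma> * q \<gamma> z) (q \<beta>)" by (simp add: L2_inner_def)
    also have "\<dots> = (\<Sum>\<gamma>\<in>S. a \<gamma> * L2_inner \<tau> (q \<gamma>) (q \<beta>))"
      by (subst L2_inner_sum) (auto intro!: continuous_intros continuous_on_q simp: L2_inner_cmult)
    also have "\<dots> = a \<beta>"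
      using \<beta> assms(3) by (simp add: orthonormal if_distrib sum.delta cong: if_cong)
    finally show "a \<beta> = 0" by simp
  qed
  from dual_point_functionals[OF assms(3) this] obtain F c where "finite F" "F \<subseteq> U"
    "\<forall>\<alpha>\<in>S. \<forall>\<beta>\<in>S. (\<Sum>z\<in>F. c \<alpha> z * q \<beta> z) = (if \<alpha> = \<beta> then 1 else 0)"
    by (elim exE conjE)
  then show ?thesis by (intro that[of F c]) simp_all
qed

text \<open>A power of a nearly extremal polynomial of fixed degree \<open>D\<close> is expanded in
  the \<open>q\<close>. Its coefficients are bounded and their number is polynomial in m, so a value
  of size exp (m (V - \<delta>/2)) cannot arise unless some \<open>q \<alpha>\<close> is large at
  \<open>z\<close>.\<close>

lemma q_lower_bound:
  assumes "0 < \<delta>" "\<delta> < V z"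
  shows "\<forall>\<^sub>F m in sequentially. \<exists>\<alpha>. mi_size \<alpha> \<le> m \<and> cmod (q \<alpha> z) \<ge> exp (real m * (V z - \<delta>))"
proof -
  define v where "v = V z"
  define T where "T = measure \<tau> UNIV + 1"
  have T: "T \<ge> 1" by (simp add: T_def)
  obtain D f where D: "D > 0" and f: "f \<in> poly_fun D" "\<And>x. x \<in> K \<Longrightarrow> cmod (f x) \<le> 1"
    and fz: "cmod (f z) > exp (real D * (v - \<delta> / 2))"
    using V_approx[of "\<delta> / 2" z] assms(1) unfolding v_def by auto
  \<comment> \<open>Half of \<delta> is lost in the choice of \<open>f\<close>, the other half beats
    the number of terms; the subtracted constant pays for rounding m down to a multiple of
    \<open>D\<close>.\<close>
  have ev: "\<forall>\<^sub>F m in sequentially. (real m + 1) ^ CARD('d) * T < exp (real m * (\<delta> / 2) - real D * (v - \<delta> / 2))"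
    using assms(1) T by (intro eventually_power_less_exp) auto
  from ev show ?thesis
  proof eventually_elim
    case (elim m)
    show ?case
    proof (rule ccontr)
      assume "\<not> ?case"
      then have small: "cmod (q \<alpha> z) \<le> exp (real m * (v - \<delta>))" if "mi_size \<alpha> \<le> m" for \<alpha>
        using \<open>\<not> ?case\<close> that unfolding v_def by (meson le_cases)
      define k where "k = m div D"
      have kD: "k * D \<le> m" "real m - real D \<le> real (k * D)"
      proof -
        show "k * D \<le> m" by (simp add: k_def)
        have "m < k * D + D" unfolding k_def using D by (metis add.commute div_mult_mod_eq add_less_cancel_left mod_less_divisor)
        then show "real m - real D \<le> real (k * D)" by linarith
      qed
      have fk: "(\<lambda>z. f z ^ k) \<in> poly_fun m"
        by (rule poly_fun_mono[OF poly_fun_power[OF f(1)] kD(1)])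
      have coeff: "cmod (L2_inner \<tau> (\<lambda>z. f z ^ k) (q \<alpha>)) \<le> T" for \<alpha>
        unfolding T_def by (rule L2_inner_q_bound)
          (use f(2) in \<open>auto intro!: continuous_on_mono_span[OF fk] power_le_one simp: norm_power\<close>)
      have "exp ((real m - real D) * (v - \<delta> / 2)) \<le> exp (real (k * D) * (v - \<delta> / 2))"
        using kD(2) assms by (simp add: v_def mult_right_mono)
      also have "\<dots> = exp (real D * (v - \<delta> / 2)) ^ k"
        by (simp add: exp_of_nat_mult[symmetric] mult_ac)
      also have "\<dots> \<le> cmod (f z) ^ k" using fz by (intro power_mono) auto
      also have "\<dots> = cmod (\<Sum>\<alpha> | mi_size \<alpha> \<le> m. L2_inner \<tau> (\<lambda>z. f z ^ k) (q \<alpha>) * q \<alpha> z)"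
        by (simp add: poly_fun_q_expansion[OF fk, symmetric] norm_power)
      also have "\<dots> \<le> (\<Sum>\<alpha> :: 'd multiindex | mi_size \<alpha> \<le> m. T * exp (real m * (v - \<delta>)))"
        by (intro sum_norm_le) (auto simp: norm_mult intro!: mult_mono coeff small order_trans[OF norm_ge_zero coeff])
      also have "\<dots> = real (card {\<alpha> :: 'd multiindex. mi_size \<alpha> \<le> m}) * T * exp (real m * (v - \<delta>))"
        by simp
      also have "\<dots> \<le> (real m + 1) ^ CARD('d) * T * exp (real m * (v - \<delta>))"
        using T by (intro mult_right_mono card_mi_size_le) auto
      also have "\<dots> < exp (real m * (\<delta> / 2) - real D * (v - \<delta> / 2)) * exp (real m * (v - \<delta>))"
        using elim by (intro mult_strict_right_mono) auto
      also have "\<dots> = exp ((real m - real D) * (v - \<delta> / 2))"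
        unfolding exp_add[symmetric] by (rule arg_cong[of _ _ exp]) (simp add: field_simps)
      finally show False by simp
    qed
  qed
qed

text \<open>The indices come from the degree levels \<open>(N - 1 - k) s\<close>, \<open>k < J\<close>, with \<open>s = n div N\<close>: since
  \<open>|q|\<close> grows like \<open>exp (m V)\<close> at level \<open>m\<close> and \<open>V > 0\<close>, consecutive values differ by a large factor,
  and since \<open>J\<close> is small compared to \<open>N\<close>, all levels are close to \<open>n\<close>.\<close>

lemma lacunary_indices:
  fixes J :: nat
  assumes "V z > 0" "\<epsilon> > 0" "R > 0"
  shows "\<forall>\<^sub>F n in sequentially. \<exists>A :: nat \<Rightarrow> 'd multiindex. \<forall>k<J.
     mi_size (A k) \<le> n \<and> R * exp (real n * (V z - \<epsilon>)) \<le> cmod (q (A k) z) \<and>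
     R * cmod (q (A (Suc k)) z) \<le> cmod (q (A k) z)"
proof -
  define v where "v = V z"
  have v: "v > 0" using assms by (simp add: v_def)
  \<comment> \<open>\<open>N * \<epsilon>\<close> has to pay for the loss (J + 1) v at the lowest
    relevant level, for \<open>N * \<delta>\<close>, which is at most v, and for a surplus 1 that is
    later multiplied by the spacing s.\<close>
  obtain N0 :: nat where N0: "real N0 * \<epsilon> \<ge> (real J + 2) * v + 1"
    using assms(2) by (metis real_arch_simple pos_divide_le_eq)
  define N where "N = N0 + J + 2"
  have N: "N > J + 1" "real N * \<epsilon> \<ge> (real J + 2) * v + 1"
  proof -
    have "real N0 * \<epsilon> \<le> real N * \<epsilon>" using assms(2) by (intro mult_right_mono) (auto simp: N_def)
    with N0 show "real N * \<epsilon> \<ge> (real J + 2) * v + 1" by linarith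
  qed (simp add: N_def)
  \<comment> \<open>Between neighbouring levels the exponent gains s v and loses at most 2 N s
    \<delta>; this choice leaves s v / 2.\<close>
  define \<delta> where "\<delta> = v / (4 * real N)"
  have \<delta>: "0 < \<delta>" "\<delta> < V z" "4 * (real N * \<delta>) = v"
    using v N(1) by (auto simp: \<delta>_def v_def field_simps)
  obtain M where M: "M > 0" "\<And>\<alpha> z. cmod (q \<alpha> z) \<le> M * exp (real (mi_size \<alpha>) * (V z + \<delta>))"
    using q_upper_bound[OF \<delta>(1)] by blast
  obtain m0 where m0: "\<And>m. m \<ge> m0 \<Longrightarrow> \<exists>\<alpha>. mi_size \<alpha> \<le> m \<and> cmod (q \<alpha> z) \<ge> exp (real m * (v - \<delta>))"
    using q_lower_bound[OF \<delta>(1,2)] unfolding eventually_sequentially v_def by blast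
  obtain B where B: "\<And>m. m \<ge> m0 \<Longrightarrow> mi_size (B m) \<le> m" "\<And>m. m \<ge> m0 \<Longrightarrow> cmod (q (B m) z) \<ge> exp (real m * (v - \<delta>))"
    using m0 by metis
  have up: "cmod (q (B m) z) \<le> M * exp (real m * (v + \<delta>))" if "m \<ge> m0" for m
  proof -
    have "cmod (q (B m) z) \<le> M * exp (real (mi_size (B m)) * (v + \<delta>))"
      unfolding v_def by (rule M(2))
    also have "\<dots> \<le> M * exp (real m * (v + \<delta>))"
      using B(1)[OF that] M(1) v \<delta>(1) by (intro mult_left_mono) (auto intro!: mult_right_mono)
    finally show ?thesis .
  qed
  \<comment> \<open>Three thresholds for the spacing: the lower bounds must be available at all
    levels used, the factor R M must be won between neighbours, and ln R plus the cost N v of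
    rounding n must be covered.\<close>
  define s0 where "s0 = nat \<lceil>max (real m0) (max (2 * ln (R * M) / v) (ln R + real N * v))\<rceil>"
  have s0: "real m0 \<le> real s" "2 * ln (R * M) / v \<le> real s" "ln R + real N * v \<le> real s" if "s \<ge> s0" for s
  proof -
    have "max (real m0) (max (2 * ln (R * M) / v) (ln R + real N * v)) \<le> real s0"
      unfolding s0_def by (rule real_nat_ceiling_ge)
    also have "\<dots> \<le> real s" using that by simp
    finally show "real m0 \<le> real s" "2 * ln (R * M) / v \<le> real s" "ln R + real N * v \<le> real s" by auto
  qed
  show ?thesis unfolding eventually_sequentially
  proof (intro exI[of _ "N * s0"] allI impI)
    fix n assume "n \<ge> N * s0"
    define s where "s = n div N"
    have s: "s \<ge> s0" using \<open>n \<ge> N * s0\<close> N(1) unfolding s_def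
      by (metis div_le_mono nonzero_mult_div_cancel_left not_less_zero)
    have ns: "N * s \<le> n" "real n - real (N * s) \<le> real N"
    proof -
      show "N * s \<le> n" by (simp add: s_def)
      have "n = N * s + n mod N" by (simp add: s_def)
      moreover have "n mod N < N" using N(1) by simp
      ultimately have "n \<le> N * s + N" by linarith
      then show "real n - real (N * s) \<le> real N" by linarith
    qed
    \<comment> \<open>\<open>N > J + 1\<close> keeps even level \<open>J\<close> at least s; that
      level is needed because the last comparison, k = J - 1, involves \<open>Suc k\<close>.\<close>
    define lev where "lev = (\<lambda>k. (N - 1 - k) * s)"
    have lev_ge: "lev k \<ge> m0" if "k \<le> J" for k
    proof -
      have "1 * s \<le> lev k" unfolding lev_def using that N(1) by (intro mult_right_mono) auto
      then show ?thesis using s0(1)[OF s] by simp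
    qed
    have lev_le: "lev k \<le> N * s" for k unfolding lev_def by (intro mult_right_mono) auto
    show "\<exists>A :: nat \<Rightarrow> 'd multiindex. \<forall>k<J.
     mi_size (A k) \<le> n \<and> R * exp (real n * (V z - \<epsilon>)) \<le> cmod (q (A k) z) \<and>
     R * cmod (q (A (Suc k)) z) \<le> cmod (q (A k) z)"
    proof (intro exI[of _ "\<lambda>k. B (lev k)"] allI impI conjI)
      fix k assume k: "k < J"
      show "mi_size (B (lev k)) \<le> n" using B(1)[OF lev_ge] k lev_le ns(1) by (meson less_imp_le order_trans)
      have low: "exp (real (lev k) * (v - \<delta>)) \<le> cmod (q (B (lev k)) z)"
        using k by (intro B(2) lev_ge) simp
      show "R * exp (real n * (V z - \<epsilon>)) \<le> cmod (q (B (lev k)) z)"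
      proof -
        have a: "real n * (v - \<epsilon>) \<le> real (N * s) * (v - \<epsilon>) + real N * v"
        proof -
          have "(real n - real (N * s)) * (v - \<epsilon>) \<le> (real n - real (N * s)) * v"
            using ns(1) assms(2) by (intro mult_left_mono) (auto simp flip: of_nat_mult)
          also have "\<dots> \<le> real N * v" using ns(2) v by (intro mult_right_mono) auto
          finally show ?thesis by (simp add: algebra_simps)
        qed
        have b: "real (lev k) * (v - \<delta>) \<ge> (real N - 1 - real J) * real s * (v - \<delta>)"
        proof (intro mult_right_mono)
          have "real (N - 1 - k) = real N - 1 - real k" using k N(1) by simp
          then show "(real N - 1 - real J) * real s \<le> real (lev k)"
            using k by (simp add: lev_def mult_right_mono)
          show "0 \<le> v - \<delta>" using \<delta>(2) by (simp add: v_def)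
        qed
        have c: "(real N - 1 - real J) * (v - \<delta>) - real N * (v - \<epsilon>) \<ge> 1"
        proof -
          have "(1 + real J) * \<delta> \<ge> 0" using \<delta>(1) by simp
          moreover have "(real N - 1 - real J) * (v - \<delta>) - real N * (v - \<epsilon>)
              = real N * \<epsilon> - (1 + real J) * v - real N * \<delta> + (1 + real J) * \<delta>"
            by (simp add: algebra_simps)
          moreover have "(real J + 2) * v = (1 + real J) * v + v" by (simp add: algebra_simps)
          moreover have "real N * \<delta> \<le> v" using \<delta>(3) v by linarith
          ultimately show ?thesis using N(2) by linarith
        qed
        have "real s * 1 \<le> real s * ((real N - 1 - real J) * (v - \<delta>) - real N * (v - \<epsilon>))"
          using c by (intro mult_left_mono) auto
        then have "ln R + real N * v \<le> (real N - 1 - real J) * real s * (v - \<delta>) - real (N * s) * (v - \<epsilon>)"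
          using s0(3)[OF s] by (simp add: algebra_simps)
        with a b have "ln R + real n * (v - \<epsilon>) \<le> real (lev k) * (v - \<delta>)" by linarith
        then have "exp (ln R + real n * (v - \<epsilon>)) \<le> exp (real (lev k) * (v - \<delta>))" by simp
        then show ?thesis using low assms(3) by (simp add: exp_add v_def)
      qed
      show "R * cmod (q (B (lev (Suc k))) z) \<le> cmod (q (B (lev k)) z)"
      proof -
        have lk: "real (lev k) = real (lev (Suc k)) + real s"
        proof -
          have "N - 1 - k = Suc (N - 1 - Suc k)" using k N(1) by linarith
          then show ?thesis by (simp add: lev_def)
        qed
        have "real (lev k) + real (lev (Suc k)) \<le> 2 * real (N * s)"
          using lev_le[of k] lev_le[of "Suc k"] by linarith
        then have "(real (lev k) + real (lev (Suc k))) * \<delta> \<le> 2 * real (N * s) * \<delta>"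
          using \<delta>(1) by (intro mult_right_mono) auto
        also have "\<dots> = real s * (v / 2)" using \<delta>(3) by (simp add: algebra_simps)
        finally have "real s * (v / 2) \<le> real (lev k) * (v - \<delta>) - real (lev (Suc k)) * (v + \<delta>)"
          by (simp add: lk algebra_simps)
        moreover have "ln (R * M) \<le> real s * (v / 2)"
          using s0(2)[OF s] v by (simp add: field_simps)
        ultimately have "ln (R * M) + real (lev (Suc k)) * (v + \<delta>) \<le> real (lev k) * (v - \<delta>)" by linarith
        then have "exp (ln (R * M) + real (lev (Suc k)) * (v + \<delta>)) \<le> exp (real (lev k) * (v - \<delta>))" by simp
        then have "R * (M * exp (real (lev (Suc k)) * (v + \<delta>))) \<le> exp (real (lev k) * (v - \<delta>))"
          using assms(3) M(1) by (simp add: exp_add mult.assoc)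
        moreover have "R * cmod (q (B (lev (Suc k))) z) \<le> R * (M * exp (real (lev (Suc k)) * (v + \<delta>)))"
          using k assms(3) by (intro mult_left_mono up lev_ge) auto
        ultimately show ?thesis using low by linarith
      qed
    qed
  qed
qed

end


section \<open>Small ball probabilities\<close>

text \<open>Fubini in the last coordinate. \<open>E'\<close> asks for sections of positive measure
  and not just nonempty ones: this makes it measurable, which a projection need not be, and loses no
  mass.\<close>

lemma (in product_prob_space) emeasure_PiM_insert_section_le:
  fixes q :: ennreal
  assumes "finite J" "i \<notin> J" and E: "E \<in> sets (Pi\<^sub>M (insert i J) M)"
    and sec: "\<And>x. x \<in> space (Pi\<^sub>M J M) \<Longrightarrow> emeasure (M i) {y \<in> space (M i). x(i := y) \<in> E} \<le> q"
  defines "E' \<equiv> {x \<in> space (Pi\<^sub>M J M). emeasure (M i) {y \<in> space (M i). x(i := y) \<in> E} > 0}"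
  shows "E' \<in> sets (Pi\<^sub>M J M)" "emeasure (Pi\<^sub>M (insert i J) M) E \<le> q * emeasure (Pi\<^sub>M J M) E'"
proof -
  note [measurable] = E
  have sp: "x(i := y) \<in> space (Pi\<^sub>M (insert i J) M)" if "x \<in> space (Pi\<^sub>M J M)" "y \<in> space (M i)" for x y
    using that by (auto simp: space_PiM PiE_def extensional_def Pi_def)
  have meas: "(\<lambda>(x, y). indicator E (x(i := y)) :: ennreal) \<in> borel_measurable (Pi\<^sub>M J M \<Otimes>\<^sub>M M i)"
  proof -
    have "(\<lambda>(x, y). x(i := y)) \<in> measurable (Pi\<^sub>M J M \<Otimes>\<^sub>M M i) (Pi\<^sub>M (insert i J) M)"
      by (rule measurable_add_dim)
    then show ?thesis
      by (simp add: split_beta') measurable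
  qed
  have sec_eq: "(\<integral>\<^sup>+y. indicator E (x(i := y)) \<partial>M i) = emeasure (M i) {y \<in> space (M i). x(i := y) \<in> E}"
    if x: "x \<in> space (Pi\<^sub>M J M)" for x
  proof -
    have "(\<lambda>y. x(i := y)) \<in> measurable (M i) (Pi\<^sub>M (insert i J) M)"
      by (rule measurable_compose[OF measurable_Pair1'[OF x] measurable_add_dim, simplified])
    from measurable_sets[OF this E]
    have "{y \<in> space (M i). x(i := y) \<in> E} \<in> sets (M i)"
      by (simp add: vimage_def Int_def conj_commute)
    moreover have "(\<integral>\<^sup>+y. indicator E (x(i := y)) \<partial>M i) =
        (\<integral>\<^sup>+y. indicator {y \<in> space (M i). x(i := y) \<in> E} y \<partial>M i)"
      by (intro nn_integral_cong) (simp add: indicator_def)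
    ultimately show ?thesis by (simp only: nn_integral_indicator)
  qed
  have sm: "(\<lambda>x. \<integral>\<^sup>+y. indicator E (x(i := y)) \<partial>M i) \<in> borel_measurable (Pi\<^sub>M J M)"
    using M.borel_measurable_nn_integral[OF meas] by simp
  have "E' = {x \<in> space (Pi\<^sub>M J M). (\<integral>\<^sup>+y. indicator E (x(i := y)) \<partial>M i) > 0}"
    unfolding E'_def by (intro Collect_cong conj_cong refl) (simp add: sec_eq)
  then show E': "E' \<in> sets (Pi\<^sub>M J M)" using sm by simp
  have "emeasure (Pi\<^sub>M (insert i J) M) E = (\<integral>\<^sup>+x. indicator E x \<partial>Pi\<^sub>M (insert i J) M)"
    using E by simp
  also have "\<dots> = (\<integral>\<^sup>+x. \<integral>\<^sup>+y. indicator E (x(i := y)) \<partial>M i \<partial>Pi\<^sub>M J M)"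
    using assms(1,2) E by (intro product_nn_integral_insert) auto
  also have "\<dots> \<le> (\<integral>\<^sup>+x. q * indicator E' x \<partial>Pi\<^sub>M J M)"
  proof (rule nn_integral_mono)
    fix x assume x: "x \<in> space (Pi\<^sub>M J M)"
    show "(\<integral>\<^sup>+y. indicator E (x(i := y)) \<partial>M i) \<le> q * indicator E' x"
      unfolding sec_eq[OF x] using sec[OF x] x by (auto simp: E'_def indicator_def not_less)
  qed
  also have "\<dots> = q * emeasure (Pi\<^sub>M J M) E'"
    using E' by (rule nn_integral_cmult_indicator)
  finally show "emeasure (Pi\<^sub>M (insert i J) M) E \<le> q * emeasure (Pi\<^sub>M J M) E'" .
qed

text \<open>The hypothesis on \<open>E\<close> says that the coordinate \<open>as ! k\<close> is
  known up to \<rho> once the coordinates outside \<open>drop k as\<close> are known, whatever the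
  later entries of the list do. Integrating the last entry first gains a factor \<open>q\<close>,
  since each section has diameter at most \<rho>. Speaking of diameters avoids a measurable choice
  of centres.\<close>

lemma emeasure_PiM_chain_le:
  fixes \<mu> :: "'b::metric_space measure" and q :: ennreal
  assumes "prob_space \<mu>"
    and q: "\<And>B. B \<in> sets \<mu> \<Longrightarrow> (\<And>s t. s \<in> B \<Longrightarrow> t \<in> B \<Longrightarrow> dist s t \<le> \<rho>) \<Longrightarrow> emeasure \<mu> B \<le> q"
  shows "finite I \<Longrightarrow> distinct as \<Longrightarrow> set as \<subseteq> I \<Longrightarrow> E \<in> sets (Pi\<^sub>M I (\<lambda>_. \<mu>)) \<Longrightarrow>
    (\<And>k x y. k < length as \<Longrightarrow> x \<in> E \<Longrightarrow> y \<in> E \<Longrightarrow> (\<And>i. i \<in> I - set (drop k as) \<Longrightarrow> x i = y i) \<Longrightarrow>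
       dist (x (as ! k)) (y (as ! k)) \<le> \<rho>) \<Longrightarrow>
    emeasure (Pi\<^sub>M I (\<lambda>_. \<mu>)) E \<le> q ^ length as"
proof (induction as arbitrary: I E rule: rev_induct)
  case Nil
  interpret product_prob_space "\<lambda>_. \<mu>" I
    using assms(1) by (intro product_prob_spaceI)
  show ?case using emeasure_le_1 by simp
next
  case (snoc a as)
  interpret product_prob_space "\<lambda>_. \<mu>" I
    using assms(1) by (intro product_prob_spaceI)
  define J where "J = I - {a}"
  have J: "finite J" "a \<notin> J" "I = insert a J" "set as \<subseteq> J"
    using snoc.prems by (auto simp: J_def)
  have E: "E \<in> sets (Pi\<^sub>M (insert a J) (\<lambda>_. \<mu>))" using snoc.prems(4) J(3) by simp
  note [measurable] = E
  define E' where "E' = {x \<in> space (Pi\<^sub>M J (\<lambda>_. \<mu>)). emeasure \<mu> {y \<in> space \<mu>. x(a := y) \<in> E} > 0}"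
  have sec: "emeasure \<mu> {y \<in> space \<mu>. x(a := y) \<in> E} \<le> q" if x: "x \<in> space (Pi\<^sub>M J (\<lambda>_. \<mu>))" for x
  proof (rule q)
    have "(\<lambda>y. x(a := y)) \<in> measurable \<mu> (Pi\<^sub>M (insert a J) (\<lambda>_. \<mu>))"
      by (rule measurable_compose[OF measurable_Pair1'[OF x] measurable_add_dim, simplified])
    from measurable_sets[OF this E] show "{y \<in> space \<mu>. x(a := y) \<in> E} \<in> sets \<mu>"
      by (simp add: vimage_def Int_def conj_commute)
    fix s t assume st: "s \<in> {y \<in> space \<mu>. x(a := y) \<in> E}" "t \<in> {y \<in> space \<mu>. x(a := y) \<in> E}"
    have "dist ((x(a := s)) ((as @ [a]) ! length as)) ((x(a := t)) ((as @ [a]) ! length as)) \<le> \<rho>"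
      using st
      by (intro snoc.prems(5)[of "length as" "x(a := s)" "x(a := t)"]) (auto simp del: fun_upd_apply simp: fun_upd_other)
    then show "dist s t \<le> \<rho>" by simp
  qed
  note main = emeasure_PiM_insert_section_le[OF J(1,2) E sec, folded E'_def]
  have "emeasure (Pi\<^sub>M J (\<lambda>_. \<mu>)) E' \<le> q ^ length as"
  proof (rule snoc.IH[OF J(1) _ J(4) main(1)])
    show "distinct as" using snoc.prems by simp
    fix k x y assume k: "k < length as" and x: "x \<in> E'" and y: "y \<in> E'"
      and agree: "\<And>i. i \<in> J - set (drop k as) \<Longrightarrow> x i = y i"
    \<comment> \<open>A section of positive measure is nonempty, so points of \<open>E'\<close>
      extend to points of \<open>E\<close> and the chain hypothesis is inherited.\<close>
    have ex: "\<exists>s. z(a := s) \<in> E" if "z \<in> E'" for z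
    proof -
      have "{y \<in> space \<mu>. z(a := y) \<in> E} \<noteq> {}" using that unfolding E'_def by (auto simp del: Collect_empty_eq)
      then show ?thesis by blast
    qed
    obtain s where s: "x(a := s) \<in> E" using ex[OF x] by blast
    obtain t where t: "y(a := t) \<in> E" using ex[OF y] by blast
    have "dist ((x(a := s)) ((as @ [a]) ! k)) ((y(a := t)) ((as @ [a]) ! k)) \<le> \<rho>"
      using k agree J(3) by (intro snoc.prems(5)[OF _ s t]) auto
    moreover have "as ! k \<noteq> a" using k J by (metis nth_mem subsetD)
    ultimately show "dist (x (as ! k)) (y (as ! k)) \<le> \<rho>"
      using k by (simp add: nth_append)
  qed
  then have "q * emeasure (Pi\<^sub>M J (\<lambda>_. \<mu>)) E' \<le> q * q ^ length as"
    by (rule mult_left_mono) simp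
  then show ?case using main(2) J(3) by simp
qed

lemma tail_o_imp_eventually:
  fixes f :: "real \<Rightarrow> real"
  assumes "f \<in> o[at_top](\<lambda>t. 1 / t ^ d)" "c > 0"
  shows "\<forall>\<^sub>F t in at_top. f t * t ^ d \<le> c"
  using landau_o.smallD[OF assms] eventually_gt_at_top[of 0]
proof eventually_elim
  case (elim t)
  then have "f t \<le> c * (1 / t ^ d)" by simp
  then have "f t * t ^ d \<le> c * (1 / t ^ d) * t ^ d" using elim by (intro mult_right_mono) auto
  then show ?case using elim by simp
qed

section \<open>The law of the coefficients\<close>

abbreviation Pi_borel :: "'i set \<Rightarrow> ('i \<Rightarrow> complex) measure" where
  "Pi_borel I \<equiv> Pi\<^sub>M I (\<lambda>_. borel)"

locale random_orthogonal_polynomials = bernstein_markov_pair K \<tau>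
  for K :: "'d::{finite,linorder} cspace set" and \<tau> :: "'d cspace measure" +
  fixes M :: "'w measure" and \<xi> :: "'d multiindex \<Rightarrow> 'w \<Rightarrow> complex"
  assumes prob_space_M: "prob_space M"
    and indep: "prob_space.indep_vars M (\<lambda>_. borel) \<xi> UNIV"
    and ident: "\<And>\<alpha> \<beta>. distr M borel (\<xi> \<alpha>) = distr M borel (\<xi> \<beta>)"
    and nondeg: "\<And>\<alpha>. nondegenerate M (\<xi> \<alpha>)"
    and tail: "\<And>\<alpha>. (\<lambda>t::real. measure M {w \<in> space M. cmod (\<xi> \<alpha> w) > exp t})
                 \<in> o[at_top](\<lambda>t. 1 / t ^ CARD('d))"
begin

sublocale M: prob_space M by (rule prob_space_M)

definition \<mu> :: "complex measure" where "\<mu> = distr M borel (\<xi> 0)"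

lemma xi_measurable [measurable]: "\<xi> \<alpha> \<in> borel_measurable M"
  using indep unfolding M.indep_vars_def by auto

lemma distr_xi: "distr M borel (\<xi> \<alpha>) = \<mu>"
  unfolding \<mu>_def by (rule ident)

lemma prob_space_mu: "prob_space \<mu>"
  unfolding \<mu>_def by (rule M.prob_space_distr) measurable

lemma sets_mu [measurable_cong]: "sets \<mu> = sets borel"
  by (simp add: \<mu>_def)

text \<open>A set of small diameter cannot meet neighbourhoods of two fixed points of the support.\<close>

lemma concentration:
  obtains \<rho> \<theta> where "\<rho> > 0" "0 \<le> \<theta>" "\<theta> < 1"
    "\<And>B. B \<in> sets \<mu> \<Longrightarrow> (\<And>s t. s \<in> B \<Longrightarrow> t \<in> B \<Longrightarrow> dist s t \<le> \<rho>) \<Longrightarrow> emeasure \<mu> B \<le> ennreal \<theta>"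
proof -
  interpret mu: prob_space \<mu> by (rule prob_space_mu)
  obtain a b where ab: "a \<noteq> b" "a \<in> measure_support \<mu>" "b \<in> measure_support \<mu>"
    using nondeg[of 0] unfolding nondegenerate_def \<mu>_def by auto
  \<comment> \<open>A set of diameter at most \<rho> meeting both balls would force dist a b < 3
    \<rho>, while the distance is 4 \<rho>.\<close>
  define \<rho> where "\<rho> = dist a b / 4"
  have \<rho>: "\<rho> > 0" using ab(1) by (simp add: \<rho>_def)
  have pos: "mu.prob (ball x \<rho>) > 0" if "x \<in> measure_support \<mu>" for x
  proof -
    have "emeasure \<mu> (ball x \<rho>) > 0"
      using that \<rho> unfolding measure_support_def by auto
    then show ?thesis by (simp add: mu.emeasure_eq_measure)
  qed
  define p where "p = min (mu.prob (ball a \<rho>)) (mu.prob (ball b \<rho>))"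
  have p: "p > 0" "p \<le> 1" using pos ab by (auto simp: p_def min.coboundedI1)
  show ?thesis
  proof (rule that[of \<rho> "1 - p"])
    fix B assume B: "B \<in> sets \<mu>" and diam: "\<And>s t. s \<in> B \<Longrightarrow> t \<in> B \<Longrightarrow> dist s t \<le> \<rho>"
    have "\<exists>x\<in>{a, b}. B \<inter> ball x \<rho> = {}"
    proof (rule ccontr)
      assume "\<not> ?thesis"
      then obtain s t where s: "s \<in> B" "dist a s < \<rho>" and t: "t \<in> B" "dist b t < \<rho>" by fastforce
      have "dist a b \<le> dist a s + dist s t + dist b t"
        using dist_triangle[of a b s] dist_triangle[of s b t] by (simp add: dist_commute)
      also have "\<dots> < 3 * \<rho>" using diam[OF s(1) t(1)] s t by linarith
      finally show False using \<rho> by (simp add: \<rho>_def)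
    qed
    then obtain x where x: "x \<in> {a, b}" "B \<inter> ball x \<rho> = {}" by blast
    have "mu.prob B + mu.prob (ball x \<rho>) = mu.prob (B \<union> ball x \<rho>)"
      using x B by (intro mu.finite_measure_Union[symmetric]) (auto simp: sets_mu)
    also have "\<dots> \<le> 1" by (rule mu.prob_le_1)
    finally have "mu.prob B \<le> 1 - p" using x(1) by (auto simp: p_def min_def)
    then show "emeasure \<mu> B \<le> ennreal (1 - p)"
      by (simp add: mu.emeasure_eq_measure ennreal_leI)
  qed (use \<rho> p in auto)
qed

text \<open>Independence and identical distribution make the joint law a power of \<mu>, so the
  coordinates can be integrated one at a time.\<close>

lemma prob_chain_le:
  assumes I: "finite I" "I \<noteq> {}" and as: "distinct as" "set as \<subseteq> I"
    and meas: "{x \<in> space (Pi_borel I). P x} \<in> sets (Pi_borel I)"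
    and \<theta>: "0 \<le> \<theta>" "\<And>B. B \<in> sets \<mu> \<Longrightarrow> (\<And>s t. s \<in> B \<Longrightarrow> t \<in> B \<Longrightarrow> dist s t \<le> \<rho>) \<Longrightarrow> emeasure \<mu> B \<le> ennreal \<theta>"
    and chain: "\<And>k x y. k < length as \<Longrightarrow> P x \<Longrightarrow> P y \<Longrightarrow>
       (\<And>i. i \<in> I - set (drop k as) \<Longrightarrow> x i = y i) \<Longrightarrow> dist (x (as ! k)) (y (as ! k)) \<le> \<rho>"
  shows "M.prob {w \<in> space M. P (\<lambda>i\<in>I. \<xi> i w)} \<le> \<theta> ^ length as"
proof -
  let ?X = "\<lambda>w. \<lambda>i\<in>I. \<xi> i w"
  define E where "E = {x \<in> space (Pi_borel I). P x}"
  have X [measurable]: "?X \<in> measurable M (Pi_borel I)"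
    by (intro measurable_restrict) measurable
  have "M.indep_vars (\<lambda>_. borel) \<xi> I"
    by (rule M.indep_vars_subset[OF indep]) simp
  then have law: "distr M (Pi_borel I) ?X = Pi\<^sub>M I (\<lambda>_. \<mu>)"
    using M.indep_vars_iff_distr_eq_PiM'[of I \<xi> "\<lambda>_. borel"] I(2) by (simp add: distr_xi)
  have sets_eq: "sets (Pi\<^sub>M I (\<lambda>_. \<mu>)) = sets (Pi_borel I)"
    by (intro sets_PiM_cong) (simp_all add: sets_mu)
  have "{w \<in> space M. P (?X w)} = ?X -` E \<inter> space M"
    using measurable_space[OF X] by (auto simp: E_def)
  then have "emeasure M {w \<in> space M. P (?X w)} = emeasure (distr M (Pi_borel I) ?X) E"
    using meas X by (simp add: emeasure_distr E_def)
  also have "\<dots> = emeasure (Pi\<^sub>M I (\<lambda>_. \<mu>)) E" by (simp only: law)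
  also have "\<dots> \<le> ennreal \<theta> ^ length as"
  proof (rule emeasure_PiM_chain_le[OF prob_space_mu _ I(1) as])
    show "E \<in> sets (Pi\<^sub>M I (\<lambda>_. \<mu>))" using meas by (simp add: E_def sets_eq)
    show "dist (x (as ! k)) (y (as ! k)) \<le> \<rho>"
      if "k < length as" "x \<in> E" "y \<in> E" "\<And>i. i \<in> I - set (drop k as) \<Longrightarrow> x i = y i" for k x y
      using that by (intro chain) (auto simp: E_def)
  qed (rule \<theta>(2))
  also have "\<dots> = ennreal (\<theta> ^ length as)" using \<theta>(1) by (simp add: ennreal_power)
  finally show ?thesis using \<theta>(1) by (simp add: M.emeasure_eq_measure)
qed

definition tail_prob :: "real \<Rightarrow> real" where
  "tail_prob c = M.prob {w \<in> space M. cmod (\<xi> 0 w) > c}"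

lemma prob_xi_gt: "M.prob {w \<in> space M. cmod (\<xi> \<alpha> w) > c} = tail_prob c"
proof -
  have "M.prob {w \<in> space M. cmod (\<xi> \<beta> w) > c} = measure \<mu> {x. cmod x > c}" for \<beta>
    unfolding distr_xi[of \<beta>, symmetric]
    by (subst measure_distr) (auto intro!: arg_cong[of _ _ M.prob])
  then show ?thesis by (simp add: tail_prob_def)
qed

lemma tail_prob_eventually:
  assumes "c > 0"
  shows "\<forall>\<^sub>F t in at_top. tail_prob (exp t) * t ^ CARD('d) \<le> c"
  using tail_o_imp_eventually[OF tail[of 0] assms] by (simp add: tail_prob_def)

lemma tail_prob_small:
  assumes "\<eta> > 0"
  obtains L where "L > 0" "tail_prob L \<le> \<eta>"
proof -
  have "\<forall>\<^sub>F t in at_top. tail_prob (exp t) * t ^ CARD('d) \<le> \<eta> \<and> t \<ge> 1"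
    using tail_prob_eventually[OF assms] eventually_ge_at_top[of 1] by eventually_elim simp
  then obtain t where t: "tail_prob (exp t) * t ^ CARD('d) \<le> \<eta>" "t \<ge> 1"
    using eventually_happens'[OF trivial_limit_at_top_linorder] by blast
  have "tail_prob (exp t) * 1 \<le> tail_prob (exp t) * t ^ CARD('d)"
    using t(2) by (intro mult_left_mono) (auto simp: tail_prob_def one_le_power)
  then show ?thesis using t(1) by (intro that[of "exp t"]) auto
qed

section \<open>Lower bounds at points\<close>

abbreviation H :: "nat \<Rightarrow> 'w \<Rightarrow> 'd cspace \<Rightarrow> complex" where
  "H \<equiv> random_poly \<tau> \<xi>"

lemma H_eq: "H n w z = (\<Sum>\<alpha> | mi_size \<alpha> \<le> n. (\<lambda>\<alpha>\<in>{\<alpha>. mi_size \<alpha> \<le> n}. \<xi> \<alpha> w) \<alpha> * q \<alpha> z)"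
  unfolding random_poly_def by (intro sum.cong) auto

lemma H_measurable [measurable]: "(\<lambda>w. H n w z) \<in> borel_measurable M"
  unfolding random_poly_def by measurable

abbreviation low_event :: "real \<Rightarrow> nat \<Rightarrow> 'd cspace set \<Rightarrow> 'w set" where
  "low_event \<epsilon> n F \<equiv> {w \<in> space M. \<forall>z\<in>F. cmod (H n w z) < exp (real n * (V z - \<epsilon>))}"

text \<open>The constants are chosen in the order \<open>J\<close>, \<open>L\<close>,
  \<open>R\<close>, all before n: the chain bound \<open>\<theta> ^ J\<close> takes one half of
  \<eta>, the truncation of \<open>J\<close> coefficients at \<open>L\<close> the other.\<close>

lemma lower_bound_positive:
  assumes z: "V z > 0" and \<epsilon>: "\<epsilon> > 0" and \<eta>: "\<eta> > 0"
  shows "\<forall>\<^sub>F n in sequentially. M.prob {w \<in> space M. cmod (H n w z) < exp (real n * (V z - \<epsilon>))} \<le> \<eta>"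
proof -
  obtain \<rho> \<theta> where \<rho>: "\<rho> > 0" and \<theta>: "0 \<le> \<theta>" "\<theta> < 1"
    and conc: "\<And>B. B \<in> sets \<mu> \<Longrightarrow> (\<And>s t. s \<in> B \<Longrightarrow> t \<in> B \<Longrightarrow> dist s t \<le> \<rho>) \<Longrightarrow> emeasure \<mu> B \<le> ennreal \<theta>"
    using concentration by metis
  obtain J where J: "\<theta> ^ J < \<eta> / 2" using real_arch_pow_inv[of "\<eta> / 2" \<theta>] \<theta> \<eta> by auto
  obtain L where L: "L > 0" "tail_prob L \<le> \<eta> / (2 * (real J + 1))"
    using tail_prob_small[of "\<eta> / (2 * (real J + 1))"] \<eta> by auto
  \<comment> \<open>Relative to the dominant value \<open>a k\<close>, two values of
    \<open>H\<close> below \<open>r\<close> contribute at most 2 / R, and fewer than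
    \<open>J\<close> later terms at most 2 L / R each; the sum must not exceed \<rho>.\<close>
  define R where "R = (2 + 2 * L * real J) / \<rho> + 2"
  have R: "R > 1" "(2 + 2 * L * real J) / R \<le> \<rho>"
  proof -
    have "(2 + 2 * L * real J) / \<rho> \<ge> 0" using L \<rho> by simp
    then show R1: "R > 1" by (simp add: R_def)
    have "R * \<rho> = 2 + 2 * L * real J + 2 * \<rho>" using \<rho> by (simp add: R_def field_simps)
    then show "(2 + 2 * L * real J) / R \<le> \<rho>" using R1 \<rho> by (simp add: divide_le_eq mult.commute)
  qed
  have "R > 0" using R(1) by simp
  from lacunary_indices[OF z \<epsilon> this, of J] show ?thesis
  proof eventually_elim
    case (elim n)
    then obtain A :: "nat \<Rightarrow> 'd multiindex" where A: "\<And>k. k < J \<Longrightarrow> mi_size (A k) \<le> n"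
      "\<And>k. k < J \<Longrightarrow> R * exp (real n * (V z - \<epsilon>)) \<le> cmod (q (A k) z)"
      "\<And>k. k < J \<Longrightarrow> R * cmod (q (A (Suc k)) z) \<le> cmod (q (A k) z)" by blast
    define I where "I = {\<alpha> :: 'd multiindex. mi_size \<alpha> \<le> n}"
    let ?S = "\<lambda>x. \<Sum>\<alpha>\<in>I. x \<alpha> * q \<alpha> z"
    define r where "r = exp (real n * (V z - \<epsilon>))"
    define a where "a = (\<lambda>k. cmod (q (A k) z))"
    have r: "r > 0" by (simp add: r_def)
    have ar: "R * r \<le> a k" if "k < J" for k using A(2)[OF that] by (simp add: a_def r_def)
    have a_pos: "a k > 0" if "k < J" for k using ar[OF that] R(1) r by (smt (verit) mult_pos_pos)
    have a_dec: "R * a j \<le> a k" if "k < j" "j < J" for j k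
      using that
    proof (induction j)
      case (Suc j)
      show ?case
      proof (cases "k = j")
        case True
        then show ?thesis using A(3)[of j] Suc.prems by (simp add: a_def)
      next
        case False
        then have "R * a j \<le> a k" using Suc by simp
        moreover have "R * a (Suc j) \<le> a j" using A(3)[of j] Suc.prems by (simp add: a_def)
        moreover have "a j \<le> R * a j" using R(1) by (simp add: a_def mult_le_cancel_right1)
        ultimately show ?thesis by linarith
      qed
    qed simp
    have inj: "A j \<noteq> A k" if "j < J" "k < j" for j k
    proof
      assume "A j = A k"
      then have "a j = a k" by (simp add: a_def)
      then have "R * a k \<le> a k" using a_dec[OF that(2,1)] by simp
      then show False using R(1) a_pos[of k] that by (simp add: mult_le_cancel_right2)
    qed
    define as where "as = map A [0..<J]"
    have as: "distinct as" "set as \<subseteq> I" "length as = J"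
      using inj A(1) by (auto simp: as_def I_def distinct_map inj_on_def) (metis linorder_neqE_nat)
    have fin: "finite I" unfolding I_def by (rule finite_mi_size_le)
    have "0 \<in> I" by (simp add: I_def mi_size_def)
    then have ne: "I \<noteq> {}" by blast
    \<comment> \<open>Only the selected coefficients are truncated, so the union bound has
      \<open>J\<close> terms, independently of n.\<close>
    define P where "P = (\<lambda>x. cmod (?S x) < r \<and> (\<forall>k<J. cmod (x (A k)) \<le> L))"
    have "M.prob {w \<in> space M. P (\<lambda>i\<in>I. \<xi> i w)} \<le> \<theta> ^ length as"
    proof (rule prob_chain_le[OF fin ne as(1,2) _ \<theta>(1) conc])
      have [measurable]: "(\<lambda>x. x \<alpha>) \<in> borel_measurable (Pi_borel I)" if "\<alpha> \<in> I" for \<alpha>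
        using that by (rule measurable_component_singleton)
      have "(\<lambda>x. x (A k)) \<in> borel_measurable (Pi_borel I)" if "k \<in> {..<J}" for k
        using A(1)[of k] that by (intro measurable_component_singleton) (simp add: I_def)
      then have "{x \<in> space (Pi_borel I). cmod (x (A k)) \<le> L} \<in> sets (Pi_borel I)" if "k \<in> {..<J}" for k
        using that by measurable
      then have "{x \<in> space (Pi_borel I). \<forall>k\<in>{..<J}. cmod (x (A k)) \<le> L} \<in> sets (Pi_borel I)"
        by (rule sets.sets_Collect_finite_All) simp_all
      moreover have "{x \<in> space (Pi_borel I). cmod (?S x) < r} \<in> sets (Pi_borel I)"
        by measurable
      ultimately have "{x \<in> space (Pi_borel I). cmod (?S x) < r} \<inter>
          {x \<in> space (Pi_borel I). \<forall>k\<in>{..<J}. cmod (x (A k)) \<le> L} \<in> sets (Pi_borel I)"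
        by (intro sets.Int)
      moreover have "{x \<in> space (Pi_borel I). P x} =
          {x \<in> space (Pi_borel I). cmod (?S x) < r} \<inter>
          {x \<in> space (Pi_borel I). \<forall>k\<in>{..<J}. cmod (x (A k)) \<le> L}"
        by (auto simp: P_def)
      ultimately show "{x \<in> space (Pi_borel I). P x} \<in> sets (Pi_borel I)"
        by (simp only:)
      fix k x y assume k: "k < length as" and xy: "P x" "P y"
        and agree: "\<And>i. i \<in> I - set (drop k as) \<Longrightarrow> x i = y i"
      have kJ: "k < J" using k as(3) by simp
      have sd: "set (drop k as) = A ` {k..<J}"
        by (simp add: as_def drop_map)
      have injA: "inj_on A {k..<J}"
        using inj by (auto simp: inj_on_def) (metis linorder_neqE_nat)
      have "(?S x) - (?S y) = (\<Sum>\<alpha>\<in>I. (x \<alpha> - y \<alpha>) * q \<alpha> z)"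
        by (simp add: sum_subtractf left_diff_distrib)
      also have "\<dots> = (\<Sum>\<alpha>\<in>A ` {k..<J}. (x \<alpha> - y \<alpha>) * q \<alpha> z)"
      proof (rule sum.mono_neutral_right[OF fin])
        show "A ` {k..<J} \<subseteq> I" using A(1) by (auto simp: I_def)
      qed (use agree sd in auto)
      also have "\<dots> = (\<Sum>j=k..<J. (x (A j) - y (A j)) * q (A j) z)"
        by (simp add: sum.reindex[OF injA])
      also have "\<dots> = (x (A k) - y (A k)) * q (A k) z + (\<Sum>j=Suc k..<J. (x (A j) - y (A j)) * q (A j) z)"
        using kJ by (simp add: sum.atLeast_Suc_lessThan)
      \<comment> \<open>The coefficients outside the remaining chain agree and cancel; the rest is
        solved for the dominant term.\<close>
      finally have eq: "(x (A k) - y (A k)) * q (A k) z =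
          (?S x) - (?S y) - (\<Sum>j=Suc k..<J. (x (A j) - y (A j)) * q (A j) z)"
        by simp
      have "cmod (\<Sum>j=Suc k..<J. (x (A j) - y (A j)) * q (A j) z) \<le> (\<Sum>j=Suc k..<J. 2 * L * (a k / R))"
      proof (rule sum_norm_le)
        fix j assume j: "j \<in> {Suc k..<J}"
        have "cmod (x (A j) - y (A j)) \<le> 2 * L"
          using xy j norm_triangle_ineq4[of "x (A j)" "y (A j)"] unfolding P_def by force
        moreover have "a j \<le> a k / R" using a_dec[of k j] j R(1) by (simp add: field_simps)
        ultimately have "cmod (x (A j) - y (A j)) * a j \<le> 2 * L * (a k / R)"
          using L(1) by (intro mult_mono) (auto simp: a_def)
        then show "cmod ((x (A j) - y (A j)) * q (A j) z) \<le> 2 * L * (a k / R)"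
          by (simp add: norm_mult a_def)
      qed
      also have "\<dots> = real (J - Suc k) * (2 * L * (a k / R))" by simp
      also have "\<dots> \<le> real J * (2 * L * (a k / R))"
        using L(1) R(1) a_pos[OF kJ] by (intro mult_right_mono) auto
      finally have rest: "cmod (\<Sum>j=Suc k..<J. (x (A j) - y (A j)) * q (A j) z) \<le> real J * (2 * L * (a k / R))" .
      have "cmod (x (A k) - y (A k)) * a k \<le> cmod (?S x) + cmod (?S y)
          + cmod (\<Sum>j=Suc k..<J. (x (A j) - y (A j)) * q (A j) z)"
        unfolding a_def norm_mult[symmetric] eq
        by (intro order_trans[OF norm_triangle_ineq4] add_mono norm_triangle_ineq4 order_refl)
      also have "\<dots> \<le> r + r + real J * (2 * L * (a k / R))"
        using xy rest unfolding P_def by linarith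
      also have "\<dots> \<le> a k / R + a k / R + real J * (2 * L * (a k / R))"
        using ar[OF kJ] R(1) by (intro add_mono) (auto simp: field_simps)
      also have "\<dots> = (2 + 2 * L * real J) / R * a k" by (simp add: add_divide_distrib algebra_simps)
      also have "\<dots> \<le> \<rho> * a k" using R(2) a_pos[OF kJ] by (intro mult_right_mono) auto
      finally have "cmod (x (A k) - y (A k)) \<le> \<rho>" using a_pos[OF kJ] by simp
      then show "dist (x (as ! k)) (y (as ! k)) \<le> \<rho>" using kJ by (simp add: as_def dist_norm)
    qed auto
    then have main: "M.prob {w \<in> space M. P (\<lambda>i\<in>I. \<xi> i w)} \<le> \<eta> / 2" using J as(3) by simp
    have HP: "{w \<in> space M. cmod (H n w z) < r} \<subseteq>
        {w \<in> space M. P (\<lambda>i\<in>I. \<xi> i w)} \<union> (\<Union>k\<in>{..<J}. {w \<in> space M. cmod (\<xi> (A k) w) > L})"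
    proof
      fix w assume w: "w \<in> {w \<in> space M. cmod (H n w z) < r}"
      show "w \<in> {w \<in> space M. P (\<lambda>i\<in>I. \<xi> i w)} \<union> (\<Union>k\<in>{..<J}. {w \<in> space M. cmod (\<xi> (A k) w) > L})"
      proof (cases "\<exists>k<J. cmod (\<xi> (A k) w) > L")
        case False
        then have "cmod (\<xi> (A k) w) \<le> L" if "k < J" for k using that by (meson not_less)
        then have "P (\<lambda>i\<in>I. \<xi> i w)"
          using w A(1) by (auto simp: P_def H_eq I_def)
        then show ?thesis using w by blast
      qed (use w in auto)
    qed
    have Pset: "{w \<in> space M. P (\<lambda>i\<in>I. \<xi> i w)} \<in> sets M"
    proof -
      have "{w \<in> space M. P (\<lambda>i\<in>I. \<xi> i w)} =
          {w \<in> space M. cmod (H n w z) < r \<and> (\<forall>k\<in>{..<J}. cmod (\<xi> (A k) w) \<le> L)}"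
        using A(1) by (auto simp: P_def H_eq I_def)
      also have "\<dots> \<in> sets M" by measurable
      finally show ?thesis .
    qed
    have "M.prob {w \<in> space M. cmod (H n w z) < r} \<le> M.prob ({w \<in> space M. P (\<lambda>i\<in>I. \<xi> i w)} \<union>
        (\<Union>k\<in>{..<J}. {w \<in> space M. cmod (\<xi> (A k) w) > L}))"
      using Pset by (intro M.finite_measure_mono HP) auto
    also have "\<dots> \<le> M.prob {w \<in> space M. P (\<lambda>i\<in>I. \<xi> i w)} +
        M.prob (\<Union>k\<in>{..<J}. {w \<in> space M. cmod (\<xi> (A k) w) > L})"
      using Pset by (intro measure_Un_le) auto
    also have "M.prob (\<Union>k\<in>{..<J}. {w \<in> space M. cmod (\<xi> (A k) w) > L}) \<le> (\<Sum>k<J. tail_prob L)"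
      by (rule order_trans[OF M.finite_measure_subadditive_finite]) (auto simp: prob_xi_gt)
    also have "(\<Sum>k<J. tail_prob L) = real J * tail_prob L" by simp
    also have "\<dots> \<le> real J * (\<eta> / (2 * (real J + 1)))" using L(2) by (intro mult_left_mono) auto
    also have "\<dots> \<le> \<eta> / 2" using \<eta> by (simp add: field_simps)
    finally show ?case using main unfolding r_def[symmetric] by linarith
  qed
qed

text \<open>Both \<open>S\<close>, any set of \<open>J\<close> indices, and the points
  \<open>F\<close> are fixed before n. The dual functionals eliminate the other coefficients of
  \<open>S\<close> exactly, so two configurations with small values on \<open>F\<close> that agree
  outside \<open>S\<close> differ at each index of \<open>S\<close> by at most 2 r C, which tends to
  0.\<close>

lemma lower_bound_zero:
  assumes U: "open U" "U \<noteq> {}" and V0: "\<And>z. z \<in> U \<Longrightarrow> V z = 0" and \<epsilon>: "\<epsilon> > 0" and \<eta>: "\<eta> > 0"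
  obtains F where "finite F" "F \<subseteq> U"
    "\<forall>\<^sub>F n in sequentially. M.prob (low_event \<epsilon> n F) \<le> \<eta>"
proof -
  obtain \<rho> \<theta> where \<rho>: "\<rho> > 0" and \<theta>: "0 \<le> \<theta>" "\<theta> < 1"
    and conc: "\<And>B. B \<in> sets \<mu> \<Longrightarrow> (\<And>s t. s \<in> B \<Longrightarrow> t \<in> B \<Longrightarrow> dist s t \<le> \<rho>) \<Longrightarrow> emeasure \<mu> B \<le> ennreal \<theta>"
    using concentration by metis
  obtain J where J: "\<theta> ^ J < \<eta>" using real_arch_pow_inv[of \<eta> \<theta>] \<theta> \<eta> by auto
  have "inj (\<lambda>k. (\<chi> i. k) :: 'd multiindex)" by (auto simp: inj_def vec_eq_iff)
  then have "infinite (UNIV :: 'd multiindex set)"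
    using range_inj_infinite infinite_super[OF subset_UNIV] by blast
  then obtain S :: "'d multiindex set" where S: "finite S" "card S = J"
    using infinite_arbitrarily_large by blast
  obtain as where as: "set as = S" "distinct as" using finite_distinct_list[OF S(1)] by blast
  have len: "length as = J" using as S distinct_card by metis
  obtain F c where F: "finite F" "F \<subseteq> U"
    and c: "\<And>\<alpha> \<beta>. \<alpha> \<in> S \<Longrightarrow> \<beta> \<in> S \<Longrightarrow> (\<Sum>z\<in>F. c \<alpha> z * q \<beta> z) = (if \<alpha> = \<beta> then 1 else 0)"
    using dual_points_q[OF U S(1)] by blast
  \<comment> \<open>A common bound for the norms of the dual functionals.\<close>
  define C where "C = (\<Sum>\<alpha>\<in>S. \<Sum>z\<in>F. cmod (c \<alpha> z))"
  have C: "(\<Sum>z\<in>F. cmod (c \<alpha> z)) \<le> C" if "\<alpha> \<in> S" for \<alpha>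
    unfolding C_def using that S(1) by (intro member_le_sum) (auto intro: sum_nonneg)
  have C0: "C \<ge> 0" unfolding C_def by (intro sum_nonneg) auto
  have "(\<lambda>n. 2 * exp (- (real n * \<epsilon>)) * C) \<longlonglongrightarrow> 0"
    using \<epsilon> by real_asymp
  then have ev1: "\<forall>\<^sub>F n in sequentially. 2 * exp (- (real n * \<epsilon>)) * C < \<rho>"
    using \<rho> by (rule order_tendstoD)
  have "\<forall>\<^sub>F n in sequentially. M.prob (low_event \<epsilon> n F) \<le> \<eta>"
    using ev1 eventually_ge_at_top[of "Max (mi_size ` S)"]
  proof eventually_elim
    case (elim n)
    define I where "I = {\<alpha> :: 'd multiindex. mi_size \<alpha> \<le> n}"
    have SI: "S \<subseteq> I"
    proof
      fix \<alpha> assume "\<alpha> \<in> S"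
      then have "mi_size \<alpha> \<le> Max (mi_size ` S)" using S(1) by simp
      then show "\<alpha> \<in> I" using elim(2) by (simp add: I_def)
    qed
    have fin: "finite I" unfolding I_def by (rule finite_mi_size_le)
    have "0 \<in> I" by (simp add: I_def mi_size_def)
    then have ne: "I \<noteq> {}" by blast
    define r where "r = exp (- (real n * \<epsilon>))"
    define P where "P = (\<lambda>x. \<forall>z\<in>F. cmod (\<Sum>\<alpha>\<in>I. x \<alpha> * q \<alpha> z) < r)"
    have "M.prob {w \<in> space M. P (\<lambda>i\<in>I. \<xi> i w)} \<le> \<theta> ^ length as"
    proof (rule prob_chain_le[OF fin ne as(2) _ _ \<theta>(1) conc])
      have [measurable]: "(\<lambda>x. x \<alpha>) \<in> borel_measurable (Pi_borel I)" if "\<alpha> \<in> I" for \<alpha>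
        using that by (rule measurable_component_singleton)
      have meas: "{x \<in> space (Pi_borel I). cmod (\<Sum>\<alpha>\<in>I. x \<alpha> * q \<alpha> z) < r} \<in> sets (Pi_borel I)" for z
        by measurable
      show "{x \<in> space (Pi_borel I). P x} \<in> sets (Pi_borel I)"
        unfolding P_def by (rule sets.sets_Collect_finite_All[OF meas F(1)])
      fix k x y assume k: "k < length as" and xy: "P x" "P y"
        and agree: "\<And>i. i \<in> I - set (drop k as) \<Longrightarrow> x i = y i"
      define \<alpha> where "\<alpha> = as ! k"
      have \<alpha>: "\<alpha> \<in> S" using k as(1) by (auto simp: \<alpha>_def)
      have agree': "x \<beta> = y \<beta>" if "\<beta> \<in> I - S" for \<beta>
        using that as(1) set_drop_subset[of k as] by (intro agree) auto
      have diff: "(\<Sum>\<beta>\<in>I. x \<beta> * q \<beta> z) - (\<Sum>\<beta>\<in>I. y \<beta> * q \<beta> z) = (\<Sum>\<beta>\<in>S. (x \<beta> - y \<beta>) * q \<beta> z)" for z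
      proof -
        have "(\<Sum>\<beta>\<in>I. x \<beta> * q \<beta> z) - (\<Sum>\<beta>\<in>I. y \<beta> * q \<beta> z) = (\<Sum>\<beta>\<in>I. (x \<beta> - y \<beta>) * q \<beta> z)"
          by (simp add: sum_subtractf left_diff_distrib)
        also have "\<dots> = (\<Sum>\<beta>\<in>S. (x \<beta> - y \<beta>) * q \<beta> z)"
          by (rule sum.mono_neutral_right[OF fin SI]) (use agree' in auto)
        finally show ?thesis .
      qed
      have "(\<Sum>z\<in>F. c \<alpha> z * (\<Sum>\<beta>\<in>S. (x \<beta> - y \<beta>) * q \<beta> z)) = (\<Sum>\<beta>\<in>S. (x \<beta> - y \<beta>) * (\<Sum>z\<in>F. c \<alpha> z * q \<beta> z))"
        unfolding sum_distrib_left by (subst sum.swap) (simp add: mult_ac)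
      also have "\<dots> = x \<alpha> - y \<alpha>"
        using \<alpha> S(1) by (simp add: c if_distrib sum.delta cong: if_cong)
      finally have "cmod (x \<alpha> - y \<alpha>) = cmod (\<Sum>z\<in>F. c \<alpha> z * (\<Sum>\<beta>\<in>S. (x \<beta> - y \<beta>) * q \<beta> z))" by simp
      also have "\<dots> \<le> (\<Sum>z\<in>F. cmod (c \<alpha> z) * (2 * r))"
      proof (rule sum_norm_le)
        fix z assume "z \<in> F"
        then have "cmod (\<Sum>\<beta>\<in>S. (x \<beta> - y \<beta>) * q \<beta> z) \<le> 2 * r"
          using xy norm_triangle_ineq4[of "\<Sum>\<beta>\<in>I. x \<beta> * q \<beta> z" "\<Sum>\<beta>\<in>I. y \<beta> * q \<beta> z"]
          unfolding P_def diff by force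
        then show "cmod (c \<alpha> z * (\<Sum>\<beta>\<in>S. (x \<beta> - y \<beta>) * q \<beta> z)) \<le> cmod (c \<alpha> z) * (2 * r)"
          by (simp add: norm_mult mult_left_mono)
      qed
      also have "\<dots> = 2 * r * (\<Sum>z\<in>F. cmod (c \<alpha> z))" by (simp add: sum_distrib_left mult_ac)
      also have "\<dots> \<le> 2 * r * C" using C[OF \<alpha>] by (intro mult_left_mono) (auto simp: r_def)
      also have "\<dots> \<le> \<rho>" using elim(1) by (simp add: r_def)
      finally show "dist (x (as ! k)) (y (as ! k)) \<le> \<rho>" by (simp add: \<alpha>_def dist_norm)
    qed (use SI as in auto)
    moreover have "{w \<in> space M. P (\<lambda>i\<in>I. \<xi> i w)} =
        {w \<in> space M. \<forall>z\<in>F. cmod (H n w z) < exp (real n * (V z - \<epsilon>))}"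
      using V0 F(2) by (intro Collect_cong conj_cong refl)
        (auto simp: P_def H_eq I_def r_def subset_eq intro!: ball_cong)
    ultimately show ?case using J len by simp
  qed
  with F show ?thesis using that by blast
qed

lemma lower_bound:
  assumes U: "open U" "U \<noteq> {}" and \<epsilon>: "\<epsilon> > 0" and \<eta>: "\<eta> > 0"
  obtains F where "finite F" "F \<subseteq> U"
    "\<forall>\<^sub>F n in sequentially. M.prob (low_event \<epsilon> n F) \<le> \<eta>"
proof (cases "\<exists>z\<in>U. V z > 0")
  case True
  then obtain z where "z \<in> U" "V z > 0" by blast
  then show ?thesis using that[of "{z}"] lower_bound_positive[OF _ \<epsilon> \<eta>] by simp
next
  case False
  then have "V z = 0" if "z \<in> U" for z using that V_nonneg[of z] by force
  then show ?thesis using lower_bound_zero[OF U _ \<epsilon> \<eta>] that by blast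
qed

text \<open>One third of \<epsilon> each goes to the size of the coefficients, to the growth of the
  \<open>q\<close>, and to the number of terms times the constant \<open>B\<close>. The exceptional
  set concerns the coefficients alone, which is why the bound holds at all z at once.\<close>

lemma upper_bound:
  assumes \<epsilon>: "\<epsilon> > 0"
  obtains Bad where "\<And>n. Bad n \<in> sets M" "(\<lambda>n. M.prob (Bad n)) \<longlonglongrightarrow> 0"
    "\<forall>\<^sub>F n in sequentially. \<forall>w\<in>space M - Bad n. \<forall>z. cmod (H n w z) \<le> exp (real n * (V z + \<epsilon>))"
proof -
  define I where "I = (\<lambda>n. {\<alpha> :: 'd multiindex. mi_size \<alpha> \<le> n})"
  have fin: "finite (I n)" for n unfolding I_def by (rule finite_mi_size_le)
  have card: "real (card (I n)) \<le> (real n + 1) ^ CARD('d)" for n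
    unfolding I_def by (rule card_mi_size_le)
  define Bad where "Bad = (\<lambda>n. \<Union>\<alpha>\<in>I n. {w \<in> space M. cmod (\<xi> \<alpha> w) > exp (real n * (\<epsilon> / 3))})"
  have sets: "Bad n \<in> sets M" for n
    unfolding Bad_def using fin by (intro sets.finite_UN) auto
  have bad_le: "M.prob (Bad n) \<le> (real n + 1) ^ CARD('d) * tail_prob (exp (real n * (\<epsilon> / 3)))" for n
  proof -
    have "M.prob (Bad n) \<le> (\<Sum>\<alpha>\<in>I n. M.prob {w \<in> space M. cmod (\<xi> \<alpha> w) > exp (real n * (\<epsilon> / 3))})"
      unfolding Bad_def using fin by (intro M.finite_measure_subadditive_finite) auto
    also have "\<dots> = real (card (I n)) * tail_prob (exp (real n * (\<epsilon> / 3)))" by (simp add: prob_xi_gt)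
    also have "\<dots> \<le> (real n + 1) ^ CARD('d) * tail_prob (exp (real n * (\<epsilon> / 3)))"
      by (intro mult_right_mono card) (simp add: tail_prob_def)
    finally show ?thesis .
  qed
  have lim: "(\<lambda>n. M.prob (Bad n)) \<longlonglongrightarrow> 0"
  proof (rule order_tendstoI)
    fix e :: real assume e: "0 < e"
    \<comment> \<open>For n \<ge> 1, n + 1 \<le> 2 n = (6 / \<epsilon>) (n \<epsilon> / 3), so the
      union bound costs (6 / \<epsilon>)^d; the factor 2 leaves e / 2 and hence a strict
      inequality.\<close>
    define c where "c = e / (2 * (6 / \<epsilon>) ^ CARD('d))"
    have c: "c > 0" using e \<epsilon> by (simp add: c_def)
    have "filterlim (\<lambda>n. real n * (\<epsilon> / 3)) at_top sequentially"
      using \<epsilon> by real_asymp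
    from eventually_compose_filterlim[OF tail_prob_eventually[OF c] this]
    have "\<forall>\<^sub>F n in sequentially. tail_prob (exp (real n * (\<epsilon> / 3))) * (real n * (\<epsilon> / 3)) ^ CARD('d) \<le> c" .
    then show "\<forall>\<^sub>F n in sequentially. M.prob (Bad n) < e"
      using eventually_ge_at_top[of 1]
    proof eventually_elim
      case (elim n)
      have "(real n + 1) ^ CARD('d) \<le> (2 * real n) ^ CARD('d)"
        using elim(2) by (intro power_mono) auto
      also have "2 * real n = 6 / \<epsilon> * (real n * (\<epsilon> / 3))" using \<epsilon> by simp
      finally have "(real n + 1) ^ CARD('d) * tail_prob (exp (real n * (\<epsilon> / 3))) \<le>
          (6 / \<epsilon>) ^ CARD('d) * (real n * (\<epsilon> / 3)) ^ CARD('d) * tail_prob (exp (real n * (\<epsilon> / 3)))"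
        unfolding power_mult_distrib by (intro mult_right_mono) (auto simp: tail_prob_def)
      also have "\<dots> \<le> (6 / \<epsilon>) ^ CARD('d) * c"
        unfolding mult.assoc using elim(1) \<epsilon> by (intro mult_left_mono) (auto simp: mult.commute)
      also have "\<dots> = e / 2" using \<epsilon> by (simp add: c_def)
      finally show ?case using bad_le[of n] e by linarith
    qed
  qed (auto intro!: always_eventually less_le_trans[OF _ measure_nonneg])
  obtain B where B: "B > 0" "\<And>\<alpha> z. cmod (q \<alpha> z) \<le> B * exp (real (mi_size \<alpha>) * (V z + \<epsilon> / 3))"
    using q_upper_bound[of "\<epsilon> / 3"] \<epsilon> by auto
  have "\<forall>\<^sub>F n in sequentially. (real n + 1) ^ CARD('d) * B < exp (real n * (\<epsilon> / 3) - 0)"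
    using \<epsilon> B(1) by (intro eventually_power_less_exp) auto
  then have "\<forall>\<^sub>F n in sequentially. \<forall>w\<in>space M - Bad n. \<forall>z. cmod (H n w z) \<le> exp (real n * (V z + \<epsilon>))"
  proof eventually_elim
    case (elim n)
    show ?case
    proof (intro ballI allI)
      fix w z assume "w \<in> space M - Bad n"
      then have w: "cmod (\<xi> \<alpha> w) \<le> exp (real n * (\<epsilon> / 3))" if "\<alpha> \<in> I n" for \<alpha>
        using that unfolding Bad_def by (auto simp: not_less)
      have "H n w z = (\<Sum>\<alpha>\<in>I n. \<xi> \<alpha> w * q \<alpha> z)" by (simp add: random_poly_def I_def)
      also have "cmod \<dots> \<le> (\<Sum>\<alpha>\<in>I n. exp (real n * (\<epsilon> / 3)) * (B * exp (real n * (V z + \<epsilon> / 3))))"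
      proof (rule sum_norm_le)
        fix \<alpha> assume \<alpha>: "\<alpha> \<in> I n"
        have "cmod (q \<alpha> z) \<le> B * exp (real (mi_size \<alpha>) * (V z + \<epsilon> / 3))" by (rule B(2))
        also have "\<dots> \<le> B * exp (real n * (V z + \<epsilon> / 3))"
          using \<alpha> B(1) \<epsilon> V_nonneg[of z] by (intro mult_left_mono) (auto simp: I_def intro!: mult_right_mono)
        finally show "cmod (\<xi> \<alpha> w * q \<alpha> z) \<le> exp (real n * (\<epsilon> / 3)) * (B * exp (real n * (V z + \<epsilon> / 3)))"
          using w[OF \<alpha>] unfolding norm_mult by (intro mult_mono) auto
      qed
      also have "\<dots> = real (card (I n)) * (B * (exp (real n * (\<epsilon> / 3)) * exp (real n * (V z + \<epsilon> / 3))))"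
        by (simp add: mult_ac)
      also have "\<dots> \<le> (real n + 1) ^ CARD('d) * (B * (exp (real n * (\<epsilon> / 3)) * exp (real n * (V z + \<epsilon> / 3))))"
        using B(1) by (intro mult_right_mono card) auto
      also have "\<dots> = ((real n + 1) ^ CARD('d) * B) * (exp (real n * (\<epsilon> / 3)) * exp (real n * (V z + \<epsilon> / 3)))"
        by (simp add: mult_ac)
      also have "\<dots> \<le> exp (real n * (\<epsilon> / 3)) * (exp (real n * (\<epsilon> / 3)) * exp (real n * (V z + \<epsilon> / 3)))"
        using elim by (intro mult_right_mono) auto
      also have "\<dots> = exp (real n * (V z + \<epsilon>))"
        by (simp add: exp_add[symmetric] algebra_simps)
      finally show "cmod (H n w z) \<le> exp (real n * (V z + \<epsilon>))" .
    qed
  qed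
  with sets lim show ?thesis using that by blast
qed

end


section \<open>Currents\<close>

lemma C_k_add:
  "C_k k f \<Longrightarrow> C_k k g \<Longrightarrow> C_k k (\<lambda>x. f x + g x)"
proof (induction k arbitrary: f g)
  case (Suc k)
  have "frechet_derivative (\<lambda>x. f x + g x) (at x) v = frechet_derivative f (at x) v + frechet_derivative g (at x) v" for x v
  proof -
    have "((\<lambda>x. f x + g x) has_derivative (\<lambda>v. frechet_derivative f (at x) v + frechet_derivative g (at x) v)) (at x)"
      using Suc.prems by (intro has_derivative_add) (simp_all add: frechet_derivative_works)
    from frechet_derivative_at[OF this] show ?thesis by metis
  qed
  then show ?case using Suc by (auto intro: differentiable_add)
qed (auto intro: continuous_on_add)

lemma C_k_bounded_linear:
  assumes "bounded_linear L"
  shows "C_k k f \<Longrightarrow> C_k k (\<lambda>x. L (f x))"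
proof (induction k arbitrary: f)
  case 0
  then show ?case using bounded_linear.continuous_on[OF assms] by simp
next
  case (Suc k)
  have der: "((\<lambda>x. L (f x)) has_derivative (\<lambda>v. L (frechet_derivative f (at x) v))) (at x)" for x
    using Suc.prems by (intro bounded_linear.has_derivative[OF assms]) (simp add: frechet_derivative_works)
  then have "frechet_derivative (\<lambda>x. L (f x)) (at x) v = L (frechet_derivative f (at x) v)" for x v
    using frechet_derivative_at[OF der] by metis
  moreover have "(\<lambda>x. L (f x)) differentiable (at x)" for x
    using der unfolding differentiable_def by blast
  ultimately show ?case using Suc by simp
qed

lemma smooth_add: "smooth f \<Longrightarrow> smooth g \<Longrightarrow> smooth (\<lambda>x. f x + g x)"
  by (simp add: smooth_def C_k_add)

lemma smooth_cmult: "smooth f \<Longrightarrow> smooth (\<lambda>x. c * f x)" for c :: complex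
  unfolding smooth_def using C_k_bounded_linear[OF bounded_linear_mult_right[of c]] by blast

lemma smooth_sum:
  fixes f :: "'i \<Rightarrow> 'a::euclidean_space \<Rightarrow> complex"
  assumes "\<And>i. i \<in> S \<Longrightarrow> smooth (f i)"
  shows "smooth (\<lambda>x. \<Sum>i\<in>S. f i x)"
proof -
  have "C_k k (\<lambda>x::'a. 0 :: complex)" for k
    by (induction k) (auto simp: frechet_derivative_const)
  then have "smooth (\<lambda>x::'a. 0 :: complex)" by (simp add: smooth_def)
  then show ?thesis using assms
    by (induction S rule: infinite_finite_induct) (auto intro: smooth_add)
qed

lemma smooth_frechet_derivative: "smooth f \<Longrightarrow> smooth (\<lambda>x. frechet_derivative f (at x) v)"
  unfolding smooth_def by (metis C_k.simps(2))

lemma smooth_imp_continuous: "smooth f \<Longrightarrow> continuous_on S f"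
  unfolding smooth_def by (metis C_k.simps(1) continuous_on_subset subset_UNIV)

lemma smooth_del_coord: "smooth f \<Longrightarrow> smooth (del_coord j f)"
proof -
  assume "smooth f"
  then have "smooth (\<lambda>z. (1 / 2) * frechet_derivative f (at z) (axis j 1) + (- \<i> / 2) * frechet_derivative f (at z) (axis j \<i>))"
    by (intro smooth_add smooth_cmult smooth_frechet_derivative)
  moreover have "del_coord j f = (\<lambda>z. (1 / 2) * frechet_derivative f (at z) (axis j 1) + (- \<i> / 2) * frechet_derivative f (at z) (axis j \<i>))"
    by (simp add: del_coord_def fun_eq_iff diff_divide_distrib)
  ultimately show ?thesis by simp
qed

lemma smooth_delbar_coord: "smooth f \<Longrightarrow> smooth (delbar_coord j f)"
proof -
  assume "smooth f"
  then have "smooth (\<lambda>z. (1 / 2) * frechet_derivative f (at z) (axis j 1) + (\<i> / 2) * frechet_derivative f (at z) (axis j \<i>))"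
    by (intro smooth_add smooth_cmult smooth_frechet_derivative)
  moreover have "delbar_coord j f = (\<lambda>z. (1 / 2) * frechet_derivative f (at z) (axis j 1) + (\<i> / 2) * frechet_derivative f (at z) (axis j \<i>))"
    by (simp add: delbar_coord_def fun_eq_iff add_divide_distrib)
  ultimately show ?thesis by simp
qed

lemma smooth_form_ddc:
  assumes "\<And>I J. smooth (\<phi> I J)"
  shows "smooth (form_ddc \<phi> I J)"
proof -
  have "smooth (form_delbar \<phi> I J)" for I J
    unfolding form_delbar_def by (intro smooth_sum smooth_cmult smooth_delbar_coord assms)
  then have "smooth (form_del (form_delbar \<phi>) I J)" for I J
    unfolding form_del_def by (intro smooth_sum smooth_cmult smooth_del_coord)
  then show ?thesis unfolding form_ddc_def by (rule smooth_cmult)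
qed

lemma coord_derivatives_vanish:
  assumes "open U" "z \<in> U" "\<And>x. x \<in> U \<Longrightarrow> f x = 0"
  shows "del_coord j f z = 0" "delbar_coord j f z = 0"
proof -
  have "((\<lambda>x. 0) has_derivative (\<lambda>v. 0)) (at z)" by simp
  then have "(f has_derivative (\<lambda>v. 0)) (at z)"
    by (rule has_derivative_transform_within_open[OF _ assms(1,2)]) (simp add: assms(3))
  from frechet_derivative_at[OF this, symmetric]
  show "del_coord j f z = 0" "delbar_coord j f z = 0"
    by (simp_all add: del_coord_def delbar_coord_def)
qed

lemma form_ddc_vanish:
  assumes "open U" "z \<in> U" "\<And>I J x. x \<in> U \<Longrightarrow> \<phi> I J x = 0"
  shows "form_ddc \<phi> I J z = 0"
proof -
  have "form_delbar \<phi> I J x = 0" if "x \<in> U" for I J x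
    unfolding form_delbar_def using coord_derivatives_vanish(2)[OF assms(1) that] assms(3) by simp
  then have "form_del (form_delbar \<phi>) I J z = 0"
    unfolding form_del_def using coord_derivatives_vanish(1)[OF assms(1,2)] by simp
  then show ?thesis by (simp add: form_ddc_def)
qed

text \<open>Derivatives are local, so applying dd^c does not enlarge the support, and there are only
  finitely many coefficients.\<close>

lemma test_form_ddc_support:
  fixes \<phi> :: "'d::{finite,linorder} cform"
  assumes "\<phi> \<in> test_forms p"
  obtains S where "compact S" "\<And>I J z. z \<notin> S \<Longrightarrow> form_ddc \<phi> I J z = 0"
proof -
  define S where "S = (\<Union>I. \<Union>J. closure {z. \<phi> I J z \<noteq> 0})"
  have "compact (closure {z. \<phi> I J z \<noteq> 0})" for I J
    using assms by (simp add: test_forms_def)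
  then have S: "compact S"
    unfolding S_def by (intro compact_UN finite_class.finite_UNIV) auto
  have "form_ddc \<phi> I J z = 0" if "z \<notin> S" for I J z
  proof (rule form_ddc_vanish[of "- S"])
    show "open (- S)" using S by (simp add: compact_imp_closed open_Compl)
    show "\<phi> I J x = 0" if "x \<in> - S" for I J x
      using that closure_subset[of "{z. \<phi> I J z \<noteq> 0}"] unfolding S_def by blast
  qed (use that in simp)
  then show ?thesis using that S by blast
qed

text \<open>The test function is bounded by some \<open>B\<close> and vanishes off \<open>S\<close>,
  so the integrals differ by at most \<open>B\<close> times the L1 distance on
  \<open>S\<close>.\<close>

lemma tendsto_integral_mult_L1loc:
  fixes u :: "nat \<Rightarrow> 'a::euclidean_space \<Rightarrow> real" and \<psi> :: "'a \<Rightarrow> complex"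
  assumes u: "\<And>k. u k \<in> borel_measurable borel" and v: "continuous_on UNIV v"
    and \<psi>: "continuous_on UNIV \<psi>" and S: "compact S" "\<And>z. z \<notin> S \<Longrightarrow> \<psi> z = 0"
    and lim: "(\<lambda>k. \<integral>\<^sup>+z\<in>S. ennreal \<bar>u k z - v z\<bar> \<partial>lborel) \<longlonglongrightarrow> 0"
  shows "(\<lambda>k. \<integral>z. complex_of_real (u k z) * \<psi> z \<partial>lborel) \<longlonglongrightarrow> (\<integral>z. complex_of_real (v z) * \<psi> z \<partial>lborel)"
proof -
  let ?d = "\<lambda>k. \<integral>\<^sup>+z\<in>S. ennreal \<bar>u k z - v z\<bar> \<partial>lborel"
  let ?I = "\<lambda>w. \<integral>z. complex_of_real (w z) * \<psi> z \<partial>lborel"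
  have [measurable]: "S \<in> sets borel" using S(1) by (intro borel_closed compact_imp_closed)
  have [measurable]: "\<psi> \<in> borel_measurable borel" "v \<in> borel_measurable borel" "\<And>k. u k \<in> borel_measurable borel"
    using \<psi> v u by (auto intro: borel_measurable_continuous_onI)
  have "bounded (\<psi> ` S)"
    by (intro compact_imp_bounded compact_continuous_image continuous_on_subset[OF \<psi>] S(1)) auto
  then obtain B where B: "B > 0" "\<And>z. z \<in> S \<Longrightarrow> cmod (\<psi> z) \<le> B" unfolding bounded_pos by auto
  have int_v: "integrable lborel (\<lambda>z. complex_of_real (v z) * \<psi> z)"
  proof -
    have "integrable lborel (\<lambda>z. indicator S z *\<^sub>R (complex_of_real (v z) * \<psi> z))"
      by (intro borel_integrable_compact S(1) continuous_intros continuous_on_subset[OF \<psi>] continuous_on_subset[OF v]) auto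
    moreover have "(\<lambda>z. indicator S z *\<^sub>R (complex_of_real (v z) * \<psi> z)) = (\<lambda>z. complex_of_real (v z) * \<psi> z)"
      using S(2) by (auto simp: indicator_def fun_eq_iff)
    ultimately show ?thesis by simp
  qed
  have bound: "(\<integral>\<^sup>+z. ennreal (norm (complex_of_real (u k z - v z) * \<psi> z)) \<partial>lborel) \<le> ennreal B * ?d k" for k
  proof -
    have "(\<integral>\<^sup>+z. ennreal (norm (complex_of_real (u k z - v z) * \<psi> z)) \<partial>lborel)
        \<le> (\<integral>\<^sup>+z. ennreal B * (ennreal \<bar>u k z - v z\<bar> * indicator S z) \<partial>lborel)"
    proof (rule nn_integral_mono)
      fix z
      show "ennreal (norm (complex_of_real (u k z - v z) * \<psi> z)) \<le> ennreal B * (ennreal \<bar>u k z - v z\<bar> * indicator S z)"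
      proof (cases "z \<in> S")
        case True
        have "norm (complex_of_real (u k z - v z) * \<psi> z) \<le> B * \<bar>u k z - v z\<bar>"
          using B(2)[OF True] by (simp only: norm_mult norm_of_real mult.commute[of B] mult_left_mono abs_ge_zero)
        then show ?thesis using True B(1) by (simp add: ennreal_mult[symmetric] ennreal_leI)
      qed (simp add: S(2))
    qed
    also have "\<dots> = ennreal B * ?d k" by (rule nn_integral_cmult) measurable
    finally show ?thesis .
  qed
  \<comment> \<open>The Bochner integral of a non-integrable function is 0 by convention, so the
    integrals are compared only for those k, eventually all, at which the distance is
    finite.\<close>
  have "\<forall>\<^sub>F k in sequentially. ?d k < \<infinity>"
    using order_tendstoD(2)[OF lim, of \<infinity>] by simp
  then have ev: "\<forall>\<^sub>F k in sequentially. integrable lborel (\<lambda>z. complex_of_real (u k z - v z) * \<psi> z)"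
  proof eventually_elim
    case (elim k)
    show ?case
    proof (rule integrableI_bounded)
      show "(\<integral>\<^sup>+z. ennreal (norm (complex_of_real (u k z - v z) * \<psi> z)) \<partial>lborel) < \<infinity>"
        using bound[of k] elim by (auto intro: le_less_trans simp: ennreal_mult_less_top)
    qed measurable
  qed
  define g where "g = (\<lambda>k. norm (?I (u k) - ?I v))"
  have le: "\<forall>\<^sub>F k in sequentially. ennreal (g k) \<le> ennreal B * ?d k"
    using ev
  proof eventually_elim
    case (elim k)
    have "?I (u k) =
        (\<integral>z. complex_of_real (u k z - v z) * \<psi> z + complex_of_real (v z) * \<psi> z \<partial>lborel)"
      by (simp add: left_diff_distrib)
    also have "\<dots> = (\<integral>z. complex_of_real (u k z - v z) * \<psi> z \<partial>lborel) + ?I v"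
      by (rule Bochner_Integration.integral_add[OF elim int_v])
    finally have "g k = norm (\<integral>z. complex_of_real (u k z - v z) * \<psi> z \<partial>lborel)" by (simp add: g_def)
    then show ?case
      using order_trans[OF integral_norm_bound_ennreal[OF elim] bound[of k]] by (simp only:)
  qed
  have "(\<lambda>k. ennreal B * ?d k) \<longlonglongrightarrow> ennreal B * 0"
    by (intro ennreal_tendsto_cmult lim) simp
  then have lim0: "(\<lambda>k. ennreal B * ?d k) \<longlonglongrightarrow> 0" by simp
  have "(\<lambda>k. ennreal (g k)) \<longlonglongrightarrow> 0"
    by (rule tendsto_sandwich[OF _ le tendsto_const lim0]) simp
  then have "g \<longlonglongrightarrow> 0"
    by (subst (asm) ennreal_0[symmetric], subst (asm) tendsto_ennreal_iff) (auto simp: g_def)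
  then show ?thesis
    unfolding g_def by (rule LIM_zero_cancel[OF tendsto_norm_zero_cancel])
qed

text \<open>Only the top coefficient of dd^c \<phi> enters the pairing; together with the
  orientation constant it is one fixed continuous function of compact support.\<close>

lemma currents_tendsto_ddc_current:
  fixes u :: "nat \<Rightarrow> 'd::{finite,linorder} cspace \<Rightarrow> real"
  assumes u: "\<And>k. u k \<in> borel_measurable borel" and v: "continuous_on UNIV v"
    and lim: "\<And>S. compact S \<Longrightarrow> (\<lambda>k. \<integral>\<^sup>+z\<in>S. ennreal \<bar>u k z - v z\<bar> \<partial>lborel) \<longlonglongrightarrow> 0"
  shows "currents_tendsto (\<lambda>k. ddc_current (u k)) (ddc_current v)"
  unfolding currents_tendsto_def
proof
  fix \<phi> :: "'d cform" assume \<phi>: "\<phi> \<in> test_forms (CARD('d) - 1)"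
  obtain S where S: "compact S" "\<And>I J z. z \<notin> S \<Longrightarrow> form_ddc \<phi> I J z = 0"
    using test_form_ddc_support[OF \<phi>] by blast
  define c :: complex where "c = (-1) ^ (CARD('d) * (CARD('d) - 1) div 2) * (-2 * \<i>) ^ CARD('d)"
  define \<psi> where "\<psi> = (\<lambda>z. c * form_ddc \<phi> UNIV UNIV z)"
  have "continuous_on UNIV \<psi>"
    unfolding \<psi>_def using \<phi>
    by (intro continuous_intros smooth_imp_continuous smooth_form_ddc) (simp add: test_forms_def)
  moreover have "\<psi> z = 0" if "z \<notin> S" for z using S(2)[OF that] by (simp add: \<psi>_def)
  ultimately have "(\<lambda>k. \<integral>z. complex_of_real (u k z) * \<psi> z \<partial>lborel) \<longlonglongrightarrow> (\<integral>z. complex_of_real (v z) * \<psi> z \<partial>lborel)"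
    using tendsto_integral_mult_L1loc[OF u v _ S(1) _ lim[OF S(1)]] by blast
  moreover have "ddc_current w \<phi> = (\<integral>z. complex_of_real (w z) * \<psi> z \<partial>lborel)" for w
    unfolding ddc_current_def form_integral_def \<psi>_def c_def by (simp add: mult_ac)
  ultimately show "(\<lambda>k. ddc_current (u k) \<phi>) \<longlonglongrightarrow> ddc_current v \<phi>" by simp
qed

text \<open>The constant 0 is a witness. By contraposition, a set that is not pluripolar contains a
  point.\<close>

lemma pluripolar_empty: "pluripolar {}"
  unfolding pluripolar_def plurisubharmonic_def ereal_integral_def
  by (intro exI[of _ "\<lambda>_. 0"]) auto

lemma eventually_subsequence:
  fixes P :: "nat \<Rightarrow> nat \<Rightarrow> bool"
  assumes "\<And>k. eventually (P k) sequentially"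
  obtains s where "strict_mono s" "\<And>k. P k (s k)"
proof -
  obtain N where N: "\<And>k n. n \<ge> N k \<Longrightarrow> P k n"
    using assms unfolding eventually_sequentially by metis
  \<comment> \<open>Partial sums dominate each \<open>N k\<close>; the added k makes the sequence
    strictly increasing.\<close>
  define s where "s = (\<lambda>k. k + (\<Sum>i\<le>k. N i))"
  have "strict_mono s" by (rule strict_mono_Suc_iff[THEN iffD2]) (auto simp: s_def)
  moreover have "s k \<ge> N k" for k
    unfolding s_def using member_le_sum[of k "{..k}" N] by simp
  ultimately show ?thesis using that N by blast
qed


section \<open>Convergence\<close>

context random_orthogonal_polynomials
begin

lemma H_poly_fun: "H n w \<in> poly_fun n"
proof -
  have "(\<lambda>z. \<Sum>\<alpha> | mi_size \<alpha> \<le> n. \<xi> \<alpha> w * q \<alpha> z) \<in> poly_fun n"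
    by (intro mono_span_sum mono_span_cmult poly_fun_mono[OF q_poly_fun]) simp
  then show ?thesis by (simp add: random_poly_def[abs_def])
qed

lemma random_potential_measurable: "random_potential \<tau> \<xi> n w \<in> borel_measurable borel"
  unfolding random_potential_def[abs_def]
  using borel_measurable_ln_poly_fun[OF H_poly_fun[of n w]] by measurable

definition L1_dist :: "'d cspace set \<Rightarrow> nat \<Rightarrow> 'w \<Rightarrow> ennreal" where
  "L1_dist C n w = (\<integral>\<^sup>+z\<in>C. ennreal \<bar>random_potential \<tau> \<xi> n w z - V z\<bar> \<partial>lborel)"

text \<open>\<open>H\<close> is a finite sum of products of a function of w and a function of z,
  hence jointly measurable, and Tonelli applies.\<close>

lemma L1_dist_measurable:
  assumes "compact C"
  shows "L1_dist C n \<in> borel_measurable M"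
proof -
  have [measurable]: "C \<in> sets borel" using assms by (intro borel_closed compact_imp_closed)
  have [measurable]: "q \<alpha> \<in> borel_measurable borel" for \<alpha>
    by (rule borel_measurable_continuous_onI[OF continuous_on_q])
  have [measurable]: "V \<in> borel_measurable borel"
    by (rule borel_measurable_continuous_onI[OF continuous_on_V])
  have "(\<lambda>(w, z). ennreal \<bar>random_potential \<tau> \<xi> n w z - V z\<bar> * indicator C z) \<in> borel_measurable (M \<Otimes>\<^sub>M lborel)"
    unfolding random_potential_def random_poly_def by measurable
  from lborel.borel_measurable_nn_integral[OF this] show ?thesis
    unfolding L1_dist_def by simp
qed

text \<open>The centres \<open>X\<close> and the radius are found before n, so finitely many
  applications of the pointwise lower bound suffice; a failure of the L1 estimate lies in
  \<open>Bad n\<close> or in one of the events \<open>E x\<close>.\<close>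

lemma L1_dist_tendsto_prob:
  assumes C: "compact C" and \<epsilon>: "\<epsilon> > 0"
  shows "(\<lambda>n. M.prob {w \<in> space M. L1_dist C n w > ennreal \<epsilon>}) \<longlonglongrightarrow> 0"
proof (rule order_tendstoI)
  fix \<eta> :: real assume \<eta>: "0 < \<eta>"
  obtain \<kappa> where \<kappa>: "\<kappa> > 0" and est:
    "\<forall>\<epsilon>>0. \<exists>X \<rho>. finite X \<and> \<rho> > 0 \<and>
       (\<forall>n m p. n > 0 \<and> p \<in> poly_fun m \<and> close_at_points V \<epsilon> X \<rho> n p \<longrightarrow>
          (\<integral>\<^sup>+z\<in>C. ennreal \<bar>ln (cmod (p z)) / real n - V z\<bar> \<partial>lborel) \<le> ennreal (\<kappa> * \<epsilon>))"
    by (rule L1_estimate_from_points[OF continuous_on_V V_nonneg C]) (rule that)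
  \<comment> \<open>Rescaling by \<kappa> is possible because \<kappa> was obtained before the error
    was chosen.\<close>
  define \<epsilon>' where "\<epsilon>' = \<epsilon> / \<kappa>"
  have \<epsilon>': "\<epsilon>' > 0" "\<kappa> * \<epsilon>' = \<epsilon>" using \<epsilon> \<kappa> by (auto simp: \<epsilon>'_def)
  from est[rule_format, OF \<epsilon>'(1)] obtain X \<rho> where X: "finite X" and \<rho>: "\<rho> > 0" and imp:
    "\<forall>n m p. n > 0 \<and> p \<in> poly_fun m \<and> close_at_points V \<epsilon>' X \<rho> n p \<longrightarrow>
          (\<integral>\<^sup>+z\<in>C. ennreal \<bar>ln (cmod (p z)) / real n - V z\<bar> \<partial>lborel) \<le> ennreal (\<kappa> * \<epsilon>')"
    by (elim exE conjE)
  \<comment> \<open>Half of \<eta> is reserved for \<open>Bad\<close>, the rest is shared among the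
    centres; the added 1 covers an empty \<open>X\<close>.\<close>
  define \<eta>' where "\<eta>' = \<eta> / (2 * (real (card X) + 1))"
  have \<eta>': "\<eta>' > 0" using \<eta> by (simp add: \<eta>'_def)
  have "\<forall>x :: 'd cspace. \<exists>F. finite F \<and> F \<subseteq> ball x \<rho> \<and> (\<forall>\<^sub>F n in sequentially.
      M.prob (low_event \<epsilon>' n F) \<le> \<eta>')"
  proof
    fix x :: "'d cspace"
    have "open (ball x \<rho>)" "ball x \<rho> \<noteq> {}" using \<rho> by auto
    from lower_bound[OF this \<epsilon>'(1) \<eta>'] obtain F where "finite F" "F \<subseteq> ball x \<rho>"
      "\<forall>\<^sub>F n in sequentially. M.prob (low_event \<epsilon>' n F) \<le> \<eta>'" .
    then show "\<exists>F. finite F \<and> F \<subseteq> ball x \<rho> \<and> (\<forall>\<^sub>F n in sequentially.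
      M.prob (low_event \<epsilon>' n F) \<le> \<eta>')"
      by (intro exI[of _ F] conjI)
  qed
  from choice[OF this] obtain F where "\<forall>x. finite (F x) \<and> F x \<subseteq> ball x \<rho> \<and> (\<forall>\<^sub>F n in sequentially.
      M.prob (low_event \<epsilon>' n (F x)) \<le> \<eta>')" ..
  then have F: "\<And>x. finite (F x)" "\<And>x. F x \<subseteq> ball x \<rho>"
    and low: "\<And>x. \<forall>\<^sub>F n in sequentially.
      M.prob (low_event \<epsilon>' n (F x)) \<le> \<eta>'"
    by simp_all
  obtain Bad where Bad: "\<And>n. Bad n \<in> sets M" "(\<lambda>n. M.prob (Bad n)) \<longlonglongrightarrow> 0"
    and up: "\<forall>\<^sub>F n in sequentially. \<forall>w\<in>space M - Bad n. \<forall>z. cmod (H n w z) \<le> exp (real n * (V z + \<epsilon>'))"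
    using upper_bound[OF \<epsilon>'(1)] by blast
  have low_all: "\<forall>\<^sub>F n in sequentially. \<forall>x\<in>X.
      M.prob (low_event \<epsilon>' n (F x)) \<le> \<eta>'"
    using X low by (simp add: eventually_ball_finite)
  have bad_small: "\<forall>\<^sub>F n in sequentially. M.prob (Bad n) < \<eta> / 2"
    using order_tendstoD(2)[OF Bad(2), of "\<eta> / 2"] \<eta> by simp
  show "\<forall>\<^sub>F n in sequentially. M.prob {w \<in> space M. L1_dist C n w > ennreal \<epsilon>} < \<eta>"
    using low_all bad_small up eventually_gt_at_top[of 0]
  proof eventually_elim
    case (elim n)
    define E where "E = (\<lambda>x. {w \<in> space M. \<forall>z\<in>F x. cmod (H n w z) < exp (real n * (V z - \<epsilon>'))})"
    have E: "E x \<in> sets M" for x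
      unfolding E_def using F(1)[of x] by (intro sets.sets_Collect_finite_All) measurable
    have sub: "{w \<in> space M. L1_dist C n w > ennreal \<epsilon>} \<subseteq> Bad n \<union> (\<Union>x\<in>X. E x)"
    proof (rule subsetI, rule ccontr)
      fix w assume w: "w \<in> {w \<in> space M. L1_dist C n w > ennreal \<epsilon>}" and "w \<notin> Bad n \<union> (\<Union>x\<in>X. E x)"
      then have 1: "\<forall>z. cmod (H n w z) \<le> exp (real n * (V z + \<epsilon>'))" using elim(3) by auto
      have 2: "\<forall>x\<in>X. \<exists>z\<in>ball x \<rho>. cmod (H n w z) \<ge> exp (real n * (V z - \<epsilon>'))"
      proof
        fix x assume "x \<in> X"
        then have "w \<notin> E x" using \<open>w \<notin> Bad n \<union> (\<Union>x\<in>X. E x)\<close> by blast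
        then obtain z where "z \<in> F x" "cmod (H n w z) \<ge> exp (real n * (V z - \<epsilon>'))"
          using w unfolding E_def by (auto simp: not_less)
        then show "\<exists>z\<in>ball x \<rho>. cmod (H n w z) \<ge> exp (real n * (V z - \<epsilon>'))" using F(2)[of x] by blast
      qed
      have "L1_dist C n w \<le> ennreal \<epsilon>"
        unfolding L1_dist_def random_potential_def \<epsilon>'(2)[symmetric]
        by (rule imp[rule_format]) (use elim(4) H_poly_fun 1 2 in \<open>auto simp: close_at_points_def\<close>)
      then show False using w by (simp add: not_less[symmetric])
    qed
    have "M.prob {w \<in> space M. L1_dist C n w > ennreal \<epsilon>} \<le> M.prob (Bad n \<union> (\<Union>x\<in>X. E x))"
      using Bad(1) E X by (intro M.finite_measure_mono sub sets.Un sets.finite_UN) auto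
    also have "\<dots> \<le> M.prob (Bad n) + M.prob (\<Union>x\<in>X. E x)"
      using Bad(1) E X by (intro measure_Un_le sets.finite_UN) auto
    also have "M.prob (\<Union>x\<in>X. E x) \<le> (\<Sum>x\<in>X. M.prob (E x))"
      using X E by (intro M.finite_measure_subadditive_finite) auto
    also have "\<dots> \<le> (\<Sum>x\<in>X. \<eta>')" by (intro sum_mono) (use elim(1) in \<open>simp add: E_def\<close>)
    also have "\<dots> \<le> \<eta> / 2" using \<eta> by (simp add: \<eta>'_def field_simps)
    finally show ?case using elim(2) by linarith
  qed
qed (auto intro!: always_eventually less_le_trans[OF _ measure_nonneg])

lemma tendsto_prob_L1loc_potential: "tendsto_prob_L1loc M (random_potential \<tau> \<xi>) V"
  unfolding tendsto_prob_L1loc_def Let_def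
proof (intro allI impI conjI)
  fix C and \<epsilon> :: real and n assume C: "compact (C :: 'd cspace set) \<and> \<epsilon> > 0"
  have [measurable]: "L1_dist C n \<in> borel_measurable M" using C by (intro L1_dist_measurable) simp
  have "{w \<in> space M. L1_dist C n w > ennreal \<epsilon>} \<in> sets M" by measurable
  then show "{w \<in> space M. ennreal \<epsilon> < (\<integral>\<^sup>+z\<in>C. ennreal \<bar>random_potential \<tau> \<xi> n w z - V z\<bar> \<partial>lborel)} \<in> sets M"
    by (simp add: L1_dist_def)
next
  fix C and \<epsilon> :: real assume C: "compact (C :: 'd cspace set) \<and> \<epsilon> > 0"
  then show "(\<lambda>n. M.prob {w \<in> space M. ennreal \<epsilon> < (\<integral>\<^sup>+z\<in>C. ennreal \<bar>random_potential \<tau> \<xi> n w z - V z\<bar> \<partial>lborel)}) \<longlonglongrightarrow> 0"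
    using L1_dist_tendsto_prob[of C \<epsilon>] by (simp add: L1_dist_def)
qed

text \<open>Balls of radius k exhaust the space, and 2^-k serves both as error and as probability.
  One null set then works for all compact sets, and hence for the uncountably many test forms
  simultaneously.\<close>

lemma zero_currents_subsequence:
  assumes r: "strict_mono (r :: nat \<Rightarrow> nat)"
  shows "\<exists>s. strict_mono s \<and>
    (AE w in M. currents_tendsto (\<lambda>k. zero_current \<tau> \<xi> (r (s k)) w) (ddc_current V))"
proof -
  have "\<forall>\<^sub>F n in sequentially.
      M.prob {w \<in> space M. L1_dist (cball 0 (real k)) (r n) w > ennreal ((1/2) ^ k)} < (1/2) ^ k" for k
  proof -
    have "(\<lambda>n. M.prob {w \<in> space M. L1_dist (cball 0 (real k)) (r n) w > ennreal ((1/2) ^ k)}) \<longlonglongrightarrow> 0"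
      using LIMSEQ_subseq_LIMSEQ[OF L1_dist_tendsto_prob[of "cball 0 (real k)" "(1/2) ^ k"] r]
      by (simp add: comp_def)
    from order_tendstoD(2)[OF this, of "(1/2) ^ k"] show ?thesis by simp
  qed
  then obtain s where s: "strict_mono s"
    "\<And>k. M.prob {w \<in> space M. L1_dist (cball 0 (real k)) (r (s k)) w > ennreal ((1/2) ^ k)} < (1/2) ^ k"
    using eventually_subsequence[of "\<lambda>k n.
      M.prob {w \<in> space M. L1_dist (cball 0 (real k)) (r n) w > ennreal ((1/2) ^ k)} < (1/2) ^ k"] by blast
  define A where "A = (\<lambda>k. {w \<in> space M. L1_dist (cball 0 (real k)) (r (s k)) w > ennreal ((1/2) ^ k)})"
  have A: "A k \<in> sets M" for k
  proof -
    have [measurable]: "L1_dist (cball 0 (real k)) (r (s k)) \<in> borel_measurable M"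
      by (intro L1_dist_measurable) simp
    show ?thesis unfolding A_def by measurable
  qed
  have "summable (\<lambda>k. M.prob (A k))"
    by (rule summable_comparison_test'[of "\<lambda>k. (1/2) ^ k" 0])
       (use s(2) in \<open>auto simp: A_def intro: less_imp_le\<close>)
  then have "AE w in M. \<forall>\<^sub>F k in sequentially. w \<in> space M - A k"
    by (intro borel_cantelli_AE1 A) (auto simp: M.emeasure_eq_measure)
  then have "AE w in M. currents_tendsto (\<lambda>k. zero_current \<tau> \<xi> (r (s k)) w) (ddc_current V)"
  proof eventually_elim
    case (elim w)
    show ?case unfolding zero_current_def
    proof (rule currents_tendsto_ddc_current[OF random_potential_measurable continuous_on_V])
      fix S :: "'d cspace set" assume "compact S"
      then obtain b where b: "\<And>x. x \<in> S \<Longrightarrow> norm x \<le> b" using compact_imp_bounded bounded_iff by metis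
      obtain k0 :: nat where k0: "b \<le> real k0" using real_arch_simple by blast
      have le: "\<forall>\<^sub>F k in sequentially. L1_dist S (r (s k)) w \<le> ennreal ((1/2) ^ k)"
        using elim eventually_ge_at_top[of k0]
      proof eventually_elim
        case (elim k)
        have "S \<subseteq> cball 0 (real k)"
        proof
          fix x assume "x \<in> S"
          then have "norm x \<le> real k" using b[of x] k0 elim(2) by linarith
          then show "x \<in> cball 0 (real k)" by simp
        qed
        then have "L1_dist S (r (s k)) w \<le> L1_dist (cball 0 (real k)) (r (s k)) w"
          unfolding L1_dist_def by (intro nn_integral_mono mult_left_mono) (auto simp: indicator_def)
        also have "\<dots> \<le> ennreal ((1/2) ^ k)" using elim(1) by (auto simp: A_def not_less)
        finally show ?case .
      qed
      have "(\<lambda>k. ennreal ((1/2) ^ k)) \<longlonglongrightarrow> ennreal 0"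
        by (intro tendsto_ennrealI LIMSEQ_realpow_zero) auto
      then have "(\<lambda>k. ennreal ((1/2) ^ k)) \<longlonglongrightarrow> 0" by simp
      from tendsto_sandwich[OF _ le tendsto_const this]
      have "(\<lambda>k. L1_dist S (r (s k)) w) \<longlonglongrightarrow> 0" by simp
      then show "(\<lambda>k. \<integral>\<^sup>+z\<in>S. ennreal \<bar>random_potential \<tau> \<xi> (r (s k)) w z - V z\<bar> \<partial>lborel) \<longlonglongrightarrow> 0"
        by (simp add: L1_dist_def)
    qed
  qed
  with s(1) show ?thesis by blast
qed

end

theorem theorem7p6:
  fixes K :: "'d::{finite,linorder} cspace set"
    and \<tau> :: "'d cspace measure"
    and M :: "'w measure"
    and \<xi> :: "'d multiindex \<Rightarrow> 'w \<Rightarrow> complex"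
  assumes "compact K" and "regular_set K" and "\<not> pluripolar K"
    and "finite_measure \<tau>" and "sets \<tau> = sets borel" and "emeasure \<tau> (- K) = 0"
    and "bernstein_markov K \<tau>"
    and "prob_space M"
    and "prob_space.indep_vars M (\<lambda>_. borel) \<xi> UNIV"
    and "\<And>\<alpha> \<beta>. distr M borel (\<xi> \<alpha>) = distr M borel (\<xi> \<beta>)"
    and "\<And>\<alpha>. nondegenerate M (\<xi> \<alpha>)"
    and "\<And>\<alpha>. (\<lambda>t::real. measure M {w \<in> space M. cmod (\<xi> \<alpha> w) > exp t})
                 \<in> o[at_top](\<lambda>t. 1 / t ^ CARD('d))"
  shows "tendsto_prob_L1loc M (random_potential \<tau> \<xi>) (\<lambda>z. real_of_ereal (extremal_function K z))
    \<and> (\<forall>r :: nat \<Rightarrow> nat. strict_mono r \<longrightarrow>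
         (\<exists>s :: nat \<Rightarrow> nat. strict_mono s \<and>
            (AE w in M. currents_tendsto (\<lambda>k. zero_current \<tau> \<xi> (r (s k)) w)
               (ddc_current (\<lambda>z. real_of_ereal (extremal_function K z))))))"
proof -
  have "K \<noteq> {}" using assms(3) pluripolar_empty by blast
  then interpret random_orthogonal_polynomials K \<tau> M \<xi>
    by (intro random_orthogonal_polynomials.intro bernstein_markov_pair.intro regular_compact.intro
        bernstein_markov_pair_axioms.intro random_orthogonal_polynomials_axioms.intro assms)
  have "(\<lambda>z. real_of_ereal (extremal_function K z)) = V" by (simp add: V_def fun_eq_iff)
  then show ?thesis using tendsto_prob_L1loc_potential zero_currents_subsequence by simp
qed

end
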